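(* In the theory $\mathrm{ACFG}$ (for any fixed prime characteristic $p$), one has $\perp^{\mathrm{alg}}=(\perp^a)^m=(\perp^a)^M$, and $\perp^d\to\perp^K\to(\perp^a)^M$.
   Context: Fix a prime $p$. Let $\mathscr L_G$ be the language of rings expanded by a unary predicate $G$, and let $T_G$ be the $\mathscr L_G$-theory whose models are the fields of characteristic $p$ in which $G$ is an additive subgroup. It is known that $T_G$ has a model-companion, denoted $\mathrm{ACFG}$; it is NSOP$_1$ and not simple. Let $(K,G)$ be a monster model of $\mathrm{ACFG}$. For a subset $A$ of $K$, $A^{\mathrm{alg}}$ is the field-theoretic algebraic closure, which coincides with the model-theoretic $\mathrm{acl}(A)$, and $G(A):=G\cap A$. $A\perp^{\mathrm{alg}}_C B$ denotes algebraic independence in the sense of fields. Kim-independence $\perp^K$ in $\mathrm{ACFG}$ is given by: $A\perp^K_C B$ iff $A\perp^{\mathrm{alg}}_C B$ and $G((AC)^{\mathrm{alg}}+(BC)^{\mathrm{alg}})=G((AC)^{\mathrm{alg}})+G((BC)^{\mathrm{alg}})$. $A\perp^d_C B$ means that $\mathrm{tp}(A/BC)$ does not divide over $C$. $A\perp^a_C B$ means $\mathrm{acl}(AC)\cap\mathrm{acl}(BC)=\mathrm{acl}(C)$. For a ternary relation $\perp$ on small subsets: $A\perp^M_C B$ iff $A\perp_D B$ for all $D$ with $C\subseteq D\subseteq\mathrm{acl}(BC)$; $A\perp^m_C B$ iff $A\perp_D B$ for all $D$ with $C\subseteq D\subseteq BC$. Write $\perp^0\to\perp$ if $A\perp^0_C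 B$ implies $A\perp_C B$ for all $A,B,C$. *)

theory Defs
  imports "HOL-Algebra.Algebra" "HOL-Library.Infinite_Typeclass"
begin

unbundle cardinal_syntax

section \<open>First-order logic for the language of rings with a unary predicate\<close>

datatype LG_term =
    Var nat
  | Zero
  | One
  | Opp LG_term
  | Add LG_term LG_term
  | Mul LG_term LG_term

datatype LG_form =
    Eq LG_term LG_term
  | InG LG_term
  | Not LG_form
  | And LG_form LG_form
  | Ex nat LG_form

abbreviation Imp :: "LG_form \<Rightarrow> LG_form \<Rightarrow> LG_form"
  where "Imp \<phi> \<psi> \<equiv> Not (And \<phi> (Not \<psi>))"

abbreviation All :: "nat \<Rightarrow> LG_form \<Rightarrow> LG_form"
  where "All n \<phi> \<equiv> Not (Ex n (Not \<phi>))"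

primrec term_vars :: "LG_term \<Rightarrow> nat set" where
  "term_vars (Var n) = {n}"
| "term_vars Zero = {}"
| "term_vars One = {}"
| "term_vars (Opp t) = term_vars t"
| "term_vars (Add t u) = term_vars t \<union> term_vars u"
| "term_vars (Mul t u) = term_vars t \<union> term_vars u"

primrec free_vars :: "LG_form \<Rightarrow> nat set" where
  "free_vars (Eq t u) = term_vars t \<union> term_vars u"
| "free_vars (InG t) = term_vars t"
| "free_vars (Not \<phi>) = free_vars \<phi>"
| "free_vars (And \<phi> \<psi>) = free_vars \<phi> \<union> free_vars \<psi>"
| "free_vars (Ex n \<phi>) = free_vars \<phi> - {n}"

definition sentence :: "LG_form \<Rightarrow> bool"
  where "sentence \<phi> \<longleftrightarrow> free_vars \<phi> = {}"

record 'a LG_struct = "'a ring" +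
  opp :: "'a \<Rightarrow> 'a"
  Gset :: "'a set"

definition LG_structure :: "'a LG_struct \<Rightarrow> bool" where
  "LG_structure M \<longleftrightarrow>
     \<zero>\<^bsub>M\<^esub> \<in> carrier M \<and> \<one>\<^bsub>M\<^esub> \<in> carrier M \<and>
     (\<forall>x\<in>carrier M. opp M x \<in> carrier M) \<and>
     (\<forall>x\<in>carrier M. \<forall>y\<in>carrier M. x \<oplus>\<^bsub>M\<^esub> y \<in> carrier M \<and> x \<otimes>\<^bsub>M\<^esub> y \<in> carrier M) \<and>
     Gset M \<subseteq> carrier M"

primrec tval :: "'a LG_struct \<Rightarrow> (nat \<Rightarrow> 'a) \<Rightarrow> LG_term \<Rightarrow> 'a" where
  "tval M s (Var n) = s n"
| "tval M s Zero = \<zero>\<^bsub>M\<^esub>"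
| "tval M s One = \<one>\<^bsub>M\<^esub>"
| "tval M s (Opp t) = opp M (tval M s t)"
| "tval M s (Add t u) = tval M s t \<oplus>\<^bsub>M\<^esub> tval M s u"
| "tval M s (Mul t u) = tval M s t \<otimes>\<^bsub>M\<^esub> tval M s u"

primrec sat :: "'a LG_struct \<Rightarrow> (nat \<Rightarrow> 'a) \<Rightarrow> LG_form \<Rightarrow> bool" where
  "sat M s (Eq t u) \<longleftrightarrow> tval M s t = tval M s u"
| "sat M s (InG t) \<longleftrightarrow> tval M s t \<in> Gset M"
| "sat M s (Not \<phi>) \<longleftrightarrow> \<not> sat M s \<phi>"
| "sat M s (And \<phi> \<psi>) \<longleftrightarrow> sat M s \<phi> \<and> sat M s \<psi>"
| "sat M s (Ex n \<phi>) \<longleftrightarrow> (\<exists>x\<in>carrier M. sat M (s(n := x)) \<phi>)"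

definition is_model :: "'a LG_struct \<Rightarrow> LG_form set \<Rightarrow> bool" where
  "is_model M T \<longleftrightarrow>
     LG_structure M \<and> (\<forall>\<phi>\<in>T. \<forall>s. range s \<subseteq> carrier M \<longrightarrow> sat M s \<phi>)"

definition embedding :: "('a \<Rightarrow> 'b) \<Rightarrow> 'a LG_struct \<Rightarrow> 'b LG_struct \<Rightarrow> bool" where
  "embedding f M N \<longleftrightarrow>
     f ` carrier M \<subseteq> carrier N \<and> inj_on f (carrier M) \<and>
     f \<zero>\<^bsub>M\<^esub> = \<zero>\<^bsub>N\<^esub> \<and> f \<one>\<^bsub>M\<^esub> = \<one>\<^bsub>N\<^esub> \<and>
     (\<forall>x\<in>carrier M. f (opp M x) = opp N (f x)) \<and>
     (\<forall>x\<in>carrier M. \<forall>y\<in>carrier M.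
        f (x \<oplus>\<^bsub>M\<^esub> y) = f x \<oplus>\<^bsub>N\<^esub> f y \<and> f (x \<otimes>\<^bsub>M\<^esub> y) = f x \<otimes>\<^bsub>N\<^esub> f y) \<and>
     (\<forall>x\<in>carrier M. f x \<in> Gset N \<longleftrightarrow> x \<in> Gset M)"

definition elementary :: "('a \<Rightarrow> 'b) \<Rightarrow> 'a LG_struct \<Rightarrow> 'b LG_struct \<Rightarrow> bool" where
  "elementary f M N \<longleftrightarrow>
     f ` carrier M \<subseteq> carrier N \<and>
     (\<forall>\<phi> s. range s \<subseteq> carrier M \<longrightarrow> (sat M s \<phi> \<longleftrightarrow> sat N (f \<circ> s) \<phi>))"

definition automorphism :: "('a \<Rightarrow> 'a) \<Rightarrow> 'a LG_struct \<Rightarrow> bool" where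
  "automorphism \<sigma> M \<longleftrightarrow> embedding \<sigma> M M \<and> \<sigma> ` carrier M = carrier M"


section \<open>Model companions\<close>

text \<open>
  HOL cannot quantify over all structures, only over those whose carrier is a subset of
  some given type. Since the language is countable, the Loewenheim-Skolem theorem shows
  that for an infinite type this yields the usual notions.
\<close>

definition model_complete :: "'a::infinite itself \<Rightarrow> LG_form set \<Rightarrow> bool" where
  "model_complete _ T \<longleftrightarrow>
     (\<forall>(M :: 'a LG_struct) (N :: 'a LG_struct) f.
        is_model M T \<and> is_model N T \<and> embedding f M N \<longrightarrow> elementary f M N)"

definition model_companion :: "'a::infinite itself \<Rightarrow> LG_form set \<Rightarrow> LG_form set \<Rightarrow> bool" where
  "model_companion U T T' \<longleftrightarrow>
     (\<forall>\<phi>\<in>T'. sentence \<phi>) \<and>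
     (\<forall>M :: 'a LG_struct. is_model M T \<longrightarrow>
        (\<exists>(N :: 'a LG_struct) f. is_model N T' \<and> embedding f M N)) \<and>
     (\<forall>M :: 'a LG_struct. is_model M T' \<longrightarrow>
        (\<exists>(N :: 'a LG_struct) f. is_model N T \<and> embedding f M N)) \<and>
     model_complete U T'"


section \<open>The theory of fields of characteristic p with an additive subgroup\<close>

primrec nat_term :: "nat \<Rightarrow> LG_term" where
  "nat_term 0 = Zero"
| "nat_term (Suc n) = Add (nat_term n) One"

definition T_G :: "nat \<Rightarrow> LG_form set" where
  "T_G p =
    (let x = Var 0; y = Var 1; z = Var 2 in
     {All 0 (All 1 (All 2 (Eq (Add (Add x y) z) (Add x (Add y z))))),
      All 0 (All 1 (Eq (Add x y) (Add y x))),
      All 0 (Eq (Add x Zero) x),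
      All 0 (Eq (Add x (Opp x)) Zero),
      All 0 (All 1 (All 2 (Eq (Mul (Mul x y) z) (Mul x (Mul y z))))),
      All 0 (All 1 (Eq (Mul x y) (Mul y x))),
      All 0 (Eq (Mul x One) x),
      All 0 (All 1 (All 2 (Eq (Mul x (Add y z)) (Add (Mul x y) (Mul x z))))),
      Not (Eq Zero One),
      All 0 (Imp (Not (Eq x Zero)) (Ex 1 (Eq (Mul x y) One))),
      Eq (nat_term p) Zero,
      InG Zero,
      All 0 (All 1 (Imp (And (InG x) (InG y)) (InG (Add x y)))),
      All 0 (Imp (InG x) (InG (Opp x)))})"


lemma tval_nat_term: "tval M s (nat_term n) = [n] \<cdot>\<^bsub>M\<^esub> \<one>\<^bsub>M\<^esub>"
  by (induction n) (simp_all add: add_pow_def)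

lemma is_model_T_G_imp:
  assumes "is_model M (T_G p)"
  shows "field M" "additive_subgroup (Gset M) M" "[p] \<cdot>\<^bsub>M\<^esub> \<one>\<^bsub>M\<^esub> = \<zero>\<^bsub>M\<^esub>"
    "\<forall>x\<in>carrier M. opp M x = \<ominus>\<^bsub>M\<^esub> x"
proof -
  have str: "LG_structure M"
    and mod: "\<And>\<phi>. \<phi> \<in> T_G p \<Longrightarrow> sat M (\<lambda>_. \<zero>\<^bsub>M\<^esub>) \<phi>"
    using assms by (auto simp: is_model_def LG_structure_def)
  have ax: "\<forall>\<phi>\<in>T_G p. sat M (\<lambda>_. \<zero>\<^bsub>M\<^esub>) \<phi>"
    using mod by blast
  note ax' = ax[unfolded T_G_def Let_def, simplified]
  have nt: "[p] \<cdot>\<^bsub>M\<^esub> \<one>\<^bsub>M\<^esub> = \<zero>\<^bsub>M\<^esub>"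
    using ax' by (simp add: tval_nat_term)
  have comm: "x \<oplus>\<^bsub>M\<^esub> y = y \<oplus>\<^bsub>M\<^esub> x" "x \<otimes>\<^bsub>M\<^esub> y = y \<otimes>\<^bsub>M\<^esub> x"
    if "x \<in> carrier M" "y \<in> carrier M" for x y
    using ax' that by auto
  have grp: "abelian_group M"
  proof (rule abelian_groupI)
    fix x assume x: "x \<in> carrier M"
    have "opp M x \<in> carrier M" "opp M x \<oplus>\<^bsub>M\<^esub> x = \<zero>\<^bsub>M\<^esub>"
      using str ax' x comm by (auto simp: LG_structure_def)
    then show "\<exists>y\<in>carrier M. y \<oplus>\<^bsub>M\<^esub> x = \<zero>\<^bsub>M\<^esub>" by blast
    show "\<zero>\<^bsub>M\<^esub> \<oplus>\<^bsub>M\<^esub> x = x"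
      using str ax' x comm by (auto simp: LG_structure_def)
  qed (use str ax' in \<open>auto simp: LG_structure_def\<close>)
  interpret abelian_group M by (rule grp)
  have mon: "comm_monoid M"
    by (rule comm_monoidI) (use str ax' comm in \<open>auto simp: LG_structure_def\<close>)
  have cr: "cring M"
    by (rule cringI[OF grp mon]) (use str ax' comm in \<open>auto simp: LG_structure_def\<close>)
  interpret cring M by (rule cr)
  have inv: "\<exists>b\<in>carrier M. a \<otimes>\<^bsub>M\<^esub> b = \<one>\<^bsub>M\<^esub>" if "a \<in> carrier M" "a \<noteq> \<zero>\<^bsub>M\<^esub>" for a
    using ax' that by blast
  show "field M"
    by (rule cring_fieldI2) (use ax' inv in auto)
  show opp: "\<forall>x\<in>carrier M. opp M x = \<ominus>\<^bsub>M\<^esub> x"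
    using str ax' by (auto simp: LG_structure_def intro!: minus_equality[symmetric] dest: comm)
  show "additive_subgroup (Gset M) M"
  proof (rule additive_subgroup.intro, rule add.subgroupI)
    show "Gset M \<subseteq> carrier M" "Gset M \<noteq> {}"
      using str ax' by (auto simp: LG_structure_def)
    fix a assume a: "a \<in> Gset M"
    then have "a \<in> carrier M" "opp M a \<in> Gset M"
      using str ax' by (auto simp: LG_structure_def)
    then show "\<ominus>\<^bsub>M\<^esub> a \<in> Gset M" using opp by simp
    fix b assume b: "b \<in> Gset M"
    have add: "\<forall>x\<in>carrier M. x \<in> Gset M \<longrightarrow>
        (\<forall>y\<in>carrier M. y \<in> Gset M \<longrightarrow> x \<oplus>\<^bsub>M\<^esub> y \<in> Gset M)"
      using ax' by (elim conjE)
    have "a \<in> carrier M" "b \<in> carrier M"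
      using a b str by (auto simp: LG_structure_def)
    with add a b show "a \<oplus>\<^bsub>M\<^esub> b \<in> Gset M"
      by simp
  qed
  show "[p] \<cdot>\<^bsub>M\<^esub> \<one>\<^bsub>M\<^esub> = \<zero>\<^bsub>M\<^esub>" by (rule nt)
qed

lemma is_model_T_GI:
  fixes M :: "'a LG_struct"
  assumes "field M" "additive_subgroup (Gset M) M" "[p] \<cdot>\<^bsub>M\<^esub> \<one>\<^bsub>M\<^esub> = \<zero>\<^bsub>M\<^esub>"
    "\<forall>x\<in>carrier M. opp M x = \<ominus>\<^bsub>M\<^esub> x"
  shows "is_model M (T_G p)"
proof -
  interpret field M by fact
  interpret additive_subgroup "Gset M" M by fact
  have inv: "\<exists>b\<in>carrier M. a \<otimes>\<^bsub>M\<^esub> b = \<one>\<^bsub>M\<^esub>" if "a \<in> carrier M" "a \<noteq> \<zero>\<^bsub>M\<^esub>" for a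
    using that field_Units Units_r_inv_ex by blast
  show ?thesis
    using assms(3,4) inv a_subset a_closed
    by (auto simp: is_model_def LG_structure_def T_G_def Let_def tval_nat_term a_assoc m_assoc
        a_comm m_comm a_lcomm m_lcomm r_distr r_neg subset_iff)
qed

text \<open>For prime p, the last equation says that the field M has characteristic p.\<close>

theorem is_model_T_G_iff:
  "is_model M (T_G p) \<longleftrightarrow>
     field M \<and> additive_subgroup (Gset M) M \<and> (\<forall>x\<in>carrier M. opp M x = \<ominus>\<^bsub>M\<^esub> x) \<and>
     [p] \<cdot>\<^bsub>M\<^esub> \<one>\<^bsub>M\<^esub> = \<zero>\<^bsub>M\<^esub>"
  using is_model_T_G_imp is_model_T_GI by metis


section \<open>Types, algebraic closure, saturation\<close>

text \<open>
  A formula with parameters is a pair of a formula and a tuple of parameters. The tuple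
  assigned to a formula is substituted for the variables 0, 1, 2, and so on; the default
  value is irrelevant for formulas whose free variables are covered by the tuple.
\<close>

definition tuple :: "'a LG_struct \<Rightarrow> 'a list \<Rightarrow> nat \<Rightarrow> 'a" where
  "tuple M xs i = (if i < length xs then xs ! i else \<zero>\<^bsub>M\<^esub>)"

definition formulas_over :: "nat \<Rightarrow> 'a set \<Rightarrow> (LG_form \<times> 'a list) set" where
  "formulas_over n C = {(\<phi>, cs). set cs \<subseteq> C \<and> free_vars \<phi> \<subseteq> {..<n + length cs}}"

definition holds :: "'a LG_struct \<Rightarrow> 'a list \<Rightarrow> LG_form \<times> 'a list \<Rightarrow> bool" where
  "holds M xs \<Phi> \<longleftrightarrow> sat M (tuple M (xs @ snd \<Phi>)) (fst \<Phi>)"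

definition tp :: "'a LG_struct \<Rightarrow> 'a list \<Rightarrow> 'a set \<Rightarrow> (LG_form \<times> 'a list) set" where
  "tp M xs C = {\<Phi> \<in> formulas_over (length xs) C. holds M xs \<Phi>}"

definition acl :: "'a LG_struct \<Rightarrow> 'a set \<Rightarrow> 'a set" where
  "acl M A = {x \<in> carrier M. \<exists>\<Phi> \<in> formulas_over 1 A.
     holds M [x] \<Phi> \<and> finite {y \<in> carrier M. holds M [y] \<Phi>}}"

definition saturated :: "'c rel \<Rightarrow> 'a LG_struct \<Rightarrow> bool" where
  "saturated \<kappa> M \<longleftrightarrow>
     (\<forall>C \<Sigma>. C \<subseteq> carrier M \<and> |C| <o \<kappa> \<and> \<Sigma> \<subseteq> formulas_over 1 C \<and>
        (\<forall>\<Sigma>'. finite \<Sigma>' \<and> \<Sigma>' \<subseteq> \<Sigma> \<longrightarrow> (\<exists>x\<in>carrier M. \<forall>\<Phi>\<in>\<Sigma>'. holds M [x] \<Phi>))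
        \<longrightarrow> (\<exists>x\<in>carrier M. \<forall>\<Phi>\<in>\<Sigma>. holds M [x] \<Phi>))"

definition partial_elementary :: "('a \<Rightarrow> 'a) \<Rightarrow> 'a set \<Rightarrow> 'a LG_struct \<Rightarrow> bool" where
  "partial_elementary f A M \<longleftrightarrow>
     f ` A \<subseteq> carrier M \<and>
     (\<forall>\<phi> xs. set xs \<subseteq> A \<and> free_vars \<phi> \<subseteq> {..<length xs} \<longrightarrow>
        (sat M (tuple M xs) \<phi> \<longleftrightarrow> sat M (tuple M (map f xs)) \<phi>))"

definition strongly_homogeneous :: "'c rel \<Rightarrow> 'a LG_struct \<Rightarrow> bool" where
  "strongly_homogeneous \<kappa> M \<longleftrightarrow>
     (\<forall>A f. A \<subseteq> carrier M \<and> |A| <o \<kappa> \<and> partial_elementary f A M \<longrightarrow>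
        (\<exists>\<sigma>. automorphism \<sigma> M \<and> (\<forall>x\<in>A. \<sigma> x = f x)))"

text \<open>Of the cardinal \<open>\<kappa>\<close> we only require that it is uncountable, the language being countable.\<close>

definition monster_model :: "'c rel \<Rightarrow> LG_form set \<Rightarrow> 'a LG_struct \<Rightarrow> bool" where
  "monster_model \<kappa> T M \<longleftrightarrow>
     Card_order \<kappa> \<and> natLeq <o \<kappa> \<and>
     is_model M T \<and> saturated \<kappa> M \<and> strongly_homogeneous \<kappa> M"

definition small :: "'c rel \<Rightarrow> 'a LG_struct \<Rightarrow> 'a set \<Rightarrow> bool" where
  "small \<kappa> M A \<longleftrightarrow> A \<subseteq> carrier M \<and> |A| <o \<kappa>"


section \<open>Algebraic independence in fields\<close>

definition alg :: "'a LG_struct \<Rightarrow> 'a set \<Rightarrow> 'a set" where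
  "alg K A = {x \<in> carrier K. ring.algebraic K (generate_field K A) x}"

text \<open>
  For a finite set S: no non-trivial polynomial relation over F. A polynomial in the
  variables indexed by S is given by its finite set E of exponents and its coefficients c.
\<close>

definition alg_independent :: "'a LG_struct \<Rightarrow> 'a set \<Rightarrow> 'a set \<Rightarrow> bool" where
  "alg_independent K F S \<longleftrightarrow>
     (\<forall>E c. finite E \<and> E \<subseteq> (S \<rightarrow>\<^sub>E (UNIV :: nat set)) \<and> c ` E \<subseteq> F \<and>
        (\<Oplus>\<^bsub>K\<^esub>e\<in>E. c e \<otimes>\<^bsub>K\<^esub> (\<Otimes>\<^bsub>K\<^esub>x\<in>S. x [^]\<^bsub>K\<^esub> e x)) = \<zero>\<^bsub>K\<^esub>
        \<longrightarrow> (\<forall>e\<in>E. c e = \<zero>\<^bsub>K\<^esub>))"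


section \<open>Ternary relations\<close>

text \<open>The arguments of a ternary relation are ordered as in \<open>A \<perp>\<^sub>C B\<close>: first A, then the base C, then B.\<close>

type_synonym 'a ternary = "'a set \<Rightarrow> 'a set \<Rightarrow> 'a set \<Rightarrow> bool"

definition indep_alg :: "'a LG_struct \<Rightarrow> 'a ternary" where
  "indep_alg K A C B \<longleftrightarrow>
     (\<forall>S. finite S \<and> S \<subseteq> A \<and> alg_independent K (generate_field K C) S
        \<longrightarrow> alg_independent K (generate_field K (B \<union> C)) S)"

definition indep_a :: "'a LG_struct \<Rightarrow> 'a ternary" where
  "indep_a K A C B \<longleftrightarrow> acl K (A \<union> C) \<inter> acl K (B \<union> C) = acl K C"

definition indep_K :: "'a LG_struct \<Rightarrow> 'a ternary" where
  "indep_K K A C B \<longleftrightarrow>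
     indep_alg K A C B \<and>
     Gset K \<inter> (alg K (A \<union> C) <+>\<^bsub>K\<^esub> alg K (B \<union> C)) =
       (Gset K \<inter> alg K (A \<union> C)) <+>\<^bsub>K\<^esub> (Gset K \<inter> alg K (B \<union> C))"

text \<open>The formula \<open>\<phi>(x, bs)\<close>, with x an n-tuple of variables, divides over C.\<close>

definition formula_divides :: "'a LG_struct \<Rightarrow> nat \<Rightarrow> LG_form \<times> 'a list \<Rightarrow> 'a set \<Rightarrow> bool" where
  "formula_divides M n \<Phi> C \<longleftrightarrow>
     (case \<Phi> of (\<phi>, bs) \<Rightarrow>
       \<exists>(k::nat) b :: nat \<Rightarrow> 'a list.
         (\<forall>i. set (b i) \<subseteq> carrier M \<and> length (b i) = length bs \<and> tp M (b i) C = tp M bs C) \<and>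
         (\<forall>I. finite I \<and> card I = k \<longrightarrow>
            \<not> (\<exists>xs. length xs = n \<and> set xs \<subseteq> carrier M \<and> (\<forall>i\<in>I. holds M xs (\<phi>, b i)))))"

text \<open>
  A formula in the type of (an enumeration of) A over \<open>B \<union> C\<close> involves only a finite
  tuple \<open>as\<close> of elements of A.
\<close>

definition indep_d :: "'a LG_struct \<Rightarrow> 'a ternary" where
  "indep_d M A C B \<longleftrightarrow>
     \<not> (\<exists>as \<Phi>. set as \<subseteq> A \<and> \<Phi> \<in> tp M as (B \<union> C) \<and> formula_divides M (length as) \<Phi> C)"

definition upper_M :: "'a LG_struct \<Rightarrow> 'a ternary \<Rightarrow> 'a ternary" where
  "upper_M M R A C B \<longleftrightarrow> (\<forall>D. C \<subseteq> D \<and> D \<subseteq> acl M (B \<union> C) \<longrightarrow> R A D B)"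

definition upper_m :: "'a ternary \<Rightarrow> 'a ternary" where
  "upper_m R A C B \<longleftrightarrow> (\<forall>D. C \<subseteq> D \<and> D \<subseteq> B \<union> C \<longrightarrow> R A D B)"

definition ternary_imp :: "'c rel \<Rightarrow> 'a LG_struct \<Rightarrow> 'a ternary \<Rightarrow> 'a ternary \<Rightarrow> bool" where
  "ternary_imp \<kappa> M R R' \<longleftrightarrow>
     (\<forall>A B C. small \<kappa> M A \<and> small \<kappa> M B \<and> small \<kappa> M C \<longrightarrow> R A C B \<longrightarrow> R' A C B)"

definition ternary_eq :: "'c rel \<Rightarrow> 'a LG_struct \<Rightarrow> 'a ternary \<Rightarrow> 'a ternary \<Rightarrow> bool" where
  "ternary_eq \<kappa> M R R' \<longleftrightarrow>
     (\<forall>A B C. small \<kappa> M A \<and> small \<kappa> M B \<and> small \<kappa> M C \<longrightarrow> (R A C B \<longleftrightarrow> R' A C B))"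

end

theory Submission
  imports Defs
begin

text \<open>
  The model companion makes K existentially closed among the fields with an additive subgroup.
  Over an algebraically closed subfield F, two copies f, g of K embed in a common field with
  f(K) \<inter> g(K) = F: by the Nullstellensatz, any finitely many nonzero elements of K are kept
  nonzero by a homomorphism over F from a finitely generated ring to F, and g is the limit of
  such homomorphisms in a quotient of a power of K. Put f(G) + g(G) on the field generated by
  both copies; by model completeness, both embeddings become elementary. Two consequences follow.
  First, acl is the field-theoretic algebraic closure, so that the statements on algebraic
  independence are about the pregeometry of algebraic dependence, where the minimal
  counterexample to independence over BC adds a single element of B to the base and
  contradicts the exchange property. Second, if v is algebraic over BC but not in H + acl(C),
  where H is 0 or G, then there are infinitely many conjugates of v over C that are pairwise
  incongruent modulo H. So the formula stating that an element algebraic over x is congruent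
  to v modulo H divides over C. The case H = 0 yields independence in the sense of acl over all
  bases between C and BC, because non-dividing is base monotone; the case H = G yields the
  condition on G in Kim-independence.
\<close>

section \<open>Algebraic elements\<close>

text \<open>Why the sum of groups works: if f(a) = f(x) + g(y) with x, y in G, then f(a - x) = g(y);
  as f and g agree wherever the two copies meet, y = a - x, and a is in G. So f(G) + g(G) induces G
  on both copies as soon as they meet only in F, and this is all that the amalgam has to provide;
  specializations into F deliver it. Two obstacles shape the rest. Model completeness and the
  companion axioms speak of structures on the type of K alone, so the amalgam is cut down to the
  field generated by both copies, which is small enough to be moved to that type. And lying outside
  H + acl(C) is not a first-order condition; it is replaced by being incongruent to finitely many
  witnesses in acl(C), named by polynomials with coefficients from C, so that the condition passes
  to conjugates over C. Conjugates are then chosen recursively, and k exceeds the number of roots of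
  the polynomial on the side of A.\<close>

locale LG_field = field K for K :: "'a LG_struct" (structure)

text \<open>Denominators are cleared below into an arbitrary such T. It is instantiated by the
  polynomials over a field in a finite set (\<open>poly_values\<close>) and by the values of terms
  of the language (\<open>term_values\<close>), the latter because terms contain no
  inverses.\<close>

definition (in ring) ring_closed :: "'a set \<Rightarrow> bool" where
  "ring_closed T \<longleftrightarrow> T \<subseteq> carrier R \<and> \<one> \<in> T \<and> (\<forall>x\<in>T. \<ominus> x \<in> T) \<and>
     (\<forall>x\<in>T. \<forall>y\<in>T. x \<oplus> y \<in> T \<and> x \<otimes> y \<in> T)"

context field
begin

lemma finite_support_generate_field:
  assumes "x \<in> generate_field R A"
  obtains A0 where "finite A0" "A0 \<subseteq> A" "x \<in> generate_field R A0"
proof -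
  have mono: "generate_field R I \<subseteq> generate_field R J" if "I \<subseteq> J" for I J
  proof
    fix x assume "x \<in> generate_field R I"
    then show "x \<in> generate_field R J"
      by induction (use that in \<open>auto intro: generate_field.intros\<close>)
  qed
  have "\<exists>A0. finite A0 \<and> A0 \<subseteq> A \<and> x \<in> generate_field R A0"
    using assms
  proof induction
    case one
    then show ?case by (auto intro: generate_field.intros)
  next
    case (incl h)
    then show ?case by (intro exI[of _ "{h}"]) (auto intro: generate_field.intros)
  next
    case (eng_add h1 h2)
    then obtain A1 A2 where "finite A1" "A1 \<subseteq> A" "h1 \<in> generate_field R A1"
      "finite A2" "A2 \<subseteq> A" "h2 \<in> generate_field R A2" by blast
    moreover from this have "h1 \<in> generate_field R (A1 \<union> A2)" "h2 \<in> generate_field R (A1 \<union> A2)"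
      using mono[OF Un_upper1] mono[OF Un_upper2] by blast+
    ultimately show ?case
      using generate_field.eng_add by (intro exI[of _ "A1 \<union> A2"]) simp
  next
    case (eng_mult h1 h2)
    then obtain A1 A2 where "finite A1" "A1 \<subseteq> A" "h1 \<in> generate_field R A1"
      "finite A2" "A2 \<subseteq> A" "h2 \<in> generate_field R A2" by blast
    moreover from this have "h1 \<in> generate_field R (A1 \<union> A2)" "h2 \<in> generate_field R (A1 \<union> A2)"
      using mono[OF Un_upper1] mono[OF Un_upper2] by blast+
    ultimately show ?case
      using generate_field.eng_mult by (intro exI[of _ "A1 \<union> A2"]) simp
  qed (blast intro: generate_field.intros)+
  then show thesis using that by blast
qed

text \<open>The fractions with numerator and denominator in T form a field containing A. Writing b x
  = a in place of x = a / b keeps most cases polynomial identities; only the inverse has to know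
  that the numerator is nonzero, and it exchanges the two.\<close>

lemma generate_field_fraction:
  assumes T: "ring_closed T" and A: "A \<subseteq> T" and x: "x \<in> generate_field R A"
  shows "\<exists>a\<in>T. \<exists>b\<in>T. b \<noteq> \<zero> \<and> b \<otimes> x = a"
proof -
  have Tc: "T \<subseteq> carrier R" using T by (simp add: ring_closed_def)
  have Ac: "A \<subseteq> carrier R" using Tc A by blast
  show ?thesis using x
  proof induction
    case one
    have "\<one> \<in> T" using T by (simp add: ring_closed_def)
    then show ?case by (intro bexI[of _ "\<one>"]) auto
  next
    case (incl h)
    have "\<one> \<in> T" using T by (simp add: ring_closed_def)
    then show ?case using incl A Tc by (intro bexI[of _ h] bexI[of _ "\<one>"]) auto
  next
    case (a_inv h)
    then obtain a b where ab: "a \<in> T" "b \<in> T" "b \<noteq> \<zero>" "b \<otimes> h = a" by blast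
    have "h \<in> carrier R" using a_inv generate_field_in_carrier[OF Ac] by blast
    then have "b \<otimes> (\<ominus> h) = \<ominus> a" using ab Tc by (auto simp: r_minus subset_iff)
    then show ?case using ab T by (auto simp: ring_closed_def)
  next
    case (m_inv h)
    then obtain a b where ab: "a \<in> T" "b \<in> T" "b \<noteq> \<zero>" "b \<otimes> h = a" by blast
    have h: "h \<in> carrier R" using m_inv generate_field_in_carrier[OF Ac] by blast
    have bc: "b \<in> carrier R" using ab Tc by blast
    have "a \<noteq> \<zero>" using ab h bc m_inv(2) integral[of b h] by auto
    moreover have "a \<otimes> inv h = b"
      unfolding ab(4)[symmetric] using h bc m_inv(2) field_Units by (simp add: m_assoc)
    ultimately show ?case using ab by blast
  next
    case (eng_add h1 h2)
    then obtain a b c d where ab: "a \<in> T" "b \<in> T" "b \<noteq> \<zero>" "b \<otimes> h1 = a"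
      "c \<in> T" "d \<in> T" "d \<noteq> \<zero>" "d \<otimes> h2 = c" by blast
    have h: "h1 \<in> carrier R" "h2 \<in> carrier R"
      using eng_add generate_field_in_carrier[OF Ac] by blast+
    have cc: "b \<in> carrier R" "d \<in> carrier R" using ab Tc by blast+
    have "(b \<otimes> d) \<otimes> (h1 \<oplus> h2) = d \<otimes> (b \<otimes> h1) \<oplus> b \<otimes> (d \<otimes> h2)"
      using h cc by algebra
    then have "(b \<otimes> d) \<otimes> (h1 \<oplus> h2) = d \<otimes> a \<oplus> b \<otimes> c" using ab by simp
    moreover have "b \<otimes> d \<noteq> \<zero>" using ab cc integral by blast
    moreover have "b \<otimes> d \<in> T" "d \<otimes> a \<oplus> b \<otimes> c \<in> T" using ab T by (auto simp: ring_closed_def)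
    ultimately show ?case by blast
  next
    case (eng_mult h1 h2)
    then obtain a b c d where ab: "a \<in> T" "b \<in> T" "b \<noteq> \<zero>" "b \<otimes> h1 = a"
      "c \<in> T" "d \<in> T" "d \<noteq> \<zero>" "d \<otimes> h2 = c" by blast
    have h: "h1 \<in> carrier R" "h2 \<in> carrier R"
      using eng_mult generate_field_in_carrier[OF Ac] by blast+
    have cc: "b \<in> carrier R" "d \<in> carrier R" using ab Tc by blast+
    have "(b \<otimes> d) \<otimes> (h1 \<otimes> h2) = (b \<otimes> h1) \<otimes> (d \<otimes> h2)"
      using h cc by algebra
    then have "(b \<otimes> d) \<otimes> (h1 \<otimes> h2) = a \<otimes> c" using ab by simp
    moreover have "b \<otimes> d \<noteq> \<zero>" using ab cc integral by blast
    moreover have "b \<otimes> d \<in> T" "a \<otimes> c \<in> T" using ab T by (auto simp: ring_closed_def)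
    ultimately show ?case by blast
  qed
qed

lemma common_denominator:
  assumes T: "ring_closed T" and A: "A \<subseteq> T" and p: "set p \<subseteq> generate_field R A"
  shows "\<exists>d\<in>T. d \<noteq> \<zero> \<and> (\<forall>x\<in>set p. d \<otimes> x \<in> T)"
  using p
proof (induction p)
  case Nil
  have "\<one> \<in> T" using T by (simp add: ring_closed_def)
  then show ?case by (intro bexI[of _ "\<one>"]) auto
next
  case (Cons y p)
  have Tc: "T \<subseteq> carrier R" using T by (simp add: ring_closed_def)
  have Ac: "A \<subseteq> carrier R" using Tc A by blast
  have pc: "set (y # p) \<subseteq> carrier R" using Cons.prems generate_field_incl[OF Ac] by blast
  obtain d where d: "d \<in> T" "d \<noteq> \<zero>" "\<forall>x\<in>set p. d \<otimes> x \<in> T" using Cons by auto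
  obtain b where b: "b \<in> T" "b \<noteq> \<zero>" "b \<otimes> y \<in> T"
    using generate_field_fraction[OF T A] Cons.prems by auto
  have bd: "b \<in> carrier R" "d \<in> carrier R" using b d Tc by blast+
  have "b \<otimes> d \<otimes> x \<in> T" if "x \<in> set (y # p)" for x
  proof (cases "x = y")
    case True
    have "b \<otimes> d \<otimes> y = d \<otimes> (b \<otimes> y)" using bd pc by (simp add: m_ac)
    then show ?thesis using True d b T by (auto simp: ring_closed_def)
  next
    case False
    then have x: "x \<in> set p" using that by simp
    then have "b \<otimes> d \<otimes> x = b \<otimes> (d \<otimes> x)" using bd pc by (auto simp: m_assoc subset_iff)
    then show ?thesis using x d b T by (auto simp: ring_closed_def)
  qed
  moreover have "b \<otimes> d \<in> T" using b d T by (auto simp: ring_closed_def)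
  moreover have "b \<otimes> d \<noteq> \<zero>" using b d bd integral by blast
  ultimately show ?case by blast
qed

lemma eval_smult:
  assumes "d \<in> carrier R" "set p \<subseteq> carrier R" "x \<in> carrier R"
  shows "eval (map (\<lambda>c. d \<otimes> c) p) x = d \<otimes> eval p x"
  using assms(2)
proof (induction p)
  case (Cons a p)
  then have "eval p x \<in> carrier R" "a \<in> carrier R" using assms eval_in_carrier by auto
  then show ?case using Cons assms by (simp add: r_distr m_assoc)
qed (use assms in simp)

lemma algebraic_iff:
  assumes "subring E R" "x \<in> carrier R"
  shows "algebraic E x \<longleftrightarrow> (\<exists>p. set p \<subseteq> E \<and> p \<noteq> [] \<and> hd p \<noteq> \<zero> \<and> eval p x = \<zero>)"
proof -
  have "p \<in> carrier (E [X]) \<and> p \<noteq> [] \<longleftrightarrow> set p \<subseteq> E \<and> p \<noteq> [] \<and> hd p \<noteq> \<zero>" for p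
    by (auto simp: univ_poly_def polynomial_def)
  then show ?thesis
    using algebraicE[OF assms] algebraicI[of _ E x] by (metis over_def)
qed

text \<open>Multiplying a polynomial over the generated field by a common denominator of its
  coefficients keeps its roots and its nonzero leading coefficient.\<close>

lemma algebraic_ring_coeffs:
  assumes T: "ring_closed T" and A: "A \<subseteq> T" and x: "x \<in> carrier R"
    and alg: "algebraic (generate_field R A) x"
  shows "\<exists>p. set p \<subseteq> T \<and> p \<noteq> [] \<and> hd p \<noteq> \<zero> \<and> eval p x = \<zero>"
proof -
  have Tc: "T \<subseteq> carrier R" using T by (simp add: ring_closed_def)
  have Ac: "A \<subseteq> carrier R" using Tc A by blast
  obtain p where p: "set p \<subseteq> generate_field R A" "p \<noteq> []" "hd p \<noteq> \<zero>" "eval p x = \<zero>"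
    using alg algebraic_iff[OF subfieldE(1)[OF generate_field_is_subfield[OF Ac]] x] by auto
  obtain d where d: "d \<in> T" "d \<noteq> \<zero>" "\<forall>x\<in>set p. d \<otimes> x \<in> T"
    using common_denominator[OF T A p(1)] by blast
  have dc: "d \<in> carrier R" using d Tc by blast
  have pc: "set p \<subseteq> carrier R" using p generate_field_incl[OF Ac] by blast
  let ?q = "map (\<lambda>c. d \<otimes> c) p"
  have "eval ?q x = \<zero>" using eval_smult[OF dc pc x] p dc by simp
  moreover have "hd ?q \<noteq> \<zero>"
    using p d dc pc integral[of d "hd p"] by (auto simp: hd_map dest: hd_in_set)
  moreover have "set ?q \<subseteq> T" using d by auto
  ultimately show ?thesis using p by (intro exI[of _ ?q]) auto
qed

lemma finite_roots:
  assumes "set p \<subseteq> carrier R" "p \<noteq> []" "hd p \<noteq> \<zero>"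
  shows "finite {x \<in> carrier R. eval p x = \<zero>}"
    and "card {x \<in> carrier R. eval p x = \<zero>} \<le> length p"
proof -
  have p: "p \<in> carrier (poly_ring R)"
    using assms by (auto simp: univ_poly_def polynomial_def)
  have eq: "{x \<in> carrier R. eval p x = \<zero>} = {x. is_root p x}"
    using assms by (auto simp: is_root_def)
  show "finite {x \<in> carrier R. eval p x = \<zero>}"
    unfolding eq by (rule finite_number_of_roots[OF p])
  have "{x. is_root p x} = set_mset (roots p)"
    using roots_mem_iff_is_root[OF p] by auto
  moreover have "card (set_mset (roots p)) \<le> size (roots p)"
    by (metis mset_set_set_mset_msubset size_mset_mono size_mset_set)
  ultimately show "card {x \<in> carrier R. eval p x = \<zero>} \<le> length p"
    unfolding eq using size_roots_le_degree[OF p] by simp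
qed

text \<open>The coefficients of a polynomial for x generate a finite extension of F over which x is
  algebraic; by the tower law x lies in a finite extension of F.\<close>

lemma algebraic_trans:
  assumes F: "subfield F R" and x: "x \<in> carrier R"
    and alg: "algebraic {y \<in> carrier R. algebraic F y} x"
  shows "algebraic F x"
proof -
  let ?A = "{y \<in> carrier R. algebraic F y}"
  have A: "subfield ?A R" using subfield_of_algebraics[OF F] by (simp add: over_def)
  obtain p where p: "set p \<subseteq> ?A" "p \<noteq> []" "hd p \<noteq> \<zero>" "eval p x = \<zero>"
    using alg algebraic_iff[OF subfieldE(1)[OF A] x] by auto
  let ?E = "finite_extension F p"
  have pc: "set p \<subseteq> carrier R" using p by auto
  have E: "subfield ?E R" and fd: "finite_dimension F ?E"
    using finite_extension_is_subfield[OF F, of p] finite_extension_finite_dimension[OF F, of p] p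
    by (auto simp: over_def)
  have "set p \<subseteq> ?E" using finite_extension_mem[OF subfieldE(1)[OF F] pc] by auto
  then have algE: "algebraic ?E x"
    using algebraic_iff[OF subfieldE(1)[OF E] x] p by blast
  have fd2: "finite_dimension ?E (simple_extension ?E x)"
    using finite_dimension_simple_extension[OF E x] algE by (simp add: over_def)
  have sf: "subfield (simple_extension ?E x) R"
    using simple_extension_is_subfield[OF E x] algE by (simp add: over_def)
  have "finite_dimension F (simple_extension ?E x)"
    using telescopic_base_dim(1)[OF F E fd fd2] .
  moreover have "F \<subseteq> simple_extension ?E x"
    using finite_extension_incl[OF subfieldE(3)[OF F] pc]
      simple_extension_incl[OF subfieldE(3)[OF E] x] by blast
  moreover have "x \<in> simple_extension ?E x"
    using simple_extension_mem[OF subfieldE(1)[OF E] x] .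
  ultimately have "(algebraic over F) x"
    using finite_dimension_imp_algebraic[OF F subfieldE(1)[OF sf]] by blast
  then show ?thesis by (simp add: over_def)
qed

end

section \<open>Algebraic independence\<close>

definition monom_at :: "('a, 'm) ring_scheme \<Rightarrow> 'a set \<Rightarrow> ('a \<Rightarrow> nat) \<Rightarrow> 'a" where
  "monom_at R S e = (\<Otimes>\<^bsub>R\<^esub>x\<in>S. x [^]\<^bsub>R\<^esub> e x)"

text \<open>The ring F[S], built from single terms so that closure under products follows by
  induction. Exponents may repeat here; \<open>poly_values_sum\<close> collects them, since
  \<open>alg_independent\<close> speaks of sums over a set of distinct exponents.\<close>

inductive_set poly_values :: "('a, 'm) ring_scheme \<Rightarrow> 'a set \<Rightarrow> 'a set \<Rightarrow> 'a set"
  for R F S where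
    zero: "\<zero>\<^bsub>R\<^esub> \<in> poly_values R F S"
  | add_term: "v \<in> poly_values R F S \<Longrightarrow> a \<in> F \<Longrightarrow> e \<in> S \<rightarrow>\<^sub>E UNIV \<Longrightarrow>
      a \<otimes>\<^bsub>R\<^esub> monom_at R S e \<oplus>\<^bsub>R\<^esub> v \<in> poly_values R F S"

context field
begin

lemma monom_at_closed [simp]:
  assumes "S \<subseteq> carrier R" shows "monom_at R S e \<in> carrier R"
  unfolding monom_at_def using assms by (intro finprod_closed) auto

lemma monom_at_mult:
  assumes "S \<subseteq> carrier R"
  shows "monom_at R S d \<otimes> monom_at R S e = monom_at R S (\<lambda>x\<in>S. d x + e x)"
proof -
  have "monom_at R S (\<lambda>x\<in>S. d x + e x) = (\<Otimes>x\<in>S. x [^] d x \<otimes> x [^] e x)"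
    unfolding monom_at_def by (rule finprod_cong') (use assms in \<open>auto simp: nat_pow_mult\<close>)
  also have "\<dots> = monom_at R S d \<otimes> monom_at R S e"
    unfolding monom_at_def by (rule finprod_multf) (use assms in auto)
  finally show ?thesis by simp
qed

lemma monom_at_insert:
  assumes "finite S" "insert s S \<subseteq> carrier R" "s \<notin> S"
  shows "monom_at R (insert s S) e = s [^] e s \<otimes> monom_at R S e"
  unfolding monom_at_def using assms by (subst finprod_insert) auto

lemma monom_at_cong:
  assumes "S \<subseteq> carrier R" "\<And>x. x \<in> S \<Longrightarrow> d x = e x"
  shows "monom_at R S d = monom_at R S e"
  unfolding monom_at_def by (rule finprod_cong') (use assms in auto)

lemma poly_values_carrier:
  assumes "F \<subseteq> carrier R" "S \<subseteq> carrier R" "v \<in> poly_values R F S"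
  shows "v \<in> carrier R"
  using assms(3) by induction (use assms in auto)

lemma poly_values_add:
  assumes F: "F \<subseteq> carrier R" and S: "S \<subseteq> carrier R"
    and "v \<in> poly_values R F S" and w: "w \<in> poly_values R F S"
  shows "v \<oplus> w \<in> poly_values R F S"
  using assms(3)
proof induction
  case zero
  then show ?case using w poly_values_carrier[OF F S] by simp
next
  case (add_term v a e)
  have "a \<otimes> monom_at R S e \<oplus> v \<oplus> w = a \<otimes> monom_at R S e \<oplus> (v \<oplus> w)"
    using add_term w F S poly_values_carrier[OF F S] by (intro a_assoc) auto
  then show ?case using poly_values.add_term[OF add_term.IH add_term.hyps(2,3)] by simp
qed

lemma poly_values_mult_term:
  assumes F: "subfield F R" and S: "S \<subseteq> carrier R" and a: "a \<in> F"
    and e: "e \<in> S \<rightarrow>\<^sub>E UNIV" and "v \<in> poly_values R F S"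
  shows "(a \<otimes> monom_at R S e) \<otimes> v \<in> poly_values R F S"
  using assms(5)
proof induction
  case zero
  then show ?case using a S subfieldE(3)[OF F] by (auto simp: poly_values.zero)
next
  case (add_term v b d)
  have Fc: "F \<subseteq> carrier R" using subfieldE(3)[OF F] .
  have ab: "a \<in> carrier R" "b \<in> carrier R" using a add_term Fc by auto
  have v: "v \<in> carrier R" using add_term poly_values_carrier[OF Fc S] by blast
  have m: "monom_at R S e \<in> carrier R" "monom_at R S d \<in> carrier R" using S by auto
  have "(a \<otimes> monom_at R S e) \<otimes> (b \<otimes> monom_at R S d \<oplus> v)
      = (a \<otimes> b) \<otimes> (monom_at R S e \<otimes> monom_at R S d) \<oplus> (a \<otimes> monom_at R S e) \<otimes> v"
    using ab v m by algebra
  also have "\<dots> = (a \<otimes> b) \<otimes> monom_at R S (\<lambda>x\<in>S. e x + d x) \<oplus> (a \<otimes> monom_at R S e) \<otimes> v"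
    by (simp add: monom_at_mult[OF S])
  also have "\<dots> \<in> poly_values R F S"
    by (rule poly_values.add_term[OF add_term.IH])
      (use a add_term subringE(6)[OF subfieldE(1)[OF F]] in auto)
  finally show ?case .
qed

lemma poly_values_mult:
  assumes F: "subfield F R" and S: "S \<subseteq> carrier R"
    and "v \<in> poly_values R F S" and w: "w \<in> poly_values R F S"
  shows "v \<otimes> w \<in> poly_values R F S"
  using assms(3)
proof induction
  case zero
  then show ?case using w poly_values_carrier[OF subfieldE(3)[OF F] S] by (auto simp: poly_values.zero)
next
  case (add_term v a e)
  have Fc: "F \<subseteq> carrier R" using subfieldE(3)[OF F] .
  have "(a \<otimes> monom_at R S e \<oplus> v) \<otimes> w = (a \<otimes> monom_at R S e) \<otimes> w \<oplus> v \<otimes> w"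
    using add_term w Fc S poly_values_carrier[OF Fc S] by (intro l_distr) auto
  then show ?case
    using poly_values_add[OF Fc S poly_values_mult_term[OF F S add_term.hyps(2,3) w] add_term.IH] by simp
qed

lemma poly_values_const:
  assumes F: "subfield F R" and S: "S \<subseteq> carrier R" and a: "a \<in> F"
  shows "a \<in> poly_values R F S"
proof -
  have "a \<otimes> monom_at R S (\<lambda>x\<in>S. 0) \<oplus> \<zero> \<in> poly_values R F S"
    by (rule poly_values.intros) (use a in \<open>auto intro: poly_values.intros\<close>)
  moreover have "monom_at R S (\<lambda>x\<in>S. 0) = \<one>"
    unfolding monom_at_def by (rule finprod_one_eqI) auto
  ultimately show ?thesis using a subfieldE(3)[OF F] by (auto simp: subset_iff)
qed

lemma poly_values_var:
  assumes F: "subfield F R" and S: "finite S" "S \<subseteq> carrier R" and s: "s \<in> S"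
  shows "s \<in> poly_values R F S"
proof -
  have "\<one> \<otimes> monom_at R S (\<lambda>x\<in>S. if x = s then 1 else 0) \<oplus> \<zero> \<in> poly_values R F S"
    by (rule poly_values.intros)
      (use subringE(3)[OF subfieldE(1)[OF F]] in \<open>auto intro: poly_values.intros\<close>)
  moreover have "monom_at R S (\<lambda>x\<in>S. if x = s then 1 else 0) = (\<Otimes>x\<in>S. if s = x then x else \<one>)"
    unfolding monom_at_def by (rule finprod_cong') (use S in auto)
  moreover have "\<dots> = s" using finprod_singleton[OF s S(1), of "\<lambda>x. x"] S by auto
  ultimately show ?thesis using S s by (auto simp: subset_iff)
qed

lemma ring_closed_poly_values:
  assumes F: "subfield F R" and S: "S \<subseteq> carrier R"
  shows "ring_closed (poly_values R F S)"
proof -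
  have Fc: "F \<subseteq> carrier R" using subfieldE(3)[OF F] .
  note C = poly_values_carrier[OF Fc S]
  have one: "\<one> \<in> F" "\<ominus> \<one> \<in> F" using subringE(3,5)[OF subfieldE(1)[OF F]] by auto
  have "\<ominus> x \<in> poly_values R F S" if "x \<in> poly_values R F S" for x
  proof -
    have "\<ominus> \<one> \<otimes> x \<in> poly_values R F S"
      using poly_values_mult[OF F S poly_values_const[OF F S one(2)] that] .
    then show ?thesis using C[OF that] by (simp add: l_minus)
  qed
  then show ?thesis
    using poly_values_add[OF Fc S] poly_values_mult[OF F S] poly_values_const[OF F S one(1)] C
    by (auto simp: ring_closed_def)
qed

lemma poly_values_sum:
  assumes F: "subfield F R" and S: "S \<subseteq> carrier R" and "v \<in> poly_values R F S"
  shows "\<exists>E c. finite E \<and> E \<subseteq> (S \<rightarrow>\<^sub>E UNIV) \<and> c ` E \<subseteq> F \<and> v = (\<Oplus>e\<in>E. c e \<otimes> monom_at R S e)"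
  using assms(3)
proof induction
  case zero
  show ?case by (intro exI[of _ "{}"]) auto
next
  case (add_term v a e)
  have Fc: "F \<subseteq> carrier R" using subfieldE(3)[OF F] .
  obtain E c where E: "finite E" "E \<subseteq> (S \<rightarrow>\<^sub>E UNIV)" "c ` E \<subseteq> F"
    "v = (\<Oplus>e\<in>E. c e \<otimes> monom_at R S e)" using add_term by blast
  have cc: "c d \<in> carrier R" if "d \<in> E" for d using E that Fc by auto
  have ac: "a \<in> carrier R" using add_term Fc by auto
  have m: "monom_at R S d \<in> carrier R" for d using S by simp
  have v: "v \<in> carrier R" using add_term poly_values_carrier[OF Fc S] by blast
  show ?case
  proof (cases "e \<in> E")
    case False
    let ?c = "c(e := a)"
    have "(\<Oplus>d\<in>insert e E. ?c d \<otimes> monom_at R S d)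
        = ?c e \<otimes> monom_at R S e \<oplus> (\<Oplus>d\<in>E. ?c d \<otimes> monom_at R S d)"
      using E False cc ac m by (intro finsum_insert) auto
    also have "(\<Oplus>d\<in>E. ?c d \<otimes> monom_at R S d) = v"
      unfolding E(4) by (rule finsum_cong') (use False cc m in auto)
    finally show ?thesis using E add_term
      by (intro exI[of _ "insert e E"] exI[of _ ?c]) auto
  next
    \<comment> \<open>The exponent e occurs already, so its coefficient is increased and no second
      term with e is added.\<close>
    case True
    let ?c = "c(e := a \<oplus> c e)" and ?D = "E - {e}"
    have ins: "insert e ?D = E" using True by auto
    have w: "(\<Oplus>d\<in>?D. c d \<otimes> monom_at R S d) \<in> carrier R"
      using cc m by (intro finsum_closed) auto
    have "(\<Oplus>d\<in>insert e ?D. ?c d \<otimes> monom_at R S d)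
        = ?c e \<otimes> monom_at R S e \<oplus> (\<Oplus>d\<in>?D. ?c d \<otimes> monom_at R S d)"
      using E True cc ac m by (intro finsum_insert) auto
    also have "(\<Oplus>d\<in>?D. ?c d \<otimes> monom_at R S d) = (\<Oplus>d\<in>?D. c d \<otimes> monom_at R S d)"
      by (rule finsum_cong') (use cc m in auto)
    also have "?c e \<otimes> monom_at R S e \<oplus> (\<Oplus>d\<in>?D. c d \<otimes> monom_at R S d)
        = a \<otimes> monom_at R S e \<oplus> (c e \<otimes> monom_at R S e \<oplus> (\<Oplus>d\<in>?D. c d \<otimes> monom_at R S d))"
      using cc[OF True] ac m[of e] w by (simp add: l_distr a_assoc)
    also have "c e \<otimes> monom_at R S e \<oplus> (\<Oplus>d\<in>?D. c d \<otimes> monom_at R S d)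
        = (\<Oplus>d\<in>insert e ?D. c d \<otimes> monom_at R S d)"
      using E True cc ac m by (intro finsum_insert[symmetric]) auto
    finally have "(\<Oplus>d\<in>E. ?c d \<otimes> monom_at R S d) = a \<otimes> monom_at R S e \<oplus> v"
      unfolding ins E(4) .
    moreover have "a \<oplus> c e \<in> F"
      using True E add_term subringE(7)[OF subfieldE(1)[OF F]] by auto
    ultimately show ?thesis using E add_term
      by (intro exI[of _ E] exI[of _ ?c]) auto
  qed
qed

text \<open>\<open>eval\<close> reads a list with the leading coefficient first, hence the
  reversal.\<close>

lemma eval_as_sum:
  assumes x: "x \<in> carrier R" and "\<And>j. j < n \<Longrightarrow> d j \<in> carrier R"
  shows "eval (map d (rev [0..<n])) x = (\<Oplus>j\<in>{..<n}. d j \<otimes> x [^] j)"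
  using assms(2)
proof (induction n)
  case (Suc n)
  have "(\<Oplus>j\<in>{..<Suc n}. d j \<otimes> x [^] j) = d n \<otimes> x [^] n \<oplus> (\<Oplus>j\<in>{..<n}. d j \<otimes> x [^] j)"
    unfolding lessThan_Suc using Suc.prems x by (intro finsum_insert) auto
  then show ?case using Suc by simp
qed simp

text \<open>A polynomial in S and s read as a polynomial in s: the exponents are sorted by their
  value j at s, and the slice of j holds the coefficient of s to the power j. Exponents on S are
  extensional, so \<open>e(s := j)\<close> is injective on a slice.\<close>

lemma sum_slices:
  assumes S: "finite S" "insert s S \<subseteq> carrier R" "s \<notin> S"
    and E: "finite E" "E \<subseteq> (insert s S \<rightarrow>\<^sub>E UNIV)" "c ` E \<subseteq> carrier R" "\<And>e. e \<in> E \<Longrightarrow> e s < n"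
  shows "(\<Oplus>e\<in>E. c e \<otimes> monom_at R (insert s S) e) =
    (\<Oplus>j\<in>{..<n}. (\<Oplus>e\<in>{e \<in> S \<rightarrow>\<^sub>E UNIV. e(s := j) \<in> E}. c (e(s := j)) \<otimes> monom_at R S e) \<otimes> s [^] j)"
proof -
  let ?D = "\<lambda>j. {e \<in> S \<rightarrow>\<^sub>E (UNIV::nat set). e(s := j) \<in> E}"
  let ?up = "\<lambda>j e. e(s := j)"
  have inj: "inj_on (?up j) (?D j)" for j
  proof (rule inj_onI)
    fix d e assume de: "d \<in> ?D j" "e \<in> ?D j" "d(s := j) = e(s := j)"
    show "d = e"
    proof
      fix x show "d x = e x"
      proof (cases "x = s")
        case True
        then show ?thesis using de S(3) by (auto simp: PiE_def extensional_def)
      next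
        case False
        then show ?thesis using fun_cong[OF de(3), of x] by simp
      qed
    qed
  qed
  have fin: "finite (?D j)" for j
    by (rule finite_imageD[OF finite_subset[OF _ E(1)] inj]) auto
  have EU: "E = (\<Union>j\<in>{..<n}. ?up j ` ?D j)"
  proof
    show "E \<subseteq> (\<Union>j\<in>{..<n}. ?up j ` ?D j)"
    proof
      fix e assume e: "e \<in> E"
      have "restrict e S \<in> S \<rightarrow>\<^sub>E UNIV" by auto
      moreover have up: "?up (e s) (restrict e S) = e"
        using e E(2) by (auto simp: fun_eq_iff PiE_def extensional_def restrict_def)
      ultimately have "restrict e S \<in> ?D (e s)" using e by simp
      then have "e \<in> ?up (e s) ` ?D (e s)"
        by (rule image_eqI[where f = "?up (e s)" and x = "restrict e S", OF up[symmetric]])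
      then show "e \<in> (\<Union>j\<in>{..<n}. ?up j ` ?D j)"
        using E(4)[OF e] by blast
    qed
  qed auto
  have cc: "c e \<in> carrier R" if "e \<in> E" for e using E that by auto
  have m: "monom_at R S d \<in> carrier R" "monom_at R (insert s S) d \<in> carrier R" for d
    using S by auto
  have val: "f s = j" if "f \<in> ?up j ` ?D j" for f j using that by auto
  have disj: "pairwise (\<lambda>i j. disjnt (?up i ` ?D i) (?up j ` ?D j)) {..<n}"
  proof (intro pairwiseI)
    fix i j :: nat assume "i \<noteq> j"
    show "disjnt (?up i ` ?D i) (?up j ` ?D j)"
      unfolding disjnt_iff
    proof (intro allI notI)
      fix f assume "f \<in> ?up i ` ?D i \<and> f \<in> ?up j ` ?D j"
      then have "f s = i" "f s = j" using val[of f i] val[of f j] by auto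
      with \<open>i \<noteq> j\<close> show False by simp
    qed
  qed
  have "(\<Oplus>e\<in>E. c e \<otimes> monom_at R (insert s S) e)
      = (\<Oplus>j\<in>{..<n}. \<Oplus>e\<in>?up j ` ?D j. c e \<otimes> monom_at R (insert s S) e)"
    by (subst EU, rule add.finprod_UN_disjoint) (use fin disj cc m in auto)
  also have "\<dots> = (\<Oplus>j\<in>{..<n}. (\<Oplus>e\<in>?D j. c (e(s := j)) \<otimes> monom_at R S e) \<otimes> s [^] j)"
  proof (rule finsum_cong')
    fix j assume j: "j \<in> {..<n}"
    have sc: "s \<in> carrier R" using S by auto
    have "(\<Oplus>e\<in>?up j ` ?D j. c e \<otimes> monom_at R (insert s S) e)
        = (\<Oplus>e\<in>?D j. c (e(s := j)) \<otimes> monom_at R (insert s S) (e(s := j)))"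
      by (rule add.finprod_reindex[OF _ inj]) (use cc m in auto)
    also have "\<dots> = (\<Oplus>e\<in>?D j. (c (e(s := j)) \<otimes> monom_at R S e) \<otimes> s [^] j)"
    proof (rule finsum_cong')
      fix e assume e: "e \<in> ?D j"
      have "monom_at R S (e(s := j)) = monom_at R S e"
        by (rule monom_at_cong) (use S in auto)
      then have "monom_at R (insert s S) (e(s := j)) = s [^] j \<otimes> monom_at R S e"
        using monom_at_insert[OF S] by simp
      then show "c (e(s := j)) \<otimes> monom_at R (insert s S) (e(s := j))
          = (c (e(s := j)) \<otimes> monom_at R S e) \<otimes> s [^] j"
        using cc[of "e(s := j)"] e m sc by (simp add: m_ac)
    qed (use cc m sc in auto)
    also have "\<dots> = (\<Oplus>e\<in>?D j. c (e(s := j)) \<otimes> monom_at R S e) \<otimes> s [^] j"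
      by (rule finsum_ldistr[symmetric]) (use fin cc m sc in auto)
    finally show "(\<Oplus>e\<in>?up j ` ?D j. c e \<otimes> monom_at R (insert s S) e)
      = (\<Oplus>e\<in>?D j. c (e(s := j)) \<otimes> monom_at R S e) \<otimes> s [^] j" .
  qed (use fin cc m S in \<open>auto intro!: finsum_closed m_closed\<close>)
  finally show ?thesis .
qed

lemma finsum_in_subring:
  assumes E: "subring E R" and "\<And>i. i \<in> A \<Longrightarrow> f i \<in> E"
  shows "finsum R f A \<in> E"
  using assms(2)
proof (induction A rule: infinite_finite_induct)
  case (insert x A)
  then have "finsum R f (insert x A) = f x \<oplus> finsum R f A"
    using subringE(1)[OF E] by (intro finsum_insert) auto
  then show ?case using insert subringE(7)[OF E] by simp
qed (use subringE(2)[OF E] in \<open>auto simp: finsum_infinite\<close>)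

lemma monom_at_in_subring:
  assumes E: "subring E R" and S: "S \<subseteq> E"
  shows "monom_at R S e \<in> E"
  using S unfolding monom_at_def
proof (induction S rule: infinite_finite_induct)
  case (insert x A)
  have pow: "y [^] (k::nat) \<in> E" if "y \<in> E" for y k
    by (induction k) (use that subringE(3,6)[OF E] in auto)
  have "(\<Otimes>x\<in>insert x A. x [^] e x) = x [^] e x \<otimes> (\<Otimes>x\<in>A. x [^] e x)"
    using insert subringE(1)[OF E] by (intro finprod_insert) auto
  then show ?case using insert pow subringE(6)[OF E] by simp
qed (use subringE(3)[OF E] in auto)

text \<open>The list may begin with zeros; dropping them leaves a polynomial with nonzero leading
  coefficient as long as some coefficient is nonzero.\<close>

lemma algebraic_if_nonzero_coeff:
  assumes E: "subring E R" and x: "x \<in> carrier R"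
    and "set p \<subseteq> E" "eval p x = \<zero>" "c \<in> set p" "c \<noteq> \<zero>"
  shows "algebraic E x"
  using assms(3-)
proof (induction p)
  case (Cons a p)
  show ?case
  proof (cases "a = \<zero>")
    case True
    have "eval p x \<in> carrier R" using Cons.prems subringE(1)[OF E] x by (intro eval_in_carrier) auto
    then have "eval p x = \<zero>" using Cons.prems True x by simp
    then show ?thesis using Cons True by auto
  next
    case False
    then have "\<exists>q. set q \<subseteq> E \<and> q \<noteq> [] \<and> hd q \<noteq> \<zero> \<and> eval q x = \<zero>"
      using Cons.prems by (intro exI[of _ "a # p"]) auto
    then show ?thesis using algebraic_iff[OF E x] by blast
  qed
qed simp

end

lemma alg_independent_monom_at:
  "alg_independent K F S \<longleftrightarrow>
     (\<forall>E c. finite E \<and> E \<subseteq> (S \<rightarrow>\<^sub>E UNIV) \<and> c ` E \<subseteq> F \<and>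
        (\<Oplus>\<^bsub>K\<^esub>e\<in>E. c e \<otimes>\<^bsub>K\<^esub> monom_at K S e) = \<zero>\<^bsub>K\<^esub> \<longrightarrow> (\<forall>e\<in>E. c e = \<zero>\<^bsub>K\<^esub>))"
  by (simp add: alg_independent_def monom_at_def)

lemma restrict_upd: "e \<in> S \<rightarrow>\<^sub>E UNIV \<Longrightarrow> s \<notin> S \<Longrightarrow> restrict (e(s := j)) S = e"
  by (auto simp: fun_eq_iff PiE_def extensional_def restrict_def)

section \<open>Algebraic dependence as a closure operator with exchange\<close>

context LG_field
begin

lemma alg_iff: "x \<in> alg K A \<longleftrightarrow> x \<in> carrier K \<and> algebraic (generate_field K A) x"
  by (simp add: alg_def)

lemma alg_carrier: "alg K A \<subseteq> carrier K"
  by (auto simp: alg_def)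

lemma alg_mono: "A \<subseteq> B \<Longrightarrow> B \<subseteq> carrier K \<Longrightarrow> alg K A \<subseteq> alg K B"
  using algebraic_mono[OF mono_generate_field] by (auto simp: alg_def over_def)

lemma subfield_alg: "A \<subseteq> carrier K \<Longrightarrow> subfield (alg K A) K"
  using subfield_of_algebraics[OF generate_field_is_subfield] by (simp add: alg_def over_def)

lemma alg_extensive:
  assumes "A \<subseteq> carrier K" shows "A \<subseteq> alg K A"
proof
  fix x assume x: "x \<in> A"
  then have "(algebraic over (generate_field K A)) x"
    using algebraic_self[OF subfieldE(1)[OF generate_field_is_subfield[OF assms]]]
    by (auto intro: generate_field.intros)
  then show "x \<in> alg K A" using x assms by (auto simp: alg_def over_def)
qed

lemma algebraic_alg_closed:
  assumes A: "A \<subseteq> carrier K" and x: "x \<in> carrier K" "algebraic (alg K A) x"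
  shows "x \<in> alg K A"
  using algebraic_trans[OF generate_field_is_subfield[OF A] x(1)] x
  by (simp add: alg_def)

lemma alg_idem:
  assumes A: "A \<subseteq> carrier K" shows "alg K (alg K A) = alg K A"
proof
  have "generate_field K (alg K A) \<subseteq> alg K A"
    by (rule generate_field_min_subfield1[OF alg_carrier subfield_alg[OF A]]) simp
  then show "alg K (alg K A) \<subseteq> alg K A"
    using algebraic_alg_closed[OF A] algebraic_mono by (auto simp: alg_iff over_def)
qed (rule alg_extensive[OF alg_carrier])

lemma alg_least: "A \<subseteq> alg K B \<Longrightarrow> B \<subseteq> carrier K \<Longrightarrow> alg K A \<subseteq> alg K B"
  using alg_mono[of A "alg K B"] alg_idem[of B] alg_carrier by blast

lemma generate_field_finite_set:
  assumes "finite W" "W \<subseteq> generate_field K A" "A \<subseteq> carrier K"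
  obtains A0 where "finite A0" "A0 \<subseteq> A" "W \<subseteq> generate_field K A0"
proof -
  have "\<exists>A0. finite A0 \<and> A0 \<subseteq> A \<and> W \<subseteq> generate_field K A0"
    using assms(1,2)
  proof (induction W)
    case (insert w W)
    then obtain A0 where A0: "finite A0" "A0 \<subseteq> A" "W \<subseteq> generate_field K A0" by auto
    obtain A1 where A1: "finite A1" "A1 \<subseteq> A" "w \<in> generate_field K A1"
      using finite_support_generate_field insert.prems by blast
    have sub: "A0 \<union> A1 \<subseteq> carrier K" using A0 A1 assms(3) by blast
    have "insert w W \<subseteq> generate_field K (A0 \<union> A1)"
      using A0 A1 mono_generate_field[OF Un_upper1 sub] mono_generate_field[OF Un_upper2 sub] by blast
    then show ?case using A0 A1 by (intro exI[of _ "A0 \<union> A1"]) auto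
  qed auto
  then show thesis using that by blast
qed

lemma alg_finite_support:
  assumes "x \<in> alg K A" "A \<subseteq> carrier K"
  obtains A0 where "finite A0" "A0 \<subseteq> A" "x \<in> alg K A0"
proof -
  have x: "x \<in> carrier K" using assms alg_carrier by blast
  obtain p where p: "set p \<subseteq> generate_field K A" "p \<noteq> []" "hd p \<noteq> \<zero>" "eval p x = \<zero>"
    using assms algebraic_iff[OF subfieldE(1)[OF generate_field_is_subfield[OF assms(2)]] x]
    by (auto simp: alg_iff)
  obtain A0 where A0: "finite A0" "A0 \<subseteq> A" "set p \<subseteq> generate_field K A0"
    using generate_field_finite_set[OF _ p(1) assms(2)] by blast
  have "A0 \<subseteq> carrier K" using A0 assms by blast
  then have "x \<in> alg K A0"
    using A0 p x algebraic_iff[OF subfieldE(1)[OF generate_field_is_subfield] x] by (auto simp: alg_iff)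
  then show thesis using that A0 by blast
qed

text \<open>The bridge from polynomial relations to the closure operator: a relation among S and s,
  sorted by powers of s, either is made of relations among S or makes s algebraic over C and S. From
  here on most arguments use \<open>alg\<close> in place of coefficients.\<close>

lemma alg_independent_insert:
  assumes C: "C \<subseteq> carrier K" and S: "finite S" "insert s S \<subseteq> carrier K" "s \<notin> S"
  shows "alg_independent K (generate_field K C) (insert s S) \<longleftrightarrow>
     alg_independent K (generate_field K C) S \<and> s \<notin> alg K (C \<union> S)"
proof -
  let ?F = "generate_field K C"
  have F: "subfield ?F K" by (rule generate_field_is_subfield[OF C])
  have Fc: "?F \<subseteq> carrier K" using subfieldE(3)[OF F] .
  have Sc: "S \<subseteq> carrier K" "s \<in> carrier K" using S by auto
  have CS: "C \<union> S \<subseteq> carrier K" using C Sc by blast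
  show ?thesis
  proof
    assume ind: "alg_independent K ?F (insert s S)"
    \<comment> \<open>A relation given slice by slice is glued to one relation among S and s. This
      is used with a single slice, for the independence of S, and with the coefficients of a
      polynomial that vanishes at s.\<close>
    have fam: "\<forall>j<n. \<forall>e\<in>E j. c j e = \<zero>"
      if fam: "\<And>j. j < n \<Longrightarrow> finite (E j) \<and> E j \<subseteq> (S \<rightarrow>\<^sub>E UNIV) \<and> c j ` E j \<subseteq> ?F"
        and zero: "(\<Oplus>j\<in>{..<n}. (\<Oplus>e\<in>E j. c j e \<otimes> monom_at K S e) \<otimes> s [^] j) = \<zero>"
      for n :: nat and E c
    proof -
      let ?E = "{e \<in> insert s S \<rightarrow>\<^sub>E UNIV. e s < n \<and> restrict e S \<in> E (e s)}"
      let ?c = "\<lambda>e. c (e s) (restrict e S)"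
      have slice: "{e \<in> S \<rightarrow>\<^sub>E UNIV. e(s := j) \<in> ?E} = E j" if "j < n" for j
      proof (rule Set.set_eqI)
        fix e
        show "e \<in> {e \<in> S \<rightarrow>\<^sub>E UNIV. e(s := j) \<in> ?E} \<longleftrightarrow> e \<in> E j"
        proof (cases "e \<in> S \<rightarrow>\<^sub>E UNIV")
          case True
          then have "e(s := j) \<in> insert s S \<rightarrow>\<^sub>E UNIV" by (auto simp: PiE_def extensional_def)
          then show ?thesis using True that restrict_upd[OF True S(3), of j] by simp
        next
          case False
          then show ?thesis using fam[OF that] by blast
        qed
      qed
      have "?E \<subseteq> (\<Union>j\<in>{..<n}. (\<lambda>e. e(s := j)) ` E j)"
      proof
        fix e assume e: "e \<in> ?E"
        then have "e = (restrict e S)(s := e s)"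
          by (auto simp: fun_eq_iff PiE_def extensional_def restrict_def)
        then have "e \<in> (\<lambda>d. d(s := e s)) ` E (e s)" using e by blast
        then show "e \<in> (\<Union>j\<in>{..<n}. (\<lambda>e. e(s := j)) ` E j)" using e by blast
      qed
      then have fin: "finite ?E" by (rule finite_subset) (use fam in auto)
      have cF: "?c ` ?E \<subseteq> ?F" using fam by blast
      have "(\<Oplus>e\<in>?E. ?c e \<otimes> monom_at K (insert s S) e)
        = (\<Oplus>j\<in>{..<n}. (\<Oplus>e\<in>{e \<in> S \<rightarrow>\<^sub>E UNIV. e(s := j) \<in> ?E}. ?c (e(s := j)) \<otimes> monom_at K S e) \<otimes> s [^] j)"
        by (rule sum_slices[OF S fin]) (use cF Fc in auto)
      also have "\<dots> = (\<Oplus>j\<in>{..<n}. (\<Oplus>e\<in>E j. c j e \<otimes> monom_at K S e) \<otimes> s [^] j)"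
      proof (rule finsum_cong')
        fix j assume j: "j \<in> {..<n}"
        have cc: "c j e \<in> carrier K" if "e \<in> E j" for e using fam[of j] that j Fc by auto
        have "(\<Oplus>e\<in>{e \<in> S \<rightarrow>\<^sub>E UNIV. e(s := j) \<in> ?E}. ?c (e(s := j)) \<otimes> monom_at K S e)
            = (\<Oplus>e\<in>E j. c j e \<otimes> monom_at K S e)"
        proof (rule finsum_cong')
          show "{e \<in> S \<rightarrow>\<^sub>E UNIV. e(s := j) \<in> ?E} = E j" using slice j by auto
          fix e assume "e \<in> E j"
          then show "?c (e(s := j)) \<otimes> monom_at K S e = c j e \<otimes> monom_at K S e"
            using fam[of j] j restrict_upd[OF _ S(3), of e j] by auto
        qed (use cc Sc in auto)
        then show "(\<Oplus>e\<in>{e \<in> S \<rightarrow>\<^sub>E UNIV. e(s := j) \<in> ?E}. ?c (e(s := j)) \<otimes> monom_at K S e) \<otimes> s [^] j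
            = (\<Oplus>e\<in>E j. c j e \<otimes> monom_at K S e) \<otimes> s [^] j" by simp
      next
        show "(\<lambda>j. (\<Oplus>e\<in>E j. c j e \<otimes> monom_at K S e) \<otimes> s [^] j) \<in> {..<n} \<rightarrow> carrier K"
        proof (intro Pi_I m_closed finsum_closed)
          fix j e assume "j \<in> {..<n}" "e \<in> E j"
          then have "c j e \<in> ?F" using fam by blast
          then show "c j e \<in> carrier K" using Fc by blast
        qed (use Sc in auto)
      qed simp
      also have "\<dots> = \<zero>" by (rule zero)
      finally have sum0: "(\<Oplus>e\<in>?E. ?c e \<otimes> monom_at K (insert s S) e) = \<zero>" .
      have "?E \<subseteq> (insert s S \<rightarrow>\<^sub>E UNIV)" by auto
      with ind fin cF sum0 have all0: "\<forall>e\<in>?E. ?c e = \<zero>"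
        unfolding alg_independent_monom_at
        by (elim allE[where x = ?E] allE[where x = ?c]) blast
      show ?thesis
      proof (intro allI impI ballI)
        fix j e assume j: "j < n" and e: "e \<in> E j"
        then have eS: "e \<in> S \<rightarrow>\<^sub>E UNIV" and up: "e(s := j) \<in> ?E" using slice[OF j] by auto
        from all0 up have "?c (e(s := j)) = \<zero>" by blast
        then show "c j e = \<zero>" using restrict_upd[OF eS S(3), of j] by simp
      qed
    qed
    have "alg_independent K ?F S"
      unfolding alg_independent_monom_at
    proof (intro allI impI)
      fix E :: "('a \<Rightarrow> nat) set" and c
      assume E: "finite E \<and> E \<subseteq> (S \<rightarrow>\<^sub>E UNIV) \<and> c ` E \<subseteq> ?F \<and>
        (\<Oplus>e\<in>E. c e \<otimes> monom_at K S e) = \<zero>"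
      then have "\<forall>j<(1::nat). \<forall>e\<in>E. c e = \<zero>"
        by (intro fam[of 1 "\<lambda>_. E" "\<lambda>_. c"]) (auto simp: lessThan_Suc)
      then show "\<forall>e\<in>E. c e = \<zero>" by simp
    qed
    moreover have "s \<notin> alg K (C \<union> S)"
    proof
      assume "s \<in> alg K (C \<union> S)"
      then have "algebraic (generate_field K (C \<union> S)) s" by (simp add: alg_iff)
      moreover have "C \<union> S \<subseteq> poly_values K ?F S"
        using poly_values_const[OF F Sc(1)] poly_values_var[OF F S(1) Sc(1)]
        by (auto intro: generate_field.incl)
      ultimately obtain p where p: "set p \<subseteq> poly_values K ?F S" "p \<noteq> []" "hd p \<noteq> \<zero>" "eval p s = \<zero>"
        using algebraic_ring_coeffs[OF ring_closed_poly_values[OF F Sc(1)] _ Sc(2)] by blast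
      define n where "n = length p"
      have dT: "coeff p j \<in> poly_values K ?F S" if "j < n" for j
        using coeff_img_restrict[of p] that p(1) by (auto simp: n_def)
      define P where "P j E c \<longleftrightarrow> finite E \<and> E \<subseteq> (S \<rightarrow>\<^sub>E UNIV) \<and> c ` E \<subseteq> ?F \<and>
          coeff p j = (\<Oplus>e\<in>E. c e \<otimes> monom_at K S e)" for j E c
      have "\<exists>E c. j < n \<longrightarrow> P j E c" for j
        using poly_values_sum[OF F Sc(1) dT[of j]] unfolding P_def by (cases "j < n") auto
      then obtain E c where "\<And>j. j < n \<Longrightarrow> P j (E j) (c j)"
        by metis
      then have Ec: "finite (E j) \<and> E j \<subseteq> (S \<rightarrow>\<^sub>E UNIV) \<and> c j ` E j \<subseteq> ?F \<and>
          coeff p j = (\<Oplus>e\<in>E j. c j e \<otimes> monom_at K S e)" if "j < n" for j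
        using that unfolding P_def by blast
      have dc: "coeff p j \<in> carrier K" if "j < n" for j
        using poly_values_carrier[OF Fc Sc(1) dT[OF that]] .
      have "(\<Oplus>j\<in>{..<n}. coeff p j \<otimes> s [^] j) = eval (map (coeff p) (rev [0..<n])) s"
        by (rule eval_as_sum[symmetric]) (use Sc dc in auto)
      also have "\<dots> = \<zero>" using p coeff_list[of p] by (simp add: n_def)
      finally have z: "(\<Oplus>j\<in>{..<n}. coeff p j \<otimes> s [^] j) = \<zero>" .
      have "(\<Oplus>j\<in>{..<n}. (\<Oplus>e\<in>E j. c j e \<otimes> monom_at K S e) \<otimes> s [^] j) = (\<Oplus>j\<in>{..<n}. coeff p j \<otimes> s [^] j)"
        by (rule finsum_cong') (use Ec dc Sc in auto)
      with z have "\<forall>j<n. \<forall>e\<in>E j. c j e = \<zero>" using Ec by (intro fam) auto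
      moreover have nn: "n - 1 < n" using p by (simp add: n_def)
      ultimately have c0: "\<And>e. e \<in> E (n - 1) \<Longrightarrow> c (n - 1) e = \<zero>" by blast
      have "coeff p (n - 1) = (\<Oplus>e\<in>E (n - 1). c (n - 1) e \<otimes> monom_at K S e)" using Ec[OF nn] by blast
      also have "\<dots> = (\<Oplus>e\<in>E (n - 1). \<zero>)"
        by (rule finsum_cong') (use c0 Sc in auto)
      finally have "coeff p (n - 1) = \<zero>" by simp
      then show False using p lead_coeff_simp[of p] by (simp add: n_def)
    qed
    ultimately show "alg_independent K ?F S \<and> s \<notin> alg K (C \<union> S)" by blast
  next
    assume asm: "alg_independent K ?F S \<and> s \<notin> alg K (C \<union> S)"
    show "alg_independent K ?F (insert s S)"
      unfolding alg_independent_monom_at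
    proof (intro allI impI ballI)
      fix E :: "('a \<Rightarrow> nat) set" and c e
      assume "finite E \<and> E \<subseteq> (insert s S \<rightarrow>\<^sub>E UNIV) \<and> c ` E \<subseteq> ?F \<and>
        (\<Oplus>e\<in>E. c e \<otimes> monom_at K (insert s S) e) = \<zero>" and e: "e \<in> E"
      then have E: "finite E" "E \<subseteq> (insert s S \<rightarrow>\<^sub>E UNIV)" "c ` E \<subseteq> ?F"
        "(\<Oplus>e\<in>E. c e \<otimes> monom_at K (insert s S) e) = \<zero>" by auto
      obtain n where n: "\<forall>k\<in>(\<lambda>e. e s) ` E. k < n"
        using E(1) finite_nat_set_iff_bounded by (metis finite_imageI)
      let ?D = "\<lambda>j. {e \<in> S \<rightarrow>\<^sub>E (UNIV::nat set). e(s := j) \<in> E}"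
      define d where "d j = (\<Oplus>e\<in>?D j. c (e(s := j)) \<otimes> monom_at K S e)" for j
      let ?G = "generate_field K (C \<union> S)"
      have G: "subring ?G K" by (rule subfieldE(1)[OF generate_field_is_subfield[OF CS]])
      have SG: "S \<subseteq> ?G" "?F \<subseteq> ?G"
        using mono_generate_field[OF Un_upper1 CS] by (auto intro: generate_field.incl)
      have dG: "d j \<in> ?G" for j
        unfolding d_def
        by (rule finsum_in_subring[OF G], rule subringE(6)[OF G])
          (use E(3) SG monom_at_in_subring[OF G SG(1)] in auto)
      then have dc: "d j \<in> carrier K" for j using subringE(1)[OF G] by blast
      have "\<zero> = (\<Oplus>j\<in>{..<n}. d j \<otimes> s [^] j)"
        unfolding d_def E(4)[symmetric] by (rule sum_slices[OF S E(1,2)]) (use E(3) Fc n in auto)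
      also have "\<dots> = eval (map d (rev [0..<n])) s"
        by (rule eval_as_sum[symmetric]) (use Sc dc in auto)
      finally have ev: "eval (map d (rev [0..<n])) s = \<zero>" by simp
      \<comment> \<open>A nonzero coefficient would make s algebraic over C and S, so each slice is
        a relation among S alone.\<close>
      have d0: "d j = \<zero>" if "j < n" for j
      proof (rule ccontr)
        assume "d j \<noteq> \<zero>"
        then have "algebraic ?G s"
          by (intro algebraic_if_nonzero_coeff[OF G Sc(2) _ ev, of "d j"]) (use dG that in auto)
        then show False using asm Sc by (simp add: alg_iff)
      qed
      let ?j = "e s"
      have up: "(restrict e S)(s := ?j) = e"
        using e E(2) by (auto simp: fun_eq_iff PiE_def extensional_def restrict_def)
      have inj: "inj_on (\<lambda>e. e(s := ?j)) (?D ?j)"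
        by (rule inj_on_inverseI[where g = "\<lambda>e. restrict e S"]) (use restrict_upd[OF _ S(3)] in auto)
      have fin: "finite (?D ?j)"
        by (rule finite_imageD[OF finite_subset[OF _ E(1)] inj]) auto
      have jn: "?j < n" using n e by auto
      have "\<forall>e\<in>?D ?j. c (e(s := ?j)) = \<zero>"
        using asm fin d0[OF jn] E(3) unfolding alg_independent_monom_at d_def
        by (elim conjE allE[where x = "?D ?j"] allE[where x = "\<lambda>e. c (e(s := ?j))"]) blast
      moreover have "restrict e S \<in> ?D ?j" using up e by simp
      ultimately have "c ((restrict e S)(s := ?j)) = \<zero>" by blast
      then show "c e = \<zero>" using up by simp
    qed
  qed
qed

abbreviation ind :: "'a set \<Rightarrow> 'a set \<Rightarrow> bool" where
  "ind C S \<equiv> alg_independent K (generate_field K C) S"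

lemma ind_empty [simp]: "ind C {}" if C: "C \<subseteq> carrier K"
  unfolding alg_independent_monom_at
proof (intro allI impI ballI)
  fix E :: "('a \<Rightarrow> nat) set" and c e
  assume E: "finite E \<and> E \<subseteq> {} \<rightarrow>\<^sub>E UNIV \<and> c ` E \<subseteq> generate_field K C \<and>
    (\<Oplus>e\<in>E. c e \<otimes> monom_at K {} e) = \<zero>" and e: "e \<in> E"
  then have "E = {e}" by auto
  moreover have "c e \<in> carrier K"
    using E e subfieldE(3)[OF generate_field_is_subfield[OF C]] by blast
  ultimately show "c e = \<zero>" using E by (auto simp: monom_at_def)
qed

lemma ind_mono: "ind C' S \<Longrightarrow> C \<subseteq> C' \<Longrightarrow> C' \<subseteq> carrier K \<Longrightarrow> ind C S"
  using mono_generate_field[of C C'] unfolding alg_independent_def by (meson order_trans)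

lemma alg_Un_cong:
  assumes "alg K C = alg K C'" "C \<subseteq> carrier K" "C' \<subseteq> carrier K" "S \<subseteq> carrier K"
  shows "alg K (C \<union> S) = alg K (C' \<union> S)"
proof -
  have "alg K (C \<union> S) \<subseteq> alg K (C' \<union> S)"
    if "alg K C = alg K C'" "C \<subseteq> carrier K" "C' \<subseteq> carrier K" for C C'
  proof (rule alg_least)
    show "C' \<union> S \<subseteq> carrier K" using that assms by blast
    then show "C \<union> S \<subseteq> alg K (C' \<union> S)"
      using alg_mono[of C' "C' \<union> S"] alg_extensive[of "C' \<union> S"] alg_extensive[of C] that by blast
  qed
  then show ?thesis using assms by blast
qed

text \<open>By the insertion criterion, independence depends on the base only through its
  closure.\<close>

lemma ind_cong:
  assumes "alg K C = alg K C'" "C \<subseteq> carrier K" "C' \<subseteq> carrier K" "finite S" "S \<subseteq> carrier K"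
  shows "ind C S \<longleftrightarrow> ind C' S"
  using assms(4,5)
proof (induction S)
  case (insert s S)
  have "s \<in> carrier K" "S \<subseteq> carrier K" using insert.prems by auto
  then show ?case
    using alg_independent_insert[OF assms(2) insert.hyps(1) insert.prems insert.hyps(2)]
      alg_independent_insert[OF assms(3) insert.hyps(1) insert.prems insert.hyps(2)]
      alg_Un_cong[OF assms(1-3)] insert.IH by simp
qed (use assms in simp)

text \<open>Independence of {x, y} does not depend on the order of insertion: if y were not
  algebraic over x and C, the pair would be independent, and inserting x last says that x is not
  algebraic over y and C.\<close>

lemma alg_exchange:
  assumes C: "C \<subseteq> carrier K" and xy: "x \<in> carrier K" "y \<in> carrier K"
    and x: "x \<in> alg K (insert y C)" "x \<notin> alg K C"
  shows "y \<in> alg K (insert x C)"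
proof (rule ccontr)
  assume y: "y \<notin> alg K (insert x C)"
  have "x \<noteq> y" using y alg_extensive[of "insert x C"] C xy by auto
  have "ind C {x}"
    using alg_independent_insert[OF C, of "{}" x] x xy C by simp
  then have "ind C {y, x}"
    using alg_independent_insert[OF C, of "{x}" y] y xy \<open>x \<noteq> y\<close> by simp
  then have "ind C (insert x {y})" by (simp add: insert_commute)
  then have "x \<notin> alg K (C \<union> {y})"
    using alg_independent_insert[OF C, of "{y}" x] xy \<open>x \<noteq> y\<close> by simp
  then show False using x by simp
qed

text \<open>Moves b from the independent set into the base: the closure in the insertion criterion
  sees only the union of the two.\<close>

lemma ind_transfer:
  assumes D: "D \<subseteq> carrier K" and b: "b \<in> carrier K" and S: "finite S" "S \<subseteq> carrier K" "b \<notin> S"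
    and ind: "ind D (insert b S)"
  shows "ind (insert b D) S"
  using S ind
proof (induction S)
  case (insert s S)
  have bD: "insert b D \<subseteq> carrier K" using b D by simp
  have "ind D (insert s (insert b S))" using insert.prems by (simp add: insert_commute)
  then have "ind D (insert b S) \<and> s \<notin> alg K (D \<union> insert b S)"
    using alg_independent_insert[OF D, of "insert b S" s] insert.hyps insert.prems b by auto
  moreover have "insert b D \<union> S = D \<union> insert b S" by blast
  ultimately show ?case
    using insert.IH insert.prems insert.hyps
      alg_independent_insert[OF bD insert.hyps(1), of s] by simp
qed (use b D in simp)

text \<open>If the element s added last made x algebraic, exchange would make s algebraic over x, D
  and the earlier elements, against independence over the base containing x.\<close>

lemma not_alg_Un_ind:
  assumes D: "D \<subseteq> carrier K" and x: "x \<in> carrier K" "x \<notin> alg K D"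
    and S: "finite S" "S \<subseteq> carrier K" and ind: "ind (insert x D) S"
  shows "x \<notin> alg K (D \<union> S)"
  using S ind
proof (induction S)
  case (insert s S)
  have xD: "insert x D \<subseteq> carrier K" using x D by simp
  have "ind (insert x D) S" "s \<notin> alg K (insert x D \<union> S)"
    using alg_independent_insert[OF xD insert.hyps(1) insert.prems(1) insert.hyps(2)] insert.prems by auto
  moreover from this have "x \<notin> alg K (D \<union> S)" using insert by simp
  ultimately show ?case
    using alg_exchange[of "D \<union> S" x s] insert.prems D x by auto
qed (use x in simp)

text \<open>A relation has finitely many coefficients, and each lies in a field generated by
  finitely many elements.\<close>

lemma ind_finite_support:
  assumes C: "C \<subseteq> carrier K" and B: "B \<subseteq> carrier K"
    and fin: "\<And>B0. finite B0 \<Longrightarrow> B0 \<subseteq> B \<Longrightarrow> ind (C \<union> B0) S"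
  shows "ind (B \<union> C) S"
  unfolding alg_independent_def
proof (intro allI impI)
  fix E :: "('a \<Rightarrow> nat) set" and c
  assume E: "finite E \<and> E \<subseteq> S \<rightarrow>\<^sub>E UNIV \<and> c ` E \<subseteq> generate_field K (B \<union> C) \<and>
    (\<Oplus>e\<in>E. c e \<otimes> (\<Otimes>x\<in>S. x [^] e x)) = \<zero>"
  obtain A0 where A0: "finite A0" "A0 \<subseteq> B \<union> C" "c ` E \<subseteq> generate_field K A0"
    using generate_field_finite_set[of "c ` E" "B \<union> C"] E B C by blast
  have "generate_field K A0 \<subseteq> generate_field K (C \<union> (A0 \<inter> B))"
    by (rule mono_generate_field) (use A0 B C in auto)
  then have "c ` E \<subseteq> generate_field K (C \<union> (A0 \<inter> B))" using A0 by blast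
  moreover have "ind (C \<union> (A0 \<inter> B)) S" using fin A0 by simp
  ultimately show "\<forall>e\<in>E. c e = \<zero>" using E unfolding alg_independent_def by blast
qed

section \<open>Independence and intersections of closures\<close>

lemma exists_maximal_ind:
  assumes D: "D \<subseteq> carrier K" and A: "finite A" "A \<subseteq> carrier K"
  shows "\<exists>S\<subseteq>A. ind D S \<and> A \<subseteq> alg K (D \<union> S)"
  using A
proof (induction A)
  case empty
  then show ?case using D by simp
next
  case (insert a A)
  then obtain S where S: "S \<subseteq> A" "ind D S" "A \<subseteq> alg K (D \<union> S)" by auto
  have fS: "finite S" "S \<subseteq> carrier K" "a \<notin> S" "a \<in> carrier K"
    using S insert finite_subset by auto
  show ?case
  proof (cases "a \<in> alg K (D \<union> S)")
    case True
    then show ?thesis using S by blast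
  next
    case False
    then have "ind D (insert a S)"
      using alg_independent_insert[OF D fS(1), of a] fS S by simp
    moreover have DS: "D \<union> insert a S \<subseteq> carrier K" using D fS by auto
    moreover have "alg K (D \<union> S) \<subseteq> alg K (D \<union> insert a S)" by (rule alg_mono[OF _ DS]) auto
    moreover have "a \<in> alg K (D \<union> insert a S)" using alg_extensive[OF DS] by auto
    ultimately show ?thesis using S by (intro exI[of _ "insert a S"]) auto
  qed
qed

text \<open>An x in both closures is algebraic over D and a finite subset S of A that is independent
  over D. By hypothesis S stays independent over B and C, hence over D enlarged by x, since x lies
  in alg(BC); so S cannot be what made x algebraic.\<close>

theorem indep_alg_imp_alg_Int:
  assumes A: "A \<subseteq> carrier K" and B: "B \<subseteq> carrier K" and C: "C \<subseteq> carrier K"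
    and ind: "indep_alg K A C B" and D: "C \<subseteq> D" "D \<subseteq> alg K (B \<union> C)"
  shows "alg K (A \<union> D) \<inter> alg K (B \<union> D) = alg K D"
proof
  have Dc: "D \<subseteq> carrier K" using D alg_carrier by blast
  have BC: "B \<union> C \<subseteq> carrier K" using B C by simp
  have AD: "A \<union> D \<subseteq> carrier K" using A Dc by simp
  show "alg K D \<subseteq> alg K (A \<union> D) \<inter> alg K (B \<union> D)"
    using alg_mono[of D "A \<union> D"] alg_mono[of D "B \<union> D"] AD B Dc by auto
  show "alg K (A \<union> D) \<inter> alg K (B \<union> D) \<subseteq> alg K D"
  proof
    fix x assume x: "x \<in> alg K (A \<union> D) \<inter> alg K (B \<union> D)"
    then have xc: "x \<in> carrier K" using alg_carrier by blast
    have "alg K (B \<union> D) \<subseteq> alg K (B \<union> C)"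
      by (rule alg_least[OF _ BC]) (use D alg_extensive[OF BC] in blast)
    then have xBC: "x \<in> alg K (B \<union> C)" using x by blast
    obtain A1 where A1: "finite A1" "A1 \<subseteq> A \<union> D" "x \<in> alg K A1"
      using x alg_finite_support[OF _ AD] by blast
    obtain S where S: "S \<subseteq> A1 \<inter> A" "ind D S" "A1 \<inter> A \<subseteq> alg K (D \<union> S)"
      using exists_maximal_ind[OF Dc, of "A1 \<inter> A"] A1 A by blast
    have fS: "finite S" "S \<subseteq> A" "S \<subseteq> carrier K" using S A1 A finite_subset by auto
    have DS: "D \<union> S \<subseteq> carrier K" using Dc fS by simp
    have "A1 \<subseteq> alg K (D \<union> S)" using S A1 alg_extensive[OF DS] by blast
    then have xDS: "x \<in> alg K (D \<union> S)" using A1 alg_least[OF _ DS] by blast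
    have "ind C S" using ind_mono[OF S(2) D(1) Dc] .
    then have "ind (B \<union> C) S" using ind fS unfolding indep_alg_def by blast
    then have "ind (alg K (B \<union> C)) S"
      using ind_cong[OF alg_idem[OF BC] alg_carrier BC fS(1,3)] by simp
    then have "ind (insert x D) S"
      by (rule ind_mono) (use xBC D alg_carrier in auto)
    then show "x \<in> alg K D"
      using not_alg_Un_ind[OF Dc xc _ fS(1,3)] xDS by blast
  qed
qed

text \<open>Elements of B enter the base D one at a time. A new b outside alg(D) lies in alg(BD), so
  by hypothesis outside alg(AD); then S together with b is independent over D, and b may be moved
  into the base.\<close>

theorem alg_Int_imp_indep_alg:
  assumes A: "A \<subseteq> carrier K" and B: "B \<subseteq> carrier K" and C: "C \<subseteq> carrier K"
    and Int: "\<And>D. C \<subseteq> D \<Longrightarrow> D \<subseteq> B \<union> C \<Longrightarrow> alg K (A \<union> D) \<inter> alg K (B \<union> D) = alg K D"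
  shows "indep_alg K A C B"
  unfolding indep_alg_def
proof (intro allI impI)
  fix S assume S: "finite S \<and> S \<subseteq> A \<and> ind C S"
  then have fS: "finite S" "S \<subseteq> A" "S \<subseteq> carrier K" using A by auto
  show "ind (B \<union> C) S"
  proof (rule ind_finite_support[OF C B])
    fix B0 assume "finite B0" "B0 \<subseteq> B"
    then show "ind (C \<union> B0) S"
    proof (induction B0)
      case empty
      then show ?case using S by simp
    next
      case (insert b B0)
      let ?D = "C \<union> B0"
      have D: "?D \<subseteq> carrier K" and b: "b \<in> carrier K" using insert.prems B C by auto
      have ind: "ind ?D S" using insert by simp
      have bD: "insert b ?D \<subseteq> carrier K" using b D by simp
      have "ind (insert b ?D) S"
      proof (cases "b \<in> alg K ?D")
        case True
        have "alg K (insert b ?D) = alg K ?D"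
          using alg_least[of "insert b ?D" ?D] alg_mono[of ?D "insert b ?D"] True
            alg_extensive[OF D] D bD by blast
        then show ?thesis using ind_cong[OF _ bD D fS(1,3)] ind by simp
      next
        case False
        have AD: "A \<union> ?D \<subseteq> carrier K" "B \<union> ?D \<subseteq> carrier K" using A B D by auto
        have "b \<in> alg K (B \<union> ?D)" using alg_extensive[OF AD(2)] insert.prems by auto
        then have "b \<notin> alg K (A \<union> ?D)" using Int[of ?D] False insert.prems by auto
        moreover have "alg K (?D \<union> S) \<subseteq> alg K (A \<union> ?D)"
          by (rule alg_mono[OF _ AD(1)]) (use fS in auto)
        ultimately have nb: "b \<notin> alg K (?D \<union> S)" by blast
        have "?D \<union> S \<subseteq> carrier K" using D fS by simp
        then have bS: "b \<notin> S" using nb alg_extensive by blast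
        have "ind ?D (insert b S)"
          using alg_independent_insert[OF D fS(1), of b] nb bS b fS ind by simp
        then show ?thesis using ind_transfer[OF D b fS(1,3) bS] by simp
      qed
      then show ?case by simp
    qed
  qed
qed

end

section \<open>Specializations and amalgamation\<close>

lemma (in cring) exists_maximalideal:
  assumes J: "ideal J R" "\<one> \<notin> J"
  obtains M where "maximalideal M R" "J \<subseteq> M"
proof -
  let ?A = "{I. ideal I R \<and> J \<subseteq> I \<and> \<one> \<notin> I}"
  have "\<exists>M\<in>?A. \<forall>I\<in>?A. M \<subseteq> I \<longrightarrow> I = M"
  proof (rule subset_Zorn)
    fix C assume C: "subset.chain ?A C"
    show "\<exists>U\<in>?A. \<forall>I\<in>C. I \<subseteq> U"
    proof (cases "C = {}")
      case True
      then show ?thesis using J by auto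
    next
      case False
      have CA: "C \<subseteq> ?A" using C by (simp add: pred_on.chain_def)
      have "subset.chain {I. ideal I R} C"
        using C by (auto simp: pred_on.chain_def)
      then have "ideal (\<Union>C) R" using chain_Union_is_ideal[of C] False by simp
      then show ?thesis using False CA by (intro bexI[of _ "\<Union>C"]) auto
    qed
  qed
  then obtain M where M: "ideal M R" "J \<subseteq> M" "\<one> \<notin> M"
    and max: "\<And>I. I \<in> ?A \<Longrightarrow> M \<subseteq> I \<Longrightarrow> I = M" by auto
  have "maximalideal M R"
  proof (rule maximalidealI[OF M(1)])
    show "carrier R \<noteq> M" using M(3) by auto
    fix I assume I: "ideal I R" "M \<subseteq> I" "I \<subseteq> carrier R"
    show "I = M \<or> I = carrier R"
      using max[of I] I M(2) ideal.one_imp_carrier[OF I(1)] by blast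
  qed
  then show thesis using that M(2) by blast
qed

lemma (in cring) exists_hom_to_field:
  assumes J: "ideal J R" "\<one> \<notin> J"
  obtains Q :: "'a set ring" and h where "field Q" "h \<in> ring_hom R Q" "\<And>x. x \<in> J \<Longrightarrow> h x = \<zero>\<^bsub>Q\<^esub>"
proof -
  obtain M where M: "maximalideal M R" "J \<subseteq> M" using exists_maximalideal[OF J] .
  interpret M: maximalideal M R by (rule M(1))
  show thesis
  proof (rule that[of "R Quot M" "(+>) M"])
    show "field (R Quot M)" by (rule M.quotient_is_field[OF is_cring])
    show "(+>) M \<in> ring_hom R (R Quot M)" by (rule M.rcos_ring_hom)
    show "M +> x = \<zero>\<^bsub>R Quot M\<^esub>" if "x \<in> J" for x
      using a_rcos_zero[OF M.ideal_axioms] that M(2) by (auto simp: FactRing_def)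
  qed
qed

text \<open>The homomorphism theorem for an image inside S. In the application g evaluates
  polynomials at t and h evaluates their specializations at a point of F, which yields a
  homomorphism on A[t].\<close>

lemma ring_hom_factor:
  assumes P: "ring P" and S: "ring S" and g: "g \<in> ring_hom P S" and h: "h \<in> ring_hom P S"
    and ker: "\<And>f. f \<in> carrier P \<Longrightarrow> g f = \<zero>\<^bsub>S\<^esub> \<Longrightarrow> h f = \<zero>\<^bsub>S\<^esub>"
  obtains \<psi> where "\<psi> \<in> ring_hom (S\<lparr>carrier := g ` carrier P\<rparr>) S"
    "\<And>f. f \<in> carrier P \<Longrightarrow> \<psi> (g f) = h f"
proof -
  interpret P: ring P by fact
  interpret S: ring S by fact
  interpret g: ring_hom_ring P S g by (rule ring_hom_ringI2[OF P S g])
  interpret h: ring_hom_ring P S h by (rule ring_hom_ringI2[OF P S h])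
  define \<psi> where "\<psi> b = h (SOME f. f \<in> carrier P \<and> g f = b)" for b
  have \<psi>: "\<psi> (g f) = h f" if f: "f \<in> carrier P" for f
  proof -
    define f' where "f' = (SOME f'. f' \<in> carrier P \<and> g f' = g f)"
    have "f' \<in> carrier P \<and> g f' = g f"
      unfolding f'_def by (rule someI[of _ f]) (use f in auto)
    then have f': "f' \<in> carrier P" "g f' = g f" by auto
    have "g (f' \<ominus>\<^bsub>P\<^esub> f) = \<zero>\<^bsub>S\<^esub>"
      using f f' by (simp add: a_minus_def S.r_neg)
    then have "h (f' \<ominus>\<^bsub>P\<^esub> f) = \<zero>\<^bsub>S\<^esub>" using ker f f' by simp
    then have "h f' \<ominus>\<^bsub>S\<^esub> h f = \<zero>\<^bsub>S\<^esub>" using f f' by (simp add: a_minus_def)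
    then have "h f' = h f" using f f' by (simp add: S.r_right_minus_eq)
    then show ?thesis by (simp add: \<psi>_def f'_def)
  qed
  have "\<psi> \<in> ring_hom (S\<lparr>carrier := g ` carrier P\<rparr>) S"
  proof (rule ring_hom_memI)
    show "\<psi> x \<in> carrier S" if "x \<in> carrier (S\<lparr>carrier := g ` carrier P\<rparr>)" for x
      using that \<psi> by auto
  next
    fix x y assume "x \<in> carrier (S\<lparr>carrier := g ` carrier P\<rparr>)" "y \<in> carrier (S\<lparr>carrier := g ` carrier P\<rparr>)"
    then obtain a b where ab: "a \<in> carrier P" "x = g a" "b \<in> carrier P" "y = g b" by auto
    show "\<psi> (x \<otimes>\<^bsub>S\<lparr>carrier := g ` carrier P\<rparr>\<^esub> y) = \<psi> x \<otimes>\<^bsub>S\<^esub> \<psi> y"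
      using \<psi>[of "a \<otimes>\<^bsub>P\<^esub> b"] \<psi> ab by simp
    show "\<psi> (x \<oplus>\<^bsub>S\<lparr>carrier := g ` carrier P\<rparr>\<^esub> y) = \<psi> x \<oplus>\<^bsub>S\<^esub> \<psi> y"
      using \<psi>[of "a \<oplus>\<^bsub>P\<^esub> b"] \<psi> ab by simp
  next
    show "\<psi> \<one>\<^bsub>S\<lparr>carrier := g ` carrier P\<rparr>\<^esub> = \<one>\<^bsub>S\<^esub>"
      using \<psi>[of "\<one>\<^bsub>P\<^esub>"] by simp
  qed
  then show thesis using that \<psi> by blast
qed

section \<open>The Nullstellensatz, one generator at a time\<close>

definition (in ring) roots_closed :: "'a set \<Rightarrow> bool" where
  "roots_closed F \<longleftrightarrow> (\<forall>p. set p \<subseteq> F \<and> 2 \<le> length p \<and> hd p \<noteq> \<zero> \<longrightarrow> (\<exists>x\<in>F. eval p x = \<zero>))"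

text \<open>Points of A with values in F exist outside every hypersurface. Demanding this for all
  nonzero r, and not only for r = 1, is what carries the property from A to A[t]: leading
  coefficients have to be kept nonzero.\<close>

definition (in ring) specializable :: "'a set \<Rightarrow> 'a set \<Rightarrow> bool" where
  "specializable F A \<longleftrightarrow> subring A R \<and> F \<subseteq> A \<and>
     (\<forall>r\<in>A. r \<noteq> \<zero> \<longrightarrow> (\<exists>\<phi>\<in>ring_hom (R\<lparr>carrier := A\<rparr>) R. \<phi> ` A \<subseteq> F \<and> (\<forall>x\<in>F. \<phi> x = x) \<and> \<phi> r \<noteq> \<zero>))"

context field
begin

lemma pow_in_subring:
  assumes "subring E R" "x \<in> E" shows "x [^] (k::nat) \<in> E"
  by (induction k) (use assms subringE(3,6)[OF assms(1)] in auto)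

context
  fixes F A t
  assumes F: "subfield F R" and rF: "roots_closed F" and A: "subring A R" and FA: "F \<subseteq> A"
    and t: "t \<in> carrier R"
begin

abbreviation "AR \<equiv> R\<lparr>carrier := A\<rparr>"
abbreviation "PR \<equiv> UP AR"

lemma UP_domain_AR: "UP_domain AR"
  by (intro UP_domain.intro subring_is_domain A)

interpretation U: UP_domain AR PR
  by (rule UP_domain_AR) simp

lemma coeff_in: "f \<in> carrier PR \<Longrightarrow> up_ring.coeff PR f i \<in> A"
  using U.coeff_closed[of f i] by simp

definition specialize :: "('a \<Rightarrow> 'a) \<Rightarrow> 'a \<Rightarrow> (nat \<Rightarrow> 'a) \<Rightarrow> 'a" where
  "specialize \<phi> x = UnivPoly.eval AR R \<phi> x"

lemma UP_prop: "\<phi> \<in> ring_hom AR R \<Longrightarrow> UP_pre_univ_prop AR R \<phi>"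
  by (rule UP_pre_univ_propI[OF U.R.is_cring is_cring])

lemma specialize_hom:
  assumes "\<phi> \<in> ring_hom AR R" "x \<in> carrier R" shows "specialize \<phi> x \<in> ring_hom PR R"
proof -
  interpret E: UP_pre_univ_prop AR R \<phi> PR by (rule UP_prop[OF assms(1)]) simp
  show ?thesis unfolding specialize_def by (rule E.eval_ring_hom[OF assms(2)])
qed

lemma specialize_const:
  assumes "\<phi> \<in> ring_hom AR R" "x \<in> carrier R" "c \<in> A"
  shows "specialize \<phi> x (up_ring.monom PR c 0) = \<phi> c"
proof -
  interpret E: UP_pre_univ_prop AR R \<phi> PR by (rule UP_prop[OF assms(1)]) simp
  show ?thesis unfolding specialize_def by (rule E.eval_const) (use assms in auto)
qed

lemma specialize_var:
  assumes "\<phi> \<in> ring_hom AR R" "x \<in> carrier R"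
  shows "specialize \<phi> x (up_ring.monom PR \<one> 1) = x"
proof -
  interpret E: UP_pre_univ_prop AR R \<phi> PR by (rule UP_prop[OF assms(1)]) simp
  show ?thesis unfolding specialize_def using E.eval_monom1[OF assms(2)] by simp
qed

lemma specialize_smult:
  assumes "\<phi> \<in> ring_hom AR R" "x \<in> carrier R" "c \<in> A" "f \<in> carrier PR"
  shows "specialize \<phi> x (c \<odot>\<^bsub>PR\<^esub> f) = \<phi> c \<otimes> specialize \<phi> x f"
proof -
  have "c \<odot>\<^bsub>PR\<^esub> f = up_ring.monom PR c 0 \<otimes>\<^bsub>PR\<^esub> f"
    using U.monom_mult_is_smult[of c f] assms by simp
  then show ?thesis
    using ring_hom_mult[OF specialize_hom[OF assms(1,2)]] specialize_const[OF assms(1-3)]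
      U.monom_closed[of c 0] assms by simp
qed

lemma specialize_eval:
  assumes \<phi>: "\<phi> \<in> ring_hom AR R" and x: "x \<in> carrier R" and f: "f \<in> carrier PR"
  shows "specialize \<phi> x f = eval (map (\<lambda>i. \<phi> (up_ring.coeff PR f i)) (rev [0..<Suc (deg AR f)])) x"
proof -
  have "\<phi> (up_ring.coeff PR f i) \<in> carrier R" for i
    using ring_hom_closed[OF \<phi>] coeff_in[OF f] by simp
  then show ?thesis
    unfolding specialize_def U.eval_on_carrier[OF f] using x
    by (subst eval_as_sum) (auto simp: lessThan_Suc_atMost)
qed

lemma specialize_in:
  assumes \<phi>: "\<phi> \<in> ring_hom AR R" "\<phi> ` A \<subseteq> F" and x: "x \<in> F" and f: "f \<in> carrier PR"
  shows "specialize \<phi> x f \<in> F"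
proof -
  have "\<phi> (up_ring.coeff PR f i) \<in> F" for i using \<phi> coeff_in[OF f] by blast
  then show ?thesis
    unfolding specialize_def U.eval_on_carrier[OF f]
    by (intro finsum_in_subring[OF subfieldE(1)[OF F]] subringE(6)[OF subfieldE(1)[OF F]]
        pow_in_subring[OF subfieldE(1)[OF F]] x)
qed

text \<open>As \<phi> keeps the leading coefficient nonzero, the image of f still has positive
  degree and hence a root in F.\<close>

lemma specialize_root:
  assumes \<phi>: "\<phi> \<in> ring_hom AR R" "\<phi> ` A \<subseteq> F" and f: "f \<in> carrier PR" "1 \<le> deg AR f"
    and lc: "\<phi> (up_ring.coeff PR f (deg AR f)) \<noteq> \<zero>"
  obtains x where "x \<in> F" "specialize \<phi> x f = \<zero>"
proof -
  let ?p = "map (\<lambda>i. \<phi> (up_ring.coeff PR f i)) (rev [0..<Suc (deg AR f)])"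
  have "set ?p \<subseteq> F" using \<phi> coeff_in[OF f(1)] by auto
  moreover have "2 \<le> length ?p" using f by simp
  moreover have "hd ?p \<noteq> \<zero>" using lc by simp
  ultimately obtain x where x: "x \<in> F" "eval ?p x = \<zero>" using rF unfolding roots_closed_def by blast
  moreover have "x \<in> carrier R" using x subfieldE(3)[OF F] by blast
  ultimately show thesis using that specialize_eval[OF \<phi>(1) _ f(1)] by simp
qed

text \<open>In positive degree, a root of f - 1 is a point where f takes the value 1.\<close>

lemma specialize_nonroot:
  assumes \<phi>: "\<phi> \<in> ring_hom AR R" "\<phi> ` A \<subseteq> F" and f: "f \<in> carrier PR"
    and lc: "\<phi> (up_ring.coeff PR f (deg AR f)) \<noteq> \<zero>"
  obtains x where "x \<in> F" "specialize \<phi> x f \<noteq> \<zero>"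
proof (cases "deg AR f = 0")
  case True
  have "\<one> \<in> F" using subringE(3)[OF subfieldE(1)[OF F]] .
  moreover have "\<phi> (up_ring.coeff PR f 0) \<in> carrier R"
    using ring_hom_closed[OF \<phi>(1)] coeff_in[OF f] by simp
  then have "specialize \<phi> \<one> f = \<phi> (up_ring.coeff PR f 0)"
    using specialize_eval[OF \<phi>(1) _ f, of \<one>] True by simp
  ultimately show thesis using that lc True by simp
next
  case False
  let ?g = "f \<ominus>\<^bsub>PR\<^esub> \<one>\<^bsub>PR\<^esub>"
  have g: "?g \<in> carrier PR" using f by simp
  have "\<ominus>\<^bsub>AR\<^esub> \<zero> = \<zero>" using U.R.minus_zero by simp
  \<comment> \<open>Only the constant coefficient changes, and the degree is positive, so f - 1 has
    the degree and the leading coefficient of f.\<close>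
  then have cg: "up_ring.coeff PR ?g n = up_ring.coeff PR f n" if "n \<ge> deg AR f" for n
    using that False f coeff_in[OF f, of n] subringE(1)[OF A]
    by (auto simp: a_minus_def[of AR])
  have dg: "deg AR ?g = deg AR f"
  proof (rule le_antisym)
    have "up_ring.coeff PR ?g m = \<zero>\<^bsub>AR\<^esub>" if "deg AR f < m" for m
      using cg[of m] that U.deg_aboveD[OF that f] by simp
    then show "deg AR ?g \<le> deg AR f" by (rule U.deg_aboveI[OF _ g])
    have "up_ring.coeff PR ?g (deg AR f) \<noteq> \<zero>\<^bsub>AR\<^esub>"
      using cg[of "deg AR f"] U.lcoeff_nonzero_deg[OF False f] by simp
    then show "deg AR f \<le> deg AR ?g" by (rule U.deg_belowI[OF _ g])
  qed
  have "\<phi> (up_ring.coeff PR ?g (deg AR ?g)) \<noteq> \<zero>" using lc cg dg by simp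
  then obtain x where x: "x \<in> F" "specialize \<phi> x ?g = \<zero>"
    using specialize_root[OF \<phi> g] dg False by auto
  have xc: "x \<in> carrier R" using x subfieldE(3)[OF F] by blast
  interpret h: ring_hom_ring PR R "specialize \<phi> x"
    by (rule ring_hom_ringI2[OF U.P.ring_axioms ring_axioms specialize_hom[OF \<phi>(1) xc]])
  have "specialize \<phi> x f \<ominus> \<one> = \<zero>"
    using x f by (simp add: a_minus_def)
  then have "specialize \<phi> x f = \<one>"
    using f by (simp add: r_right_minus_eq)
  then show thesis using that x one_not_zero by simp
qed

text \<open>A[t] is the image of A[X] under evaluation at t, so a suitable homomorphism on it
  amounts to a homomorphism \<phi> on A and a point x of F at which the image of every polynomial
  vanishing at t vanishes. Both have to be chosen so that a given nonzero s = f(t) survives.\<close>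

lemma specializable_adjoin:
  assumes N: "specializable F A"
  shows "\<exists>B. specializable F B \<and> A \<subseteq> B \<and> t \<in> B"
proof -
  have id: "id \<in> ring_hom AR R"
    by (rule ring_hom_memI) (use subringE(1)[OF A] in auto)
  let ?e = "specialize id t"
  have eh: "?e \<in> ring_hom PR R" by (rule specialize_hom[OF id t])
  interpret e: ring_hom_ring PR R ?e
    by (rule ring_hom_ringI2[OF U.P.ring_axioms ring_axioms eh])
  define B where "B = ?e ` carrier PR"
  have B: "subring B R"
    unfolding B_def by (rule e.img_is_subring[OF U.P.carrier_is_subring])
  have eA: "?e (up_ring.monom PR a 0) = a" if "a \<in> A" for a
    using specialize_const[OF id t that] by simp
  have mA: "up_ring.monom PR a 0 \<in> carrier PR" if "a \<in> A" for a using that by simp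
  have AB: "A \<subseteq> B"
  proof
    fix a assume "a \<in> A"
    then show "a \<in> B" unfolding B_def using eA mA by (metis image_eqI)
  qed
  have "up_ring.monom PR \<one> 1 \<in> carrier PR" using U.monom_closed[of \<one> 1] subringE(3)[OF A] by simp
  then have tB: "t \<in> B" unfolding B_def using specialize_var[OF id t] by (metis image_eqI)
  have Ac: "A \<subseteq> carrier R" by (rule subringE(1)[OF A])
  have smult: "?e (c \<odot>\<^bsub>PR\<^esub> f) = c \<otimes> ?e f" if "c \<in> A" "f \<in> carrier PR" for c f
    using specialize_smult[OF id t that] by simp
  have lcA: "up_ring.coeff PR g n [^]\<^bsub>AR\<^esub> (k::nat) = up_ring.coeff PR g n [^] k" for g n k
    by (simp add: nat_pow_def)
  have lc0: "up_ring.coeff PR g (deg AR g) \<noteq> \<zero>" if "g \<in> carrier PR" "g \<noteq> \<zero>\<^bsub>PR\<^esub>" for g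
    using U.lcoeff_nonzero2[OF that] by simp
  have pow0: "c [^] (k::nat) \<noteq> \<zero>" if "c \<in> carrier R" "c \<noteq> \<zero>" for c k
    using that by (induction k) (auto dest: integral)
  have div: "\<exists>q r (k::nat). q \<in> carrier PR \<and> r \<in> carrier PR \<and>
      up_ring.coeff PR g (deg AR g) [^] k \<odot>\<^bsub>PR\<^esub> f = g \<otimes>\<^bsub>PR\<^esub> q \<oplus>\<^bsub>PR\<^esub> r \<and>
      (r = \<zero>\<^bsub>PR\<^esub> \<or> deg AR r < deg AR g)"
    if "g \<in> carrier PR" "f \<in> carrier PR" "g \<noteq> \<zero>\<^bsub>PR\<^esub>" for f g
    using U.long_div_theorem[OF that] unfolding lcA by blast
  have const: "f = up_ring.monom PR (up_ring.coeff PR f 0) 0" if "f \<in> carrier PR" "deg AR f = 0" for f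
    using U.deg_zero_impl_monom[OF that] .
  have extend: "\<exists>\<psi>\<in>ring_hom (R\<lparr>carrier := B\<rparr>) R. \<psi> ` B \<subseteq> F \<and> (\<forall>x\<in>F. \<psi> x = x) \<and>
      (\<forall>f\<in>carrier PR. \<psi> (?e f) = specialize \<phi> x f)"
    if \<phi>: "\<phi> \<in> ring_hom AR R" "\<phi> ` A \<subseteq> F" "\<forall>x\<in>F. \<phi> x = x" and x: "x \<in> F"
      and ker: "\<And>f. f \<in> carrier PR \<Longrightarrow> ?e f = \<zero> \<Longrightarrow> specialize \<phi> x f = \<zero>" for \<phi> x
  proof -
    have xc: "x \<in> carrier R" using x subfieldE(3)[OF F] by blast
    obtain \<psi> where \<psi>: "\<psi> \<in> ring_hom (R\<lparr>carrier := B\<rparr>) R"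
      "\<And>f. f \<in> carrier PR \<Longrightarrow> \<psi> (?e f) = specialize \<phi> x f"
      using ring_hom_factor[OF U.P.ring_axioms ring_axioms eh specialize_hom[OF \<phi>(1) xc] ker]
      unfolding B_def by blast
    have "\<psi> ` B \<subseteq> F"
      unfolding B_def using \<psi>(2) specialize_in[OF \<phi>(1,2) x] by auto
    moreover have "\<psi> y = y" if "y \<in> F" for y
    proof -
      have yA: "y \<in> A" using that FA by blast
      have "\<psi> y = specialize \<phi> x (up_ring.monom PR y 0)"
        using \<psi>(2)[OF mA[OF yA]] eA[OF yA] by simp
      then show ?thesis using specialize_const[OF \<phi>(1) xc yA] \<phi>(3) that by simp
    qed
    ultimately show ?thesis using \<psi> by blast
  qed
  have "\<exists>\<psi>\<in>ring_hom (R\<lparr>carrier := B\<rparr>) R. \<psi> ` B \<subseteq> F \<and> (\<forall>x\<in>F. \<psi> x = x) \<and> \<psi> s \<noteq> \<zero>"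
    if sB: "s \<in> B" and s0: "s \<noteq> \<zero>" for s
  proof -
    obtain f where f: "f \<in> carrier PR" "?e f = s" using sB by (auto simp: B_def)
    have fn0: "f \<noteq> \<zero>\<^bsub>PR\<^esub>" using f s0 by auto
    show ?thesis
    proof (cases "\<exists>p\<in>carrier PR. p \<noteq> \<zero>\<^bsub>PR\<^esub> \<and> ?e p = \<zero>")
      \<comment> \<open>Here t is transcendental over A, so the only condition on x is that the
        image of f does not vanish there.\<close>
      case False
      obtain \<phi> where \<phi>: "\<phi> \<in> ring_hom AR R" "\<phi> ` A \<subseteq> F" "\<forall>x\<in>F. \<phi> x = x"
        "\<phi> (up_ring.coeff PR f (deg AR f)) \<noteq> \<zero>"
        using N coeff_in[OF f(1)] lc0[OF f(1) fn0] unfolding specializable_def by blast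
      obtain x where x: "x \<in> F" "specialize \<phi> x f \<noteq> \<zero>"
        using specialize_nonroot[OF \<phi>(1,2) f(1) \<phi>(4)] by blast
      have xc: "x \<in> carrier R" using x subfieldE(3)[OF F] by blast
      interpret h: ring_hom_ring PR R "specialize \<phi> x"
        by (rule ring_hom_ringI2[OF U.P.ring_axioms ring_axioms specialize_hom[OF \<phi>(1) xc]])
      have "specialize \<phi> x g = \<zero>" if "g \<in> carrier PR" "?e g = \<zero>" for g
        using False that by auto
      then obtain \<psi> where "\<psi>\<in>ring_hom (R\<lparr>carrier := B\<rparr>) R" "\<psi> ` B \<subseteq> F" "\<forall>x\<in>F. \<psi> x = x"
        "\<forall>f\<in>carrier PR. \<psi> (?e f) = specialize \<phi> x f"
        using extend[OF \<phi>(1-3) x(1)] by blast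
      then show ?thesis using x f by (intro bexI[of _ \<psi>]) auto
    next
      \<comment> \<open>Here t is algebraic over A. With p of least degree among the nonzero
        polynomials vanishing at t, pseudo-division by p decides which polynomials vanish at t;
        powers of the leading coefficient of p take the place of inverses.\<close>
      case True
      define Q where "Q p \<longleftrightarrow> p \<in> carrier PR \<and> p \<noteq> \<zero>\<^bsub>PR\<^esub> \<and> ?e p = \<zero>" for p
      have "\<exists>p. Q p" using True unfolding Q_def by blast
      then obtain p where Qp: "Q p" and min: "\<And>q. Q q \<Longrightarrow> deg AR p \<le> deg AR q"
        using ex_has_least_nat[of Q _ "deg AR"] by blast
      have p: "p \<in> carrier PR" "p \<noteq> \<zero>\<^bsub>PR\<^esub>" "?e p = \<zero>" using Qp by (auto simp: Q_def)
      have dp: "1 \<le> deg AR p"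
      proof (rule ccontr)
        assume "\<not> 1 \<le> deg AR p"
        then have d0: "deg AR p = 0" by simp
        then have "?e p = up_ring.coeff PR p 0"
          using const[OF p(1) d0] eA[OF coeff_in[OF p(1)]] by metis
        then show False using p lc0[OF p(1,2)] d0 by simp
      qed
      let ?l = "up_ring.coeff PR p (deg AR p)"
      have l: "?l \<in> A" "?l \<noteq> \<zero>" using coeff_in[OF p(1)] lc0[OF p(1,2)] by auto
      have nz: "?e g \<noteq> \<zero>" if "g \<in> carrier PR" "g \<noteq> \<zero>\<^bsub>PR\<^esub>" "deg AR g < deg AR p" for g
        using min[of g] that by (auto simp: Q_def)
      \<comment> \<open>Division with remainder of the minimal polynomial by g, as in Euclid's algorithm,
        makes the value of g at t a divisor of a nonzero element of A.\<close>
      have euclid: "\<exists>h\<in>carrier PR. \<exists>c\<in>A. c \<noteq> \<zero> \<and> ?e g \<otimes> ?e h = c"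
        if "g \<in> carrier PR" "g \<noteq> \<zero>\<^bsub>PR\<^esub>" "deg AR g < deg AR p" for g
        using that
      proof (induction "deg AR g" arbitrary: g rule: less_induct)
        case less
        note g = less.prems
        have egc: "?e g \<in> carrier R" using g by simp
        show ?case
        proof (cases "deg AR g = 0")
          case True
          let ?c = "up_ring.coeff PR g 0"
          have "?e g = ?c" using const[OF g(1) True] eA[OF coeff_in[OF g(1)]] by metis
          then have "?e g \<otimes> ?e \<one>\<^bsub>PR\<^esub> = ?c" using egc by simp
          moreover have "?c \<noteq> \<zero>" using lc0[OF g(1,2)] True by simp
          ultimately show ?thesis using coeff_in[OF g(1)] U.P.one_closed by blast
        next
          case False
          let ?lg = "up_ring.coeff PR g (deg AR g)"
          obtain q r k where q: "q \<in> carrier PR" and r: "r \<in> carrier PR"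
            and eq: "?lg [^] (k::nat) \<odot>\<^bsub>PR\<^esub> p = g \<otimes>\<^bsub>PR\<^esub> q \<oplus>\<^bsub>PR\<^esub> r"
            and dr: "r = \<zero>\<^bsub>PR\<^esub> \<or> deg AR r < deg AR g"
            using div[OF g(1) p(1) g(2)] by blast
          have lg: "?lg [^] k \<in> A" "?lg [^] k \<noteq> \<zero>"
            using pow_in_subring[OF A coeff_in[OF g(1)]] pow0[of ?lg k] lc0[OF g(1,2)]
              coeff_in[OF g(1)] Ac by auto
          have eqr: "?e q \<in> carrier R" "?e r \<in> carrier R" using q r by auto
          have "?e (?lg [^] k \<odot>\<^bsub>PR\<^esub> p) = \<zero>" using smult[OF lg(1) p(1)] p(3) lg(1) Ac by auto
          then have sum0: "?e g \<otimes> ?e q \<oplus> ?e r = \<zero>" unfolding eq using g q r by simp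
          show ?thesis
          proof (cases "r = \<zero>\<^bsub>PR\<^esub>")
            \<comment> \<open>Impossible: q would be nonzero, vanish at t and have degree below that
              of p, as the degrees of g and q add up to that of p and g is not constant.\<close>
            case True
            then have "?e g \<otimes> ?e q = \<zero>" using sum0 g q by simp
            then have q0: "?e q = \<zero>" using nz[OF g] integral[OF _ egc eqr(1)] by blast
            have gq: "?lg [^] k \<odot>\<^bsub>PR\<^esub> p = g \<otimes>\<^bsub>PR\<^esub> q" using eq True g q by simp
            have dl: "deg AR (?lg [^] k \<odot>\<^bsub>PR\<^esub> p) = deg AR p"
              using U.deg_smult[of "?lg [^] k" p] lg p by simp
            have qn: "q \<noteq> \<zero>\<^bsub>PR\<^esub>"
            proof
              assume "q = \<zero>\<^bsub>PR\<^esub>"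
              then have "?lg [^] k \<odot>\<^bsub>PR\<^esub> p = \<zero>\<^bsub>PR\<^esub>" using gq g by simp
              then have "deg AR p = 0" using dl by simp
              then show False using dp by simp
            qed
            have "deg AR p = deg AR g + deg AR q"
              using dl gq U.deg_mult[OF g(2) qn g(1) q] by simp
            then have "deg AR q < deg AR p" using False by simp
            then show ?thesis using nz[OF q qn] q0 by simp
          next
            case rn: False
            then have drg: "deg AR r < deg AR g" using dr by simp
            then obtain h c where h: "h \<in> carrier PR" "c \<in> A" "c \<noteq> \<zero>" "?e r \<otimes> ?e h = c"
              using less.hyps[OF drg r rn] g(3) by auto
            have eh': "?e h \<in> carrier R" using h by simp
            \<comment> \<open>At t the remainder r equals - g q, so a cofactor for r multiplied by -
              q is a cofactor for g.\<close>
            let ?h = "\<ominus>\<^bsub>PR\<^esub> q \<otimes>\<^bsub>PR\<^esub> h"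
            have "?e ?h = \<ominus> ?e q \<otimes> ?e h" using q h by simp
            moreover have "?e g \<otimes> (\<ominus> ?e q \<otimes> ?e h) = ?e r \<otimes> ?e h \<ominus> (?e g \<otimes> ?e q \<oplus> ?e r) \<otimes> ?e h"
              using egc eqr eh' by algebra
            ultimately have "?e g \<otimes> ?e ?h = c" using sum0 h(4) h(2) Ac eh' by (auto simp: a_minus_def)
            moreover have "?h \<in> carrier PR" using q h by simp
            ultimately show ?thesis using h by blast
          qed
        qed
      qed
      \<comment> \<open>g is the remainder of f modulo p. Its value at t is s times a power of the
        leading coefficient of p, and \<open>euclid\<close> makes this value a divisor of some
        nonzero c in A.\<close>
      obtain q g k where q: "q \<in> carrier PR" and g: "g \<in> carrier PR"
        and eq: "?l [^] (k::nat) \<odot>\<^bsub>PR\<^esub> f = p \<otimes>\<^bsub>PR\<^esub> q \<oplus>\<^bsub>PR\<^esub> g"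
        and dg: "g = \<zero>\<^bsub>PR\<^esub> \<or> deg AR g < deg AR p"
        using div[OF p(1) f(1) p(2)] by blast
      have lk: "?l [^] k \<in> A" "?l [^] k \<noteq> \<zero>"
        using pow_in_subring[OF A l(1)] pow0[of ?l k] l Ac by auto
      have sc: "s \<in> carrier R" using f by auto
      have "?l [^] k \<otimes> s = ?e (p \<otimes>\<^bsub>PR\<^esub> q \<oplus>\<^bsub>PR\<^esub> g)"
        using smult[OF lk(1) f(1)] f(2) eq by simp
      also have "\<dots> = ?e g" using p q g by simp
      finally have eg: "?e g = ?l [^] k \<otimes> s" by simp
      have "?e g \<noteq> \<zero>" unfolding eg using integral[OF _ _ sc] lk s0 Ac by blast
      then have "g \<noteq> \<zero>\<^bsub>PR\<^esub>" by auto
      then obtain h c where h: "h \<in> carrier PR" "c \<in> A" "c \<noteq> \<zero>" "?e g \<otimes> ?e h = c"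
        using euclid[OF g] dg by blast
      \<comment> \<open>\<phi> has to preserve the leading coefficient of p, so that the image of p
        has a root in F, and c, so that the image of s, which divides c in A[t], is nonzero.\<close>
      have lc: "?l \<otimes> c \<in> A" "?l \<otimes> c \<noteq> \<zero>"
        using l h subringE(6)[OF A] integral[of ?l c] Ac by blast+
      obtain \<phi> where \<phi>: "\<phi> \<in> ring_hom AR R" "\<phi> ` A \<subseteq> F" "\<forall>x\<in>F. \<phi> x = x" "\<phi> (?l \<otimes> c) \<noteq> \<zero>"
        using N lc unfolding specializable_def by blast
      have \<phi>c: "\<phi> a \<in> carrier R" if "a \<in> A" for a using ring_hom_closed[OF \<phi>(1)] that by simp
      have "\<phi> (?l \<otimes> c) = \<phi> ?l \<otimes> \<phi> c" using ring_hom_mult[OF \<phi>(1)] l h by simp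
      then have \<phi>l: "\<phi> ?l \<noteq> \<zero>" and \<phi>n: "\<phi> c \<noteq> \<zero>" using \<phi>(4) \<phi>c l h by auto
      obtain x where x: "x \<in> F" "specialize \<phi> x p = \<zero>"
        using specialize_root[OF \<phi>(1,2) p(1) dp \<phi>l] by blast
      have xc: "x \<in> carrier R" using x subfieldE(3)[OF F] by blast
      interpret h: ring_hom_ring PR R "specialize \<phi> x"
        by (rule ring_hom_ringI2[OF U.P.ring_axioms ring_axioms specialize_hom[OF \<phi>(1) xc]])
      \<comment> \<open>A polynomial vanishing at t has remainder 0 modulo p. Up to a power of the
        leading coefficient it is a multiple of p, so its image vanishes at every root of the image
        of p.\<close>
      have ker: "specialize \<phi> x f' = \<zero>" if f': "f' \<in> carrier PR" "?e f' = \<zero>" for f'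
      proof -
        obtain q g k where q: "q \<in> carrier PR" and g: "g \<in> carrier PR"
          and eq: "?l [^] (k::nat) \<odot>\<^bsub>PR\<^esub> f' = p \<otimes>\<^bsub>PR\<^esub> q \<oplus>\<^bsub>PR\<^esub> g"
          and dg: "g = \<zero>\<^bsub>PR\<^esub> \<or> deg AR g < deg AR p"
          using div[OF p(1) f'(1) p(2)] by blast
        have lk: "?l [^] k \<in> A" using pow_in_subring[OF A l(1)] .
        have "\<zero> = ?e (p \<otimes>\<^bsub>PR\<^esub> q \<oplus>\<^bsub>PR\<^esub> g)"
          using smult[OF lk f'(1)] f'(2) lk Ac unfolding eq[symmetric] by auto
        also have "\<dots> = ?e g" using p q g by simp
        finally have "g = \<zero>\<^bsub>PR\<^esub>" using nz[OF g] dg by auto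
        then have "?l [^] k \<odot>\<^bsub>PR\<^esub> f' = p \<otimes>\<^bsub>PR\<^esub> q" using eq p q by simp
        then have "specialize \<phi> x (?l [^] k \<odot>\<^bsub>PR\<^esub> f') = \<zero>" using p q x by simp
        then have "\<phi> (?l [^] k) \<otimes> specialize \<phi> x f' = \<zero>"
          using specialize_smult[OF \<phi>(1) xc lk f'(1)] by simp
        moreover have "\<phi> (?l [^] k) = \<phi> ?l [^] k"
        proof (induction k)
          case 0
          then show ?case using ring_hom_one[OF \<phi>(1)] by simp
        next
          case (Suc k)
          then show ?case
            using ring_hom_mult[OF \<phi>(1), of "?l [^] k" ?l] l pow_in_subring[OF A l(1)] by simp
        qed
        moreover have "\<phi> ?l [^] k \<noteq> \<zero>" using pow0 \<phi>l \<phi>c l by blast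
        ultimately show ?thesis using integral[of "\<phi> ?l [^] k" "specialize \<phi> x f'"] f' \<phi>c[OF l(1)] by auto
      qed
      obtain \<psi> where \<psi>: "\<psi>\<in>ring_hom (R\<lparr>carrier := B\<rparr>) R" "\<psi> ` B \<subseteq> F" "\<forall>x\<in>F. \<psi> x = x"
        "\<forall>f\<in>carrier PR. \<psi> (?e f) = specialize \<phi> x f"
        using extend[OF \<phi>(1-3) x(1) ker] by blast
      have "\<psi> c = \<phi> c"
        using \<psi>(4) mA[OF h(2)] eA[OF h(2)] specialize_const[OF \<phi>(1) xc h(2)] by metis
      moreover have hB: "?e h \<in> B" "?l [^] k \<in> B" "?l [^] k \<otimes> s \<in> B"
        using h lk AB sB subringE(6)[OF B] by (auto simp: B_def)
      have "\<psi> c = \<psi> (?l [^] k) \<otimes> \<psi> s \<otimes> \<psi> (?e h)"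
        using ring_hom_mult[OF \<psi>(1), of "?l [^] k \<otimes> s" "?e h"] ring_hom_mult[OF \<psi>(1), of "?l [^] k" s]
          hB sB h(4) eg by simp
      moreover have "\<psi> (?l [^] k) \<in> carrier R" "\<psi> (?e h) \<in> carrier R"
        using ring_hom_closed[OF \<psi>(1)] hB by auto
      ultimately have "\<psi> s \<noteq> \<zero>" using \<phi>n by auto
      then show ?thesis using \<psi> by blast
    qed
  qed
  then have "specializable F B"
    unfolding specializable_def using B FA AB by blast
  then show ?thesis using AB tB by blast
qed

end

end

context field
begin

lemma specializable_self:
  assumes F: "subfield F R" shows "specializable F F"
proof -
  have "id \<in> ring_hom (R\<lparr>carrier := F\<rparr>) R"
    by (rule ring_hom_memI) (use subfieldE(3)[OF F] in auto)
  then show ?thesis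
    unfolding specializable_def using subfieldE(1)[OF F] by (intro conjI ballI impI bexI[of _ id]) auto
qed

lemma specializable_finite:
  assumes F: "subfield F R" "roots_closed F" and S: "finite S" "S \<subseteq> carrier R"
  shows "\<exists>A. specializable F A \<and> S \<subseteq> A"
  using S
proof (induction S)
  case empty
  then show ?case using specializable_self[OF F(1)] by blast
next
  case (insert t S)
  then obtain A where A: "specializable F A" "S \<subseteq> A" by auto
  then have "subring A R" "F \<subseteq> A" by (auto simp: specializable_def)
  moreover have "t \<in> carrier R" using insert.prems by simp
  ultimately obtain B where "specializable F B" "A \<subseteq> B" "t \<in> B"
    using specializable_adjoin[OF F _ _ _ A(1)] by metis
  then show ?case using A by blast
qed

text \<open>One element stands for all of S: the product r of its nonzero elements. A homomorphism
  that keeps r nonzero keeps each of them nonzero.\<close>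

theorem finite_specialization:
  assumes F: "subfield F R" "roots_closed F" and S: "finite S" "S \<subseteq> carrier R"
  obtains A \<phi> where "subring A R" "F \<subseteq> A" "S \<subseteq> A" "\<phi> \<in> ring_hom (R\<lparr>carrier := A\<rparr>) R"
    "\<phi> ` A \<subseteq> F" "\<forall>x\<in>F. \<phi> x = x" "\<forall>s\<in>S. s \<noteq> \<zero> \<longrightarrow> \<phi> s \<noteq> \<zero>"
proof -
  obtain A where N: "specializable F A" and SA: "S \<subseteq> A" using specializable_finite[OF F S] by blast
  then have A: "subring A R" "F \<subseteq> A" by (auto simp: specializable_def)
  have Ac: "A \<subseteq> carrier R" by (rule subringE(1)[OF A(1)])
  have "\<exists>r\<in>A. r \<noteq> \<zero> \<and> (\<forall>\<phi>\<in>ring_hom (R\<lparr>carrier := A\<rparr>) R. \<phi> r \<noteq> \<zero> \<longrightarrow> (\<forall>s\<in>S. s \<noteq> \<zero> \<longrightarrow> \<phi> s \<noteq> \<zero>))"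
    using S(1) SA
  proof (induction S)
    case empty
    show ?case using subringE(3)[OF A(1)] by (intro bexI[of _ \<one>]) auto
  next
    case (insert s S)
    then obtain r where r: "r \<in> A" "r \<noteq> \<zero>"
      "\<forall>\<phi>\<in>ring_hom (R\<lparr>carrier := A\<rparr>) R. \<phi> r \<noteq> \<zero> \<longrightarrow> (\<forall>s\<in>S. s \<noteq> \<zero> \<longrightarrow> \<phi> s \<noteq> \<zero>)" by auto
    show ?case
    proof (cases "s = \<zero>")
      case True
      then show ?thesis using r by (intro bexI[of _ r]) auto
    next
      case False
      have sA: "s \<in> A" using insert by simp
      have "\<forall>x\<in>insert s S. x \<noteq> \<zero> \<longrightarrow> \<phi> x \<noteq> \<zero>"
        if \<phi>: "\<phi> \<in> ring_hom (R\<lparr>carrier := A\<rparr>) R" and rs: "\<phi> (r \<otimes> s) \<noteq> \<zero>" for \<phi>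
      proof -
        have "\<phi> (r \<otimes> s) = \<phi> r \<otimes> \<phi> s" using ring_hom_mult[OF \<phi>] r sA by simp
        moreover have "\<phi> r \<in> carrier R" "\<phi> s \<in> carrier R" using ring_hom_closed[OF \<phi>] r sA by auto
        ultimately have "\<phi> r \<noteq> \<zero>" "\<phi> s \<noteq> \<zero>" using rs by auto
        then show ?thesis using r \<phi> by auto
      qed
      moreover have "r \<otimes> s \<in> A" using r sA subringE(6)[OF A(1)] by blast
      moreover have "r \<otimes> s \<noteq> \<zero>" using r sA False Ac integral by blast
      ultimately show ?thesis by blast
    qed
  qed
  then obtain r where r: "r \<in> A" "r \<noteq> \<zero>"
    "\<forall>\<phi>\<in>ring_hom (R\<lparr>carrier := A\<rparr>) R. \<phi> r \<noteq> \<zero> \<longrightarrow> (\<forall>s\<in>S. s \<noteq> \<zero> \<longrightarrow> \<phi> s \<noteq> \<zero>)" by blast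
  obtain \<phi> where "\<phi>\<in>ring_hom (R\<lparr>carrier := A\<rparr>) R" "\<phi> ` A \<subseteq> F" "\<forall>x\<in>F. \<phi> x = x" "\<phi> r \<noteq> \<zero>"
    using N r unfolding specializable_def by blast
  then show thesis using that A SA r by blast
qed

end

section \<open>The disjoint amalgam in a quotient of a power\<close>

definition fun_ring :: "('a, 'm) ring_scheme \<Rightarrow> ('i \<Rightarrow> 'a) ring" where
  "fun_ring R = \<lparr>carrier = {h. range h \<subseteq> carrier R}, monoid.mult = (\<lambda>g h i. g i \<otimes>\<^bsub>R\<^esub> h i), monoid.one = (\<lambda>_. \<one>\<^bsub>R\<^esub>),
     ring.zero = (\<lambda>_. \<zero>\<^bsub>R\<^esub>), ring.add = (\<lambda>g h i. g i \<oplus>\<^bsub>R\<^esub> h i)\<rparr>"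

lemma (in cring) cring_fun_ring: "cring (fun_ring R :: ('i \<Rightarrow> 'a) ring)"
proof (rule cringI)
  show "abelian_group (fun_ring R :: ('i \<Rightarrow> 'a) ring)"
  proof (rule abelian_groupI)
    fix x :: "'i \<Rightarrow> 'a" assume x: "x \<in> carrier (fun_ring R)"
    show "\<exists>y\<in>carrier (fun_ring R). y \<oplus>\<^bsub>fun_ring R\<^esub> x = \<zero>\<^bsub>fun_ring R\<^esub>"
      by (rule bexI[of _ "\<lambda>i. \<ominus> x i"]) (use x in \<open>auto simp: fun_ring_def image_subset_iff l_neg\<close>)
  qed (auto simp: fun_ring_def image_subset_iff a_ac)
  show "Group.comm_monoid (fun_ring R :: ('i \<Rightarrow> 'a) ring)"
    by (rule comm_monoidI) (auto simp: fun_ring_def image_subset_iff m_ac)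
qed (auto simp: fun_ring_def image_subset_iff l_distr)

lemma (in cring) fun_ring_minus:
  assumes "x \<in> carrier (fun_ring R)" shows "\<ominus>\<^bsub>fun_ring R\<^esub> x = (\<lambda>i. \<ominus> x i)"
proof -
  interpret P: cring "fun_ring R" by (rule cring_fun_ring)
  show ?thesis
    by (rule P.minus_equality) (use assms in \<open>auto simp: fun_ring_def image_subset_iff l_neg\<close>)
qed

lemma field_hom_nonzero:
  assumes "field R" "field S" "h \<in> ring_hom R S" "a \<in> carrier R" "a \<noteq> \<zero>\<^bsub>R\<^esub>"
  shows "h a \<noteq> \<zero>\<^bsub>S\<^esub>"
proof
  interpret R: field R by fact
  interpret S: field S by fact
  assume "h a = \<zero>\<^bsub>S\<^esub>"
  moreover have u: "a \<in> Units R" using assms R.field_Units by simp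
  then have "h a \<otimes>\<^bsub>S\<^esub> h (inv\<^bsub>R\<^esub> a) = \<one>\<^bsub>S\<^esub>"
    using ring_hom_mult[OF assms(3), of a "inv\<^bsub>R\<^esub> a"] ring_hom_one[OF assms(3)] assms(4) by simp
  ultimately show False using ring_hom_closed[OF assms(3), of "inv\<^bsub>R\<^esub> a"] u by simp
qed

lemma field_hom_inj:
  assumes "field R" "field S" "h \<in> ring_hom R S"
  shows "inj_on h (carrier R)"
proof (rule inj_onI)
  interpret R: field R by fact
  interpret S: field S by fact
  interpret h: ring_hom_ring R S h by (rule ring_hom_ringI2[OF R.ring_axioms S.ring_axioms assms(3)])
  fix x y assume xy: "x \<in> carrier R" "y \<in> carrier R" "h x = h y"
  then have "h (x \<ominus>\<^bsub>R\<^esub> y) = \<zero>\<^bsub>S\<^esub>" by (simp add: a_minus_def S.r_neg)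
  then show "x = y" using field_hom_nonzero[OF assms, of "x \<ominus>\<^bsub>R\<^esub> y"] xy R.r_right_minus_eq by auto
qed

text \<open>
  The second embedding sends an element of the field to the family of its specializations,
  indexed by the finite sets of elements that are to be kept nonzero. The difference of an
  element and a specialization is then nonzero for almost all indices, hence a unit.
\<close>

theorem (in field) exists_disjoint_amalgam:
  assumes F: "subfield F R" "roots_closed F"
  obtains L :: "('a set \<Rightarrow> 'a) set ring" and f g
  where "field L" "f \<in> ring_hom R L" "g \<in> ring_hom R L" "\<And>x. x \<in> F \<Longrightarrow> f x = g x"
    "\<And>a b. a \<in> carrier R \<Longrightarrow> b \<in> carrier R \<Longrightarrow> f a = g b \<Longrightarrow> a = b \<and> a \<in> F"
proof -
  define P where "P S A \<phi> \<longleftrightarrow> subring A R \<and> F \<subseteq> A \<and> S \<subseteq> A \<and> \<phi> \<in> ring_hom (R\<lparr>carrier := A\<rparr>) R \<and>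
    \<phi> ` A \<subseteq> F \<and> (\<forall>x\<in>F. \<phi> x = x) \<and> (\<forall>s\<in>S. s \<noteq> \<zero> \<longrightarrow> \<phi> s \<noteq> \<zero>)" for S A and \<phi> :: "'a \<Rightarrow> 'a"
  define fin where "fin S \<longleftrightarrow> finite S \<and> S \<subseteq> carrier R" for S :: "'a set"
  have "\<exists>A \<phi>. fin S \<longrightarrow> P S A \<phi>" for S
    using finite_specialization[OF F, of S] unfolding P_def fin_def by metis
  then obtain A \<phi> where A\<phi>: "\<And>S. fin S \<Longrightarrow> P S (A S) (\<phi> S)" by metis
  have Fc: "F \<subseteq> carrier R" by (rule subfieldE(3)[OF F(1)])
  have A: "subring (A S) R" "F \<subseteq> A S" "S \<subseteq> A S" "A S \<subseteq> carrier R" if "fin S" for S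
    using A\<phi>[OF that] subringE(1) by (auto simp: P_def)
  have hom: "\<phi> S \<in> ring_hom (R\<lparr>carrier := A S\<rparr>) R" if "fin S" for S
    using A\<phi>[OF that] by (simp add: P_def)
  have \<phi>F: "\<phi> S a \<in> F" if "fin S" "a \<in> A S" for S a
    using A\<phi>[OF that(1)] that(2) by (auto simp: P_def)
  have \<phi>id: "\<phi> S a = a" if "fin S" "a \<in> F" for S a
    using A\<phi>[OF that(1)] that(2) by (auto simp: P_def)
  have \<phi>nz: "\<phi> S a \<noteq> \<zero>" if "fin S" "a \<in> S" "a \<noteq> \<zero>" for S a
    using A\<phi>[OF that(1)] that(2-) by (auto simp: P_def)
  define ev where "ev Q \<longleftrightarrow> (\<exists>S0. fin S0 \<and> (\<forall>S. fin S \<and> S0 \<subseteq> S \<longrightarrow> Q S))" for Q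
  have ev_conj: "ev (\<lambda>S. Q S \<and> Q' S)" if Q: "ev Q" "ev Q'" for Q Q'
  proof -
    obtain S0 where "fin S0" "\<forall>S. fin S \<and> S0 \<subseteq> S \<longrightarrow> Q S"
      using Q(1) unfolding ev_def by blast
    moreover obtain S1 where "fin S1" "\<forall>S. fin S \<and> S1 \<subseteq> S \<longrightarrow> Q' S"
      using Q(2) unfolding ev_def by blast
    ultimately show ?thesis unfolding ev_def by (intro exI[of _ "S0 \<union> S1"]) (auto simp: fin_def)
  qed
  have ev_mono: "ev Q'" if "ev Q" "\<And>S. Q S \<Longrightarrow> Q' S" for Q Q'
    using that unfolding ev_def by blast
  have ev_I: "ev Q" if "fin S0" "\<And>S. fin S \<Longrightarrow> S0 \<subseteq> S \<Longrightarrow> Q S" for Q S0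
    using that unfolding ev_def by blast
  let ?X = "fun_ring R :: ('a set \<Rightarrow> 'a) ring"
  interpret X: cring ?X by (rule cring_fun_ring)
  have Xc: "h \<in> carrier ?X \<longleftrightarrow> (\<forall>i. h i \<in> carrier R)" for h by (auto simp: fun_ring_def)
  have Xops: "(g \<otimes>\<^bsub>?X\<^esub> h) i = g i \<otimes> h i" "(g \<oplus>\<^bsub>?X\<^esub> h) i = g i \<oplus> h i"
    "\<one>\<^bsub>?X\<^esub> i = \<one>" "\<zero>\<^bsub>?X\<^esub> i = \<zero>" for g h i
    by (auto simp: fun_ring_def)
  have Xminus: "(g \<ominus>\<^bsub>?X\<^esub> h) i = g i \<ominus> h i" if "h \<in> carrier ?X" for g h i
    using fun_ring_minus[OF that] by (simp add: a_minus_def Xops)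
  define J where "J = {h \<in> carrier ?X. ev (\<lambda>S. h S = \<zero>)}"
  have ideal: "ideal J ?X"
  proof (rule idealI[OF X.ring_axioms])
    show "subgroup J (add_monoid ?X)"
    proof (rule X.add.subgroupI)
      show "J \<subseteq> carrier ?X" by (auto simp: J_def)
      have "\<zero>\<^bsub>?X\<^esub> \<in> J" unfolding J_def using ev_I[of "{}"] by (auto simp: Xops fin_def)
      then show "J \<noteq> {}" by blast
      show "\<ominus>\<^bsub>?X\<^esub> a \<in> J" if "a \<in> J" for a
      proof -
        have a: "a \<in> carrier ?X" "ev (\<lambda>S. a S = \<zero>)" using that by (auto simp: J_def)
        have "ev (\<lambda>S. \<ominus> a S = \<zero>)" by (rule ev_mono[OF a(2)]) simp
        then show ?thesis
          using X.a_inv_closed[OF a(1)] unfolding J_def by (simp add: fun_ring_minus[OF a(1)])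
      qed
      show "a \<oplus>\<^bsub>?X\<^esub> b \<in> J" if "a \<in> J" "b \<in> J" for a b
        using that ev_conj[of "\<lambda>S. a S = \<zero>" "\<lambda>S. b S = \<zero>"] unfolding J_def
        by (auto simp: Xops elim!: ev_mono)
    qed
    fix a x assume a: "a \<in> J" and x: "x \<in> carrier ?X"
    then have "ev (\<lambda>S. (x \<otimes>\<^bsub>?X\<^esub> a) S = \<zero>)"
      unfolding J_def Xops by (auto simp: Xc elim!: ev_mono)
    then show "x \<otimes>\<^bsub>?X\<^esub> a \<in> J" using a x by (auto simp: J_def)
    then show "a \<otimes>\<^bsub>?X\<^esub> x \<in> J" using X.m_comm[of a x] a x by (auto simp: J_def)
  qed
  have one: "\<one>\<^bsub>?X\<^esub> \<notin> J" unfolding J_def ev_def by (auto simp: Xops)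
  obtain L :: "('a set \<Rightarrow> 'a) set ring" and \<pi> where L: "field L" "\<pi> \<in> ring_hom ?X L" "\<And>x. x \<in> J \<Longrightarrow> \<pi> x = \<zero>\<^bsub>L\<^esub>"
    by (rule X.exists_hom_to_field[OF ideal one]) blast
  interpret L: field L by (rule L(1))
  interpret \<pi>: ring_hom_ring ?X L \<pi> by (rule ring_hom_ringI2[OF X.ring_axioms L.ring_axioms L(2)])
  have \<pi>eq: "\<pi> x = \<pi> y" if xy: "x \<in> carrier ?X" "y \<in> carrier ?X" and e: "ev (\<lambda>S. x S = y S)" for x y
  proof -
    have "ev (\<lambda>S. (x \<ominus>\<^bsub>?X\<^esub> y) S = \<zero>)"
      by (rule ev_mono[OF e]) (use xy in \<open>simp add: Xminus Xc r_right_minus_eq\<close>)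
    then have "x \<ominus>\<^bsub>?X\<^esub> y \<in> J" using xy by (simp add: J_def)
    then have "\<pi> x \<ominus>\<^bsub>L\<^esub> \<pi> y = \<zero>\<^bsub>L\<^esub>" using L(3) xy by (fastforce simp: a_minus_def)
    then show ?thesis using xy by (simp add: L.r_right_minus_eq)
  qed
  \<comment> \<open>Eventually distinct families stay distinct in L, although \<pi> may kill more
    than J: their difference has the inverse u modulo J, hence a nonzero image.\<close>
  have \<pi>neq: "ev (\<lambda>S. x S \<noteq> y S) \<Longrightarrow> \<pi> x \<noteq> \<pi> y" if xy: "x \<in> carrier ?X" "y \<in> carrier ?X" for x y
  proof
    assume e: "ev (\<lambda>S. x S \<noteq> y S)" and eq: "\<pi> x = \<pi> y"
    define u where "u S = (if x S = y S then \<zero> else inv (x S \<ominus> y S))" for S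
    have nz: "x S \<ominus> y S \<in> Units R" if "x S \<noteq> y S" for S
      using that xy field_Units by (auto simp: Xc r_right_minus_eq)
    have u: "u \<in> carrier ?X" using nz by (auto simp: Xc u_def)
    have "ev (\<lambda>S. (u \<otimes>\<^bsub>?X\<^esub> (x \<ominus>\<^bsub>?X\<^esub> y)) S = \<one>\<^bsub>?X\<^esub> S)"
      by (rule ev_mono[OF e]) (use xy nz in \<open>auto simp: Xops Xminus u_def\<close>)
    then have "\<pi> (u \<otimes>\<^bsub>?X\<^esub> (x \<ominus>\<^bsub>?X\<^esub> y)) = \<pi> \<one>\<^bsub>?X\<^esub>" using u xy by (intro \<pi>eq) auto
    moreover have "\<pi> (x \<ominus>\<^bsub>?X\<^esub> y) = \<zero>\<^bsub>L\<^esub>" using xy eq by (simp add: a_minus_def L.r_neg)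
    ultimately show False using u xy by simp
  qed
  define cst where "cst a = (\<lambda>S::'a set. a)" for a :: 'a
  \<comment> \<open>The ring \<open>A S\<close> need not contain a if S does not. The value 0 there
    is harmless, since a belongs to S, and so to \<open>A S\<close>, eventually.\<close>
  define sp where "sp a S = (if fin S \<and> a \<in> A S then \<phi> S a else \<zero>)" for a S
  have cstX: "cst a \<in> carrier ?X" if "a \<in> carrier R" for a using that by (simp add: Xc cst_def)
  have spX: "sp a \<in> carrier ?X" for a using \<phi>F Fc by (auto simp: Xc sp_def)
  have spS: "sp a S = \<phi> S a" if "fin S" "a \<in> A S" for a S using that by (simp add: sp_def)
  have f: "(\<lambda>a. \<pi> (cst a)) \<in> ring_hom R L"
  proof (rule ring_hom_memI)
    fix a b assume ab: "a \<in> carrier R" "b \<in> carrier R"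
    have "cst (a \<otimes> b) = cst a \<otimes>\<^bsub>?X\<^esub> cst b" "cst (a \<oplus> b) = cst a \<oplus>\<^bsub>?X\<^esub> cst b"
      by (auto simp: cst_def fun_ring_def)
    then show "\<pi> (cst (a \<otimes> b)) = \<pi> (cst a) \<otimes>\<^bsub>L\<^esub> \<pi> (cst b)" "\<pi> (cst (a \<oplus> b)) = \<pi> (cst a) \<oplus>\<^bsub>L\<^esub> \<pi> (cst b)"
      using ab cstX by auto
  next
    have "cst \<one> = \<one>\<^bsub>?X\<^esub>" by (simp add: cst_def fun_ring_def)
    then show "\<pi> (cst \<one>) = \<one>\<^bsub>L\<^esub>" by simp
  qed (use cstX in simp)
  have g: "(\<lambda>a. \<pi> (sp a)) \<in> ring_hom R L"
  proof (rule ring_hom_memI)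
    fix a b assume ab: "a \<in> carrier R" "b \<in> carrier R"
    have S0: "fin {a, b}" using ab by (simp add: fin_def)
    have in_A: "a \<in> A S" "b \<in> A S" if "fin S" "{a, b} \<subseteq> S" for S using A(3)[OF that(1)] that(2) by auto
    have "ev (\<lambda>S. sp (a \<otimes> b) S = (sp a \<otimes>\<^bsub>?X\<^esub> sp b) S)"
    proof (rule ev_I[OF S0])
      fix S assume S: "fin S" "{a, b} \<subseteq> S"
      have "a \<otimes> b \<in> A S" using in_A[OF S] subringE(6)[OF A(1)[OF S(1)]] by blast
      then show "sp (a \<otimes> b) S = (sp a \<otimes>\<^bsub>?X\<^esub> sp b) S"
        using in_A[OF S] S ring_hom_mult[OF hom[OF S(1)], of a b] by (simp add: Xops spS)
    qed
    then have "\<pi> (sp (a \<otimes> b)) = \<pi> (sp a \<otimes>\<^bsub>?X\<^esub> sp b)" using spX by (intro \<pi>eq) auto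
    then show "\<pi> (sp (a \<otimes> b)) = \<pi> (sp a) \<otimes>\<^bsub>L\<^esub> \<pi> (sp b)" using spX by simp
    have "ev (\<lambda>S. sp (a \<oplus> b) S = (sp a \<oplus>\<^bsub>?X\<^esub> sp b) S)"
    proof (rule ev_I[OF S0])
      fix S assume S: "fin S" "{a, b} \<subseteq> S"
      have "a \<oplus> b \<in> A S" using in_A[OF S] subringE(7)[OF A(1)[OF S(1)]] by blast
      then show "sp (a \<oplus> b) S = (sp a \<oplus>\<^bsub>?X\<^esub> sp b) S"
        using in_A[OF S] S ring_hom_add[OF hom[OF S(1)], of a b] by (simp add: Xops spS)
    qed
    then have "\<pi> (sp (a \<oplus> b)) = \<pi> (sp a \<oplus>\<^bsub>?X\<^esub> sp b)" using spX by (intro \<pi>eq) auto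
    then show "\<pi> (sp (a \<oplus> b)) = \<pi> (sp a) \<oplus>\<^bsub>L\<^esub> \<pi> (sp b)" using spX by simp
  next
    have "ev (\<lambda>S. sp \<one> S = \<one>\<^bsub>?X\<^esub> S)"
      by (rule ev_I[of "{}"])
        (use subringE(3)[OF A(1)] ring_hom_one[OF hom] in \<open>auto simp: fin_def Xops sp_def\<close>)
    then have "\<pi> (sp \<one>) = \<pi> \<one>\<^bsub>?X\<^esub>" using spX by (intro \<pi>eq) auto
    then show "\<pi> (sp \<one>) = \<one>\<^bsub>L\<^esub>" by simp
  qed (use spX in simp)
  have fg: "\<pi> (cst x) = \<pi> (sp x)" if "x \<in> F" for x
    by (rule \<pi>eq[OF cstX spX ev_I[of "{}"]])
      (use that Fc A(2) \<phi>id in \<open>auto simp: fin_def cst_def sp_def\<close>)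
  have disj: "a = b \<and> a \<in> F" if ab: "a \<in> carrier R" "b \<in> carrier R" and eq: "\<pi> (cst a) = \<pi> (sp b)" for a b
  proof (rule ccontr)
    assume n: "\<not> (a = b \<and> a \<in> F)"
    \<comment> \<open>With b in S, the family of b has the value \<open>\<phi> S b\<close> at S. If
      this were a, then a would be in F and fixed by \<open>\<phi> S\<close>, which would then send
      b - a to 0; as b - a is in S, this forces b = a.\<close>
    have S0: "fin {b, b \<ominus> a}" using ab by (simp add: fin_def)
    have "ev (\<lambda>S. cst a S \<noteq> sp b S)"
    proof (rule ev_I[OF S0])
      fix S assume S: "fin S" "{b, b \<ominus> a} \<subseteq> S"
      have b: "b \<in> A S" using A(3)[OF S(1)] S(2) by auto
      have "a \<noteq> \<phi> S b"
      proof
        assume a: "a = \<phi> S b"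
        then have aF: "a \<in> F" using \<phi>F[OF S(1) b] by simp
        then have ba: "b \<ominus> a \<noteq> \<zero>" using n ab r_right_minus_eq by auto
        have aA: "\<ominus> a \<in> A S" using aF A(2)[OF S(1)] subringE(5)[OF A(1)[OF S(1)]] by blast
        have aF': "\<ominus> a \<in> F" using aF subringE(5)[OF subfieldE(1)[OF F(1)]] by blast
        have "\<phi> S (b \<ominus> a) = \<phi> S b \<oplus> \<phi> S (\<ominus> a)"
          using ring_hom_add[OF hom[OF S(1)], of b "\<ominus> a"] b aA by (simp add: a_minus_def)
        also have "\<dots> = a \<ominus> a" using \<phi>id[OF S(1) aF'] a by (simp add: a_minus_def)
        also have "\<dots> = \<zero>" using ab by (simp add: a_minus_def r_neg)
        finally show False using \<phi>nz[OF S(1) _ ba] S(2) by auto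
      qed
      then show "cst a S \<noteq> sp b S" using spS[OF S(1) b] by (simp add: cst_def)
    qed
    then show False using \<pi>neq[OF cstX[OF ab(1)] spX] eq by blast
  qed
  show thesis using that[OF L(1) f g fg disj] .
qed

section \<open>Adjoining a root, and the size of a generated field\<close>

lemma (in field) exists_root_extension:
  assumes p: "set p \<subseteq> carrier R" "2 \<le> length p" "hd p \<noteq> \<zero>"
  obtains L :: "((('a list \<times> nat) multiset) \<Rightarrow> 'a) ring" and h x
  where "field L" "h \<in> ring_hom R L" "x \<in> carrier L" "ring.eval L (map h p) x = \<zero>\<^bsub>L\<^esub>"
proof -
  obtain L :: "((('a list \<times> nat) multiset) \<Rightarrow> 'a) ring"
    where L: "algebraic_closure L (indexed_const ` (carrier R))" and h: "indexed_const \<in> ring_hom R L"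
    using exists_closure by blast
  interpret L: algebraic_closure L "indexed_const ` (carrier R)" by (rule L)
  let ?p = "map indexed_const p"
  have pn: "p \<noteq> []" using p by auto
  have hd: "hd ?p \<noteq> \<zero>\<^bsub>L\<^esub>"
    using field_hom_nonzero[OF field_axioms L.field_axioms h, of "hd p"] p pn
    by (auto simp: hd_map dest: hd_in_set)
  have pc: "set ?p \<subseteq> carrier L" using p ring_hom_closed[OF h] by auto
  then have P: "?p \<in> carrier (poly_ring L)" using hd pn by (auto simp: univ_poly_def polynomial_def)
  have "size (L.roots ?p) = length p - 1"
    using L.roots_over_carrier[OF P] by (simp add: L.splitted_def)
  then have "size (L.roots ?p) \<noteq> 0" using p by linarith
  then obtain x where "x \<in># L.roots ?p" by (metis multiset_nonemptyE size_empty)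
  then have "L.is_root ?p x" using L.roots_mem_iff_is_root[OF P] by simp
  then show thesis using that[OF L.field_axioms h] by (auto simp: L.is_root_def)
qed

text \<open>The generated field is covered by countably many stages, each adding one application of
  the field operations to the previous one. This bound lets the amalgam live on the type of
  K.\<close>

lemma card_generate_field:
  fixes R :: "('b, 'm) ring_scheme" and C :: "'c set"
  assumes inf: "infinite C" and H: "|H| \<le>o |C|"
  shows "|generate_field R H| \<le>o |C|"
proof -
  define step where "step S = S \<union> (\<lambda>x. \<ominus>\<^bsub>R\<^esub> x) ` S \<union> (\<lambda>x. inv\<^bsub>R\<^esub> x) ` S \<union>
    (\<lambda>(x, y). x \<oplus>\<^bsub>R\<^esub> y) ` (S \<times> S) \<union> (\<lambda>(x, y). x \<otimes>\<^bsub>R\<^esub> y) ` (S \<times> S)" for S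
  define G where "G n = (step ^^ n) (insert \<one>\<^bsub>R\<^esub> H)" for n :: nat
  have infF: "infinite (Field |C| )" using inf by simp
  have co: "Card_order |C|" by (rule card_of_Card_order)
  have Un: "|A \<union> B| \<le>o |C|" if "|A| \<le>o |C|" "|B| \<le>o |C|" for A B :: "'b set"
    by (rule card_of_Un_ordLeq_infinite_Field[OF infF that co])
  have im: "|f ` A| \<le>o |C|" if "|A| \<le>o |C|" for f :: "'d \<Rightarrow> 'b" and A
    using ordLeq_transitive[OF card_of_image that] .
  have Ti: "|A \<times> B| \<le>o |C|" if "|A| \<le>o |C|" "|B| \<le>o |C|" for A B :: "'b set"
    by (rule card_of_Times_ordLeq_infinite_Field[OF infF that co])
  have G: "|G n| \<le>o |C|" for n
  proof (induction n)
    case 0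
    have "|{\<one>\<^bsub>R\<^esub>}| \<le>o |C|" using inf by (meson finite.emptyI finite.insertI finite_ordLess_infinite2 ordLess_imp_ordLeq)
    then show ?case using Un[of "{\<one>\<^bsub>R\<^esub>}" H] H by (simp add: G_def)
  next
    case (Suc n)
    have "G (Suc n) = step (G n)" by (simp add: G_def)
    then show ?case unfolding step_def using Suc by (auto intro!: Un im Ti)
  qed
  have mono: "G n \<subseteq> G (n + k)" for n k
    by (induction k) (auto simp: G_def step_def)
  have "generate_field R H \<subseteq> (\<Union>n. G n)"
  proof
    have S: "G (Suc n) = step (G n)" for n by (simp add: G_def)
    have two: "\<exists>n. x \<in> G n \<and> y \<in> G n" if "x \<in> G m" "y \<in> G k" for x y m k
      using mono[of m k] mono[of k m] that by (auto simp: add.commute)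
    fix x assume "x \<in> generate_field R H"
    then show "x \<in> (\<Union>n. G n)"
    proof induction
      case one
      have "\<one>\<^bsub>R\<^esub> \<in> G 0" by (simp add: G_def)
      then show ?case by blast
    next
      case (incl h)
      then have "h \<in> G 0" by (simp add: G_def)
      then show ?case by blast
    next
      case (a_inv h)
      then obtain n where "h \<in> G n" by blast
      then have "\<ominus>\<^bsub>R\<^esub> h \<in> G (Suc n)" unfolding S step_def by blast
      then show ?case by blast
    next
      case (m_inv h)
      then obtain n where "h \<in> G n" by blast
      then have "inv\<^bsub>R\<^esub> h \<in> G (Suc n)" unfolding S step_def by blast
      then show ?case by blast
    next
      case (eng_add h1 h2)
      then obtain n where "h1 \<in> G n \<and> h2 \<in> G n" using two by blast
      then have "h1 \<oplus>\<^bsub>R\<^esub> h2 \<in> G (Suc n)" unfolding S step_def by blast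
      then show ?case by blast
    next
      case (eng_mult h1 h2)
      then obtain n where "h1 \<in> G n \<and> h2 \<in> G n" using two by blast
      then have "h1 \<otimes>\<^bsub>R\<^esub> h2 \<in> G (Suc n)" unfolding S step_def by blast
      then show ?case by blast
    qed
  qed
  moreover have "|\<Union>n. G n| \<le>o |C|"
    using card_of_UNION_ordLeq_infinite[OF inf, of UNIV G] G inf infinite_iff_card_of_nat by blast
  ultimately show ?thesis using ordLeq_transitive[OF card_of_mono1] by blast
qed

section \<open>Renaming of variables\<close>

primrec term_rename :: "(nat \<Rightarrow> nat) \<Rightarrow> LG_term \<Rightarrow> LG_term" where
  "term_rename r (Var n) = Var (r n)"
| "term_rename r Zero = Zero"
| "term_rename r One = One"
| "term_rename r (Opp t) = Opp (term_rename r t)"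
| "term_rename r (Add t u) = Add (term_rename r t) (term_rename r u)"
| "term_rename r (Mul t u) = Mul (term_rename r t) (term_rename r u)"

text \<open>Bound variables are renamed together with the free ones, so an injective r causes no
  capture.\<close>

primrec form_rename :: "(nat \<Rightarrow> nat) \<Rightarrow> LG_form \<Rightarrow> LG_form" where
  "form_rename r (Eq t u) = Eq (term_rename r t) (term_rename r u)"
| "form_rename r (InG t) = InG (term_rename r t)"
| "form_rename r (Not \<phi>) = Not (form_rename r \<phi>)"
| "form_rename r (And \<phi> \<psi>) = And (form_rename r \<phi>) (form_rename r \<psi>)"
| "form_rename r (Ex n \<phi>) = Ex (r n) (form_rename r \<phi>)"

lemma finite_term_vars [simp]: "finite (term_vars t)"
  by (induction t) auto

lemma term_vars_rename [simp]: "term_vars (term_rename r t) = r ` term_vars t"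
  by (induction t) auto

lemma free_vars_rename: "inj r \<Longrightarrow> free_vars (form_rename r \<phi>) = r ` free_vars \<phi>"
  by (induction \<phi>) (auto simp: image_Un image_set_diff)

lemma tval_rename [simp]: "tval M s (term_rename r t) = tval M (\<lambda>i. s (r i)) t"
  by (induction t) auto

lemma sat_rename: "inj r \<Longrightarrow> sat M s (form_rename r \<phi>) \<longleftrightarrow> sat M (\<lambda>i. s (r i)) \<phi>"
proof (induction \<phi> arbitrary: s)
  case (Ex n \<phi>)
  have "(\<lambda>i. (s(r n := x)) (r i)) = (\<lambda>i. s (r i))(n := x)" for x
    using Ex.prems by (auto simp: fun_eq_iff inj_eq)
  then show ?case using Ex by simp
qed auto

lemma tval_cong: "(\<And>i. i \<in> term_vars t \<Longrightarrow> s i = s' i) \<Longrightarrow> tval M s t = tval M s' t"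
  by (induction t) auto

lemma sat_cong: "(\<And>i. i \<in> free_vars \<phi> \<Longrightarrow> s i = s' i) \<Longrightarrow> sat M s \<phi> \<longleftrightarrow> sat M s' \<phi>"
proof (induction \<phi> arbitrary: s s')
  case (Eq t u)
  then show ?case using tval_cong[of t s s' M] tval_cong[of u s s' M] by simp
next
  case (InG t)
  then show ?case using tval_cong[of t s s' M] by simp
next
  case (And \<phi> \<psi>)
  have "sat M s \<phi> \<longleftrightarrow> sat M s' \<phi>" by (rule And.IH(1), rule And.prems) simp
  moreover have "sat M s \<psi> \<longleftrightarrow> sat M s' \<psi>" by (rule And.IH(2), rule And.prems) simp
  ultimately show ?case by (simp only: sat.simps)
next
  case (Ex n \<phi>)
  have "sat M (s(n := x)) \<phi> \<longleftrightarrow> sat M (s'(n := x)) \<phi>" for x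
    by (rule Ex.IH) (use Ex.prems in auto)
  then show ?case by simp
next
  case (Not \<phi>)
  have "sat M s \<phi> \<longleftrightarrow> sat M s' \<phi>" by (rule Not.IH, rule Not.prems) simp
  then show ?case by (simp only: sat.simps)
qed

lemma tval_closed:
  assumes "LG_structure M" "\<And>i. i \<in> term_vars t \<Longrightarrow> s i \<in> carrier M"
  shows "tval M s t \<in> carrier M"
  using assms(2) by (induction t) (use assms(1) in \<open>auto simp: LG_structure_def\<close>)

lemma tval_embedding:
  assumes "LG_structure M" "embedding f M N" "\<And>i. i \<in> term_vars t \<Longrightarrow> s i \<in> carrier M"
  shows "tval N (\<lambda>i. f (s i)) t = f (tval M s t)"
  using assms(3)
proof (induction t)
  case (Opp t)
  then show ?case using assms(2) tval_closed[OF assms(1), of t s] by (simp add: embedding_def)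
next
  case (Add t u)
  then show ?case using assms(2) tval_closed[OF assms(1), of t s] tval_closed[OF assms(1), of u s]
    by (simp add: embedding_def)
next
  case (Mul t u)
  then show ?case using assms(2) tval_closed[OF assms(1), of t s] tval_closed[OF assms(1), of u s]
    by (simp add: embedding_def)
qed (use assms(2) in \<open>auto simp: embedding_def\<close>)

lemma sat_onto_embedding:
  assumes M: "LG_structure M" and f: "embedding f M N" "f ` carrier M = carrier N"
    and "range s \<subseteq> carrier M"
  shows "sat N (\<lambda>i. f (s i)) \<phi> \<longleftrightarrow> sat M s \<phi>"
  using assms(4)
proof (induction \<phi> arbitrary: s)
  case (Eq t u)
  have c: "tval M s t \<in> carrier M" "tval M s u \<in> carrier M"
    using Eq by (auto intro!: tval_closed[OF M])
  have "tval N (\<lambda>i. f (s i)) t = f (tval M s t)" "tval N (\<lambda>i. f (s i)) u = f (tval M s u)"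
    using Eq by (auto intro!: tval_embedding[OF M f(1)])
  then show ?case using f(1) c by (auto simp: embedding_def inj_on_def)
next
  case (InG t)
  have c: "tval M s t \<in> carrier M" using InG by (auto intro!: tval_closed[OF M])
  have "tval N (\<lambda>i. f (s i)) t = f (tval M s t)"
    using InG by (auto intro!: tval_embedding[OF M f(1)])
  then show ?case using f(1) c by (auto simp: embedding_def)
next
  case (Ex n \<phi>)
  have "sat N ((\<lambda>i. f (s i))(n := f x)) \<phi> \<longleftrightarrow> sat M (s(n := x)) \<phi>" if "x \<in> carrier M" for x
  proof -
    have eq: "(\<lambda>i. f (s i))(n := f x) = (\<lambda>i. f ((s(n := x)) i))" by auto
    have "range (s(n := x)) \<subseteq> carrier M" using Ex.prems that by auto
    then show ?thesis unfolding eq by (rule Ex.IH)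
  qed
  then show ?case unfolding sat.simps f(2)[symmetric] by auto
qed auto

definition conjs :: "LG_form list \<Rightarrow> LG_form" where
  "conjs \<phi>s = foldr And \<phi>s (Eq Zero Zero)"

lemma sat_conjs [simp]: "sat M s (conjs \<phi>s) \<longleftrightarrow> (\<forall>\<phi>\<in>set \<phi>s. sat M s \<phi>)"
  by (induction \<phi>s) (auto simp: conjs_def)

lemma free_vars_conjs [simp]: "free_vars (conjs \<phi>s) = (\<Union>\<phi>\<in>set \<phi>s. free_vars \<phi>)"
  by (induction \<phi>s) (auto simp: conjs_def)

text \<open>Horner's scheme with the leading coefficient first, in step with
  \<open>eval\<close>.\<close>

definition poly_term :: "LG_term list \<Rightarrow> LG_term \<Rightarrow> LG_term" where
  "poly_term ts v = foldl (\<lambda>t c. Add (Mul t v) c) Zero ts"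

lemma term_vars_poly_term: "term_vars (poly_term ts v) \<subseteq> (\<Union>t\<in>set ts. term_vars t) \<union> term_vars v"
  by (induction ts rule: rev_induct) (auto simp: poly_term_def)

lemma tval_poly_term:
  assumes M: "field M" and "\<And>t. t \<in> set ts \<Longrightarrow> tval M s t \<in> carrier M" and v: "tval M s v \<in> carrier M"
  shows "tval M s (poly_term ts v) = ring.eval M (map (tval M s) ts) (tval M s v)"
proof -
  interpret field M by fact
  show ?thesis using assms(2)
  proof (induction ts rule: rev_induct)
    case (snoc t ts)
    have "set (map (tval M s) ts) \<subseteq> carrier M" "tval M s t \<in> carrier M" using snoc.prems by auto
    then show ?case using eval_append_aux[of "map (tval M s) ts" "tval M s t" "tval M s v"] v snoc
      by (simp add: poly_term_def)
  qed (simp add: poly_term_def)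
qed

section \<open>Formulas with parameters\<close>

definition map_params :: "('a \<Rightarrow> 'b) \<Rightarrow> LG_form \<times> 'a list \<Rightarrow> LG_form \<times> 'b list" where
  "map_params f \<Phi> = (fst \<Phi>, map f (snd \<Phi>))"

text \<open>The variables below n are common to both formulas; the variables of the second one that
  stand for its parameters are shifted past the parameters of the first.\<close>

definition And_params :: "nat \<Rightarrow> LG_form \<times> 'a list \<Rightarrow> LG_form \<times> 'a list \<Rightarrow> LG_form \<times> 'a list" where
  "And_params n \<Phi> \<Psi> =
    (And (fst \<Phi>) (form_rename (\<lambda>i. if i < n then i else i + length (snd \<Phi>)) (fst \<Psi>)), snd \<Phi> @ snd \<Psi>)"

text \<open>The quantified variable n goes behind the k parameters, which close the gap. The
  renaming is a permutation of all indices, because \<open>form_rename\<close> also touches bound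
  variables.\<close>

definition Ex_last :: "nat \<Rightarrow> LG_form \<times> 'a list \<Rightarrow> LG_form \<times> 'a list" where
  "Ex_last n \<Phi> = (let k = length (snd \<Phi>) in
    (Ex (n + k) (form_rename
      (\<lambda>i. if i < n then i else if i = n then n + k else if i \<le> n + k then i - 1 else i) (fst \<Phi>)), snd \<Phi>))"

text \<open>Leaves the last variable of a formula free, as variable 0, and turns those before it
  into parameters. This is the form to which saturation in one variable applies.\<close>

definition plug_init :: "'a list \<Rightarrow> LG_form \<times> 'a list \<Rightarrow> LG_form \<times> 'a list" where
  "plug_init xs \<Phi> =
    (form_rename (\<lambda>i. if i < length xs then Suc i else if i = length xs then 0 else i) (fst \<Phi>), xs @ snd \<Phi>)"

lemma inj_And: "inj (\<lambda>i::nat. if i < n then i else i + k)"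
  by (auto simp: inj_def split: if_splits)

lemma inj_Ex: "inj (\<lambda>i::nat. if i < n then i else if i = n then n + k else if i \<le> n + k then i - 1 else i)"
  by (auto simp: inj_def split: if_splits)

lemma inj_plug: "inj (\<lambda>i::nat. if i < n then Suc i else if i = n then 0 else i)"
  by (auto simp: inj_def split: if_splits)

lemma map_params_And: "map_params f (And_params n \<Phi> \<Psi>) = And_params n (map_params f \<Phi>) (map_params f \<Psi>)"
  by (simp add: map_params_def And_params_def cong: if_cong)

lemma map_params_Ex: "map_params f (Ex_last n \<Phi>) = Ex_last n (map_params f \<Phi>)"
  by (simp add: map_params_def Ex_last_def Let_def)

lemma map_params_formulas: "\<Phi> \<in> formulas_over n C \<Longrightarrow> map_params f \<Phi> \<in> formulas_over n (f ` C)"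
  by (auto simp: formulas_over_def map_params_def)

lemma And_params_formulas:
  assumes "\<Phi> \<in> formulas_over n C" "\<Psi> \<in> formulas_over n C"
  shows "And_params n \<Phi> \<Psi> \<in> formulas_over n C"
proof -
  obtain \<phi> cs \<psi> ds where eq: "\<Phi> = (\<phi>, cs)" "\<Psi> = (\<psi>, ds)" by (cases \<Phi>, cases \<Psi>)
  have fv: "i < n + length cs" if "i \<in> free_vars \<phi>" for i
    using assms that by (auto simp: formulas_over_def eq)
  moreover have "i < n + length ds" if "i \<in> free_vars \<psi>" for i
    using assms that by (auto simp: formulas_over_def eq)
  ultimately show ?thesis using assms
    by (auto simp: formulas_over_def And_params_def eq free_vars_rename[OF inj_And] intro: trans_less_add1)
      (use fv in fastforce)+
qed

lemma holds_And_params: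
  assumes "\<Phi> \<in> formulas_over n C" "\<Psi> \<in> formulas_over n D" "length xs = n"
  shows "holds M xs (And_params n \<Phi> \<Psi>) \<longleftrightarrow> holds M xs \<Phi> \<and> holds M xs \<Psi>"
proof -
  obtain \<phi> cs \<psi> ds where eq: "\<Phi> = (\<phi>, cs)" "\<Psi> = (\<psi>, ds)" by (cases \<Phi>, cases \<Psi>)
  have fv: "free_vars \<phi> \<subseteq> {..<n + length cs}" "free_vars \<psi> \<subseteq> {..<n + length ds}"
    using assms by (auto simp: formulas_over_def eq)
  have "sat M (tuple M (xs @ cs @ ds)) \<phi> \<longleftrightarrow> sat M (tuple M (xs @ cs)) \<phi>"
    by (rule sat_cong) (use fv assms(3) in \<open>auto simp: tuple_def nth_append\<close>)
  moreover have "sat M (\<lambda>i. tuple M (xs @ cs @ ds) (if i < n then i else i + length cs)) \<psi> \<longleftrightarrow>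
      sat M (tuple M (xs @ ds)) \<psi>"
    by (rule sat_cong) (use fv assms(3) in \<open>auto simp: tuple_def nth_append\<close>)
  ultimately show ?thesis
    by (simp add: holds_def eq And_params_def sat_rename[OF inj_And] cong: if_cong)
qed

lemma Ex_last_formulas:
  assumes "\<Phi> \<in> formulas_over (Suc n) C" shows "Ex_last n \<Phi> \<in> formulas_over n C"
proof -
  obtain \<phi> cs where eq: "\<Phi> = (\<phi>, cs)" by (cases \<Phi>)
  have "i < Suc n + length cs" if "i \<in> free_vars \<phi>" for i
    using assms that by (auto simp: formulas_over_def eq)
  then show ?thesis using assms
    by (force simp: formulas_over_def Ex_last_def Let_def eq free_vars_rename[OF inj_Ex] split: if_splits)
qed

lemma holds_Ex_last:
  assumes "\<Phi> \<in> formulas_over (Suc n) C" "length xs = n"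
  shows "holds M xs (Ex_last n \<Phi>) \<longleftrightarrow> (\<exists>x\<in>carrier M. holds M (xs @ [x]) \<Phi>)"
proof -
  obtain \<phi> cs where eq: "\<Phi> = (\<phi>, cs)" by (cases \<Phi>)
  let ?k = "length cs"
  let ?r = "\<lambda>i. if i < n then i else if i = n then n + ?k else if i \<le> n + ?k then i - 1 else i"
  have fv: "free_vars \<phi> \<subseteq> {..<Suc n + ?k}" using assms by (auto simp: formulas_over_def eq)
  have "sat M (\<lambda>i. ((tuple M (xs @ cs))(n + ?k := x)) (?r i)) \<phi> \<longleftrightarrow> sat M (tuple M ((xs @ [x]) @ cs)) \<phi>" for x
  proof (rule sat_cong)
    fix i assume "i \<in> free_vars \<phi>"
    then have i: "i < Suc n + ?k" using fv by auto
    consider "i < n" | "i = n" | "n < i" by linarith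
    then show "((tuple M (xs @ cs))(n + ?k := x)) (?r i) = tuple M ((xs @ [x]) @ cs) i"
    proof cases
      case 3
      then obtain j where "i = Suc (n + j)" by (metis less_iff_Suc_add)
      then show ?thesis using i assms(2) by (simp add: tuple_def nth_append)
    qed (use assms(2) in \<open>auto simp: tuple_def nth_append\<close>)
  qed
  then show ?thesis
    by (simp add: holds_def eq Ex_last_def Let_def sat_rename[OF inj_Ex])
qed

lemma plug_init_formulas:
  assumes "\<Phi> \<in> formulas_over (Suc n) C" "length xs = n"
  shows "plug_init xs \<Phi> \<in> formulas_over 1 (C \<union> set xs)"
proof -
  obtain \<phi> cs where eq: "\<Phi> = (\<phi>, cs)" by (cases \<Phi>)
  have "i < Suc n + length cs" if "i \<in> free_vars \<phi>" for i
    using assms that by (auto simp: formulas_over_def eq)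
  then show ?thesis using assms
    by (force simp: formulas_over_def plug_init_def eq free_vars_rename[OF inj_plug] split: if_splits)
qed

lemma holds_plug_init:
  assumes "\<Phi> \<in> formulas_over (Suc n) C" "length xs = n"
  shows "holds M [x] (plug_init xs \<Phi>) \<longleftrightarrow> holds M (xs @ [x]) \<Phi>"
proof -
  obtain \<phi> cs where eq: "\<Phi> = (\<phi>, cs)" by (cases \<Phi>)
  let ?r = "\<lambda>i. if i < length xs then Suc i else if i = length xs then 0 else i"
  have fv: "free_vars \<phi> \<subseteq> {..<Suc n + length cs}" using assms by (auto simp: formulas_over_def eq)
  have "sat M (\<lambda>i. tuple M ([x] @ xs @ cs) (?r i)) \<phi> \<longleftrightarrow> sat M (tuple M ((xs @ [x]) @ cs)) \<phi>"
  proof (rule sat_cong)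
    fix i assume "i \<in> free_vars \<phi>"
    then have i: "i < Suc n + length cs" using fv by auto
    consider "i < n" | "i = n" | "n < i" by linarith
    then show "tuple M ([x] @ xs @ cs) (?r i) = tuple M ((xs @ [x]) @ cs) i"
    proof cases
      case 3
      then obtain j where "i = Suc (n + j)" by (metis less_iff_Suc_add)
      then show ?thesis using i assms(2) by (simp add: tuple_def nth_append)
    qed (use assms(2) in \<open>auto simp: tuple_def nth_append\<close>)
  qed
  then show ?thesis
    by (simp add: holds_def eq plug_init_def sat_rename[OF inj_plug])
qed

text \<open>One conjunction serves all structures and all parameter maps f, because it is formed
  over K and evaluated in an extension along an elementary map.\<close>

lemma finite_conj_formula:
  fixes \<Sigma> :: "(LG_form \<times> 'a list) set"
  assumes "finite \<Sigma>" "\<Sigma> \<subseteq> formulas_over n C"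
  obtains \<Theta> where "\<Theta> \<in> formulas_over n C"
    "\<And>(M::'b LG_struct) f xs. length xs = n \<Longrightarrow>
       holds M xs (map_params f \<Theta>) \<longleftrightarrow> (\<forall>\<Phi>\<in>\<Sigma>. holds M xs (map_params f \<Phi>))"
proof -
  have "\<exists>\<Theta>\<in>formulas_over n C. \<forall>(M::'b LG_struct) f xs. length xs = n \<longrightarrow>
       (holds M xs (map_params f \<Theta>) \<longleftrightarrow> (\<forall>\<Phi>\<in>\<Sigma>. holds M xs (map_params f \<Phi>)))"
    using assms
  proof (induction \<Sigma>)
    case empty
    show ?case
      by (intro bexI[of _ "(Eq Zero Zero, [])"]) (auto simp: holds_def map_params_def formulas_over_def)
  next
    case (insert \<Phi> \<Sigma>)
    then obtain \<Theta> where \<Theta>: "\<Theta> \<in> formulas_over n C" "\<forall>(M::'b LG_struct) f xs. length xs = n \<longrightarrow>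
       (holds M xs (map_params f \<Theta>) \<longleftrightarrow> (\<forall>\<Phi>\<in>\<Sigma>. holds M xs (map_params f \<Phi>)))" by auto
    have \<Phi>: "\<Phi> \<in> formulas_over n C" using insert by simp
    show ?case
    proof (intro bexI[of _ "And_params n \<Phi> \<Theta>"] allI impI)
      fix M :: "'b LG_struct" and f :: "'a \<Rightarrow> 'b" and xs :: "'b list" assume "length xs = n"
      then show "holds M xs (map_params f (And_params n \<Phi> \<Theta>)) \<longleftrightarrow>
          (\<forall>\<Phi>\<in>insert \<Phi> \<Sigma>. holds M xs (map_params f \<Phi>))"
        unfolding map_params_And
        using holds_And_params[OF map_params_formulas[OF \<Phi>] map_params_formulas[OF \<Theta>(1)]] \<Theta>(2) by auto
    qed (rule And_params_formulas[OF \<Phi> \<Theta>(1)])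
  qed
  then show thesis using that by blast
qed

lemma map_params_id [simp]: "map_params (\<lambda>x. x) \<Phi> = \<Phi>"
  by (simp add: map_params_def)

section \<open>Saturation for tuples\<close>

lemma infinite_Field:
  assumes \<kappa>: "Card_order \<kappa>" "natLeq <o \<kappa>" shows "infinite (Field \<kappa>)"
proof
  assume "finite (Field \<kappa>)"
  then have "|Field \<kappa>| <o natLeq" using finite_iff_ordLess_natLeq by blast
  then have "\<kappa> <o natLeq"
    using ordIso_ordLess_trans[OF ordIso_symmetric[OF card_of_Field_ordIso[OF \<kappa>(1)]]] by blast
  then show False using \<kappa>(2) ordLess_transitive ordLess_irreflexive by blast
qed

lemma card_Un_finite_less:
  assumes \<kappa>: "Card_order \<kappa>" "natLeq <o \<kappa>" and "|C| <o \<kappa>" "finite Y"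
  shows "|C \<union> Y| <o \<kappa>"
proof (rule card_of_Un_ordLess_infinite_Field[OF infinite_Field[OF \<kappa>] \<kappa>(1) assms(3)])
  have "|Y| <o natLeq" using assms(4) finite_iff_ordLess_natLeq by blast
  then show "|Y| <o \<kappa>" using \<kappa>(2) ordLess_transitive by blast
qed

text \<open>Saturation is defined for one variable. The first n entries realize the projections of
  all finite conjunctions from \<Sigma>; the last entry then realizes \<Sigma> over C and those n
  entries.\<close>

lemma saturated_tuples:
  fixes \<kappa> :: "'c rel" and M :: "'a LG_struct"
  assumes sat: "saturated \<kappa> M" and \<kappa>: "Card_order \<kappa>" "natLeq <o \<kappa>"
    and C: "C \<subseteq> carrier M" "|C| <o \<kappa>" and "\<Sigma> \<subseteq> formulas_over n C"
    and "\<And>\<Sigma>'. finite \<Sigma>' \<Longrightarrow> \<Sigma>' \<subseteq> \<Sigma> \<Longrightarrow>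
      \<exists>xs. length xs = n \<and> set xs \<subseteq> carrier M \<and> (\<forall>\<Phi>\<in>\<Sigma>'. holds M xs \<Phi>)"
  shows "\<exists>xs. length xs = n \<and> set xs \<subseteq> carrier M \<and> (\<forall>\<Phi>\<in>\<Sigma>. holds M xs \<Phi>)"
  using assms(6,7)
proof (induction n arbitrary: \<Sigma>)
  case 0
  have "holds M [] \<Phi>" if "\<Phi> \<in> \<Sigma>" for \<Phi> using 0(2)[of "{\<Phi>}"] that by auto
  then show ?case by auto
next
  case (Suc n)
  define P where "P \<Delta> \<Theta> \<longleftrightarrow> \<Theta> \<in> formulas_over (Suc n) C \<and>
    (\<forall>xs. length xs = Suc n \<longrightarrow> (holds M xs \<Theta> \<longleftrightarrow> (\<forall>\<Phi>\<in>\<Delta>. holds M xs \<Phi>)))" for \<Delta> \<Theta>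
  have ex: "\<exists>\<Theta>. P \<Delta> \<Theta>" if \<Delta>: "finite \<Delta>" "\<Delta> \<subseteq> \<Sigma>" for \<Delta>
  proof -
    obtain \<Theta> where "\<Theta> \<in> formulas_over (Suc n) C"
      "\<And>(N::'a LG_struct) f xs. length xs = Suc n \<Longrightarrow>
       holds N xs (map_params f \<Theta>) \<longleftrightarrow> (\<forall>\<Phi>\<in>\<Delta>. holds N xs (map_params f \<Phi>))"
      using finite_conj_formula[OF \<Delta>(1), of "Suc n" C] \<Delta>(2) Suc.prems(1) by blast
    note \<Theta> = this(1) this(2)[of _ M "\<lambda>x. x"]
    then show ?thesis unfolding P_def by (intro exI[of _ \<Theta>]) simp
  qed
  \<comment> \<open>Conjunctions are formed before projecting, since the projections of single
    formulas might have different witnesses.\<close>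
  let ?S = "{\<Theta>'. \<exists>\<Delta> \<Theta>. finite \<Delta> \<and> \<Delta> \<subseteq> \<Sigma> \<and> P \<Delta> \<Theta> \<and> \<Theta>' = Ex_last n \<Theta>}"
  have "\<exists>xs. length xs = n \<and> set xs \<subseteq> carrier M \<and> (\<forall>\<Phi>\<in>?S. holds M xs \<Phi>)"
  proof (rule Suc.IH)
    show "?S \<subseteq> formulas_over n C" using Ex_last_formulas unfolding P_def by blast
    fix \<Sigma>' assume S': "finite \<Sigma>'" "\<Sigma>' \<subseteq> ?S"
    \<comment> \<open>One finite part \<Delta> of \<Sigma> covers all conjunctions behind \<Sigma>',
      so one realization of \<Delta> serves them all.\<close>
    have "\<exists>\<Delta>. finite \<Delta> \<and> \<Delta> \<subseteq> \<Sigma> \<and>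
      (\<forall>\<Theta>'\<in>\<Sigma>'. \<exists>\<Delta>' \<Theta>. \<Delta>' \<subseteq> \<Delta> \<and> P \<Delta>' \<Theta> \<and> \<Theta>' = Ex_last n \<Theta>)"
      using S'
    proof (induction \<Sigma>')
      case empty
      then show ?case by auto
    next
      case (insert \<Phi> \<Sigma>')
      then obtain \<Delta> where \<Delta>: "finite \<Delta>" "\<Delta> \<subseteq> \<Sigma>"
        "\<forall>\<Theta>'\<in>\<Sigma>'. \<exists>\<Delta>' \<Theta>. \<Delta>' \<subseteq> \<Delta> \<and> P \<Delta>' \<Theta> \<and> \<Theta>' = Ex_last n \<Theta>" by auto
      obtain \<Delta>1 \<Theta>1 where 1: "finite \<Delta>1" "\<Delta>1 \<subseteq> \<Sigma>" "P \<Delta>1 \<Theta>1" "\<Phi> = Ex_last n \<Theta>1"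
        using insert.prems by blast
      have "\<forall>\<Theta>'\<in>insert \<Phi> \<Sigma>'. \<exists>\<Delta>' \<Theta>. \<Delta>' \<subseteq> \<Delta> \<union> \<Delta>1 \<and> P \<Delta>' \<Theta> \<and> \<Theta>' = Ex_last n \<Theta>"
      proof
        fix \<Theta>' assume "\<Theta>' \<in> insert \<Phi> \<Sigma>'"
        then consider "\<Theta>' = \<Phi>" | "\<Theta>' \<in> \<Sigma>'" by blast
        then show "\<exists>\<Delta>' \<Theta>. \<Delta>' \<subseteq> \<Delta> \<union> \<Delta>1 \<and> P \<Delta>' \<Theta> \<and> \<Theta>' = Ex_last n \<Theta>"
        proof cases
          case 1
          then show ?thesis using \<open>P \<Delta>1 \<Theta>1\<close> \<open>\<Phi> = Ex_last n \<Theta>1\<close> by blast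
        next
          case 2
          then obtain \<Delta>' \<Theta> where "\<Delta>' \<subseteq> \<Delta>" "P \<Delta>' \<Theta>" "\<Theta>' = Ex_last n \<Theta>" using \<Delta>(3) by blast
          then show ?thesis by (intro exI[of _ \<Delta>'] exI[of _ \<Theta>]) auto
        qed
      qed
      then show ?case using \<Delta> 1 by (intro exI[of _ "\<Delta> \<union> \<Delta>1"]) simp
    qed
    then obtain \<Delta> where \<Delta>: "finite \<Delta>" "\<Delta> \<subseteq> \<Sigma>"
      "\<forall>\<Theta>'\<in>\<Sigma>'. \<exists>\<Delta>' \<Theta>. \<Delta>' \<subseteq> \<Delta> \<and> P \<Delta>' \<Theta> \<and> \<Theta>' = Ex_last n \<Theta>" by blast
    obtain ys where ys: "length ys = Suc n" "set ys \<subseteq> carrier M" "\<forall>\<Phi>\<in>\<Delta>. holds M ys \<Phi>"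
      using Suc.prems(2)[OF \<Delta>(1,2)] by blast
    then obtain xs x where xs: "ys = xs @ [x]" "length xs = n"
      by (cases ys rule: rev_cases) auto
    have "holds M xs \<Theta>'" if T: "\<Theta>' \<in> \<Sigma>'" for \<Theta>'
    proof -
      obtain \<Delta>' \<Theta> where D: "\<Delta>' \<subseteq> \<Delta>" "P \<Delta>' \<Theta>" "\<Theta>' = Ex_last n \<Theta>"
        using bspec[OF \<Delta>(3) T] by (elim exE conjE)
      have "length (xs @ [x]) = Suc n" using xs by simp
      moreover have "\<forall>\<Phi>\<in>\<Delta>'. holds M (xs @ [x]) \<Phi>" using ys(3) xs(1) D(1) by blast
      ultimately have "\<Theta> \<in> formulas_over (Suc n) C" "holds M (xs @ [x]) \<Theta>"
        using D(2) unfolding P_def by blast+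
      moreover have "x \<in> carrier M" using ys xs by simp
      ultimately show ?thesis unfolding D(3) using holds_Ex_last[of \<Theta> n C xs M] xs(2) by blast
    qed
    then show "\<exists>xs. length xs = n \<and> set xs \<subseteq> carrier M \<and> (\<forall>\<Phi>\<in>\<Sigma>'. holds M xs \<Phi>)"
      using xs ys by auto
  qed
  then obtain xs where xs: "length xs = n" "set xs \<subseteq> carrier M" "\<forall>\<Phi>\<in>?S. holds M xs \<Phi>" by blast
  let ?C = "C \<union> set xs"
  have "\<exists>x\<in>carrier M. \<forall>\<Phi>\<in>plug_init xs ` \<Sigma>. holds M [x] \<Phi>"
  proof (rule sat[unfolded saturated_def, rule_format], intro conjI allI impI)
    show "?C \<subseteq> carrier M" using C xs by simp
    show "|?C| <o \<kappa>" by (rule card_Un_finite_less[OF \<kappa> C(2)]) simp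
    show "plug_init xs ` \<Sigma> \<subseteq> formulas_over 1 ?C"
      using plug_init_formulas[OF _ xs(1)] Suc.prems(1) by blast
    fix \<Sigma>' assume "finite \<Sigma>' \<and> \<Sigma>' \<subseteq> plug_init xs ` \<Sigma>"
    then obtain \<Delta> where \<Delta>: "\<Delta> \<subseteq> \<Sigma>" "finite \<Delta>" "\<Sigma>' = plug_init xs ` \<Delta>"
      by (metis finite_subset_image)
    obtain \<Theta> where \<Theta>: "P \<Delta> \<Theta>" using ex[OF \<Delta>(2,1)] by blast
    then have \<Theta>1: "\<Theta> \<in> formulas_over (Suc n) C"
      "\<And>ys. length ys = Suc n \<Longrightarrow> holds M ys \<Theta> \<longleftrightarrow> (\<forall>\<Phi>\<in>\<Delta>. holds M ys \<Phi>)"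
      unfolding P_def by blast+
    have "Ex_last n \<Theta> \<in> ?S" using \<Delta> \<Theta> by blast
    then have "holds M xs (Ex_last n \<Theta>)" using xs by blast
    then obtain x where x: "x \<in> carrier M" "holds M (xs @ [x]) \<Theta>"
      using holds_Ex_last[OF \<Theta>1(1) xs(1)] by blast
    then have "\<forall>\<Phi>\<in>\<Delta>. holds M (xs @ [x]) \<Phi>" using \<Theta>1(2) xs(1) by simp
    then have "\<forall>\<Phi>\<in>\<Sigma>'. holds M [x] \<Phi>"
      using holds_plug_init[OF _ xs(1)] Suc.prems(1) \<Delta> by blast
    then show "\<exists>x\<in>carrier M. \<forall>\<Phi>\<in>\<Sigma>'. holds M [x] \<Phi>" using x by blast
  qed
  then obtain x where x: "x \<in> carrier M" "\<And>\<Phi>. \<Phi> \<in> \<Sigma> \<Longrightarrow> holds M [x] (plug_init xs \<Phi>)" by auto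
  have "holds M (xs @ [x]) \<Phi>" if "\<Phi> \<in> \<Sigma>" for \<Phi>
    using x(2)[OF that] holds_plug_init[OF _ xs(1)] Suc.prems(1) that by blast
  then show ?case using x xs by (intro exI[of _ "xs @ [x]"]) auto
qed

section \<open>Elementary maps and formulas with parameters\<close>

lemma elementary_tuple:
  assumes "elementary f K M" "set xs \<subseteq> carrier K" "\<zero>\<^bsub>K\<^esub> \<in> carrier K" "free_vars \<phi> \<subseteq> {..<length xs}"
  shows "sat M (tuple M (map f xs)) \<phi> \<longleftrightarrow> sat K (tuple K xs) \<phi>"
proof -
  have "range (tuple K xs) \<subseteq> carrier K" using assms(2,3) by (auto simp: tuple_def)
  then have "sat K (tuple K xs) \<phi> \<longleftrightarrow> sat M (f \<circ> tuple K xs) \<phi>"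
    using assms(1) unfolding elementary_def by blast
  also have "\<dots> \<longleftrightarrow> sat M (tuple M (map f xs)) \<phi>"
    by (rule sat_cong) (use assms(4) in \<open>auto simp: tuple_def\<close>)
  finally show ?thesis by simp
qed

lemma elementary_holds:
  assumes "elementary f K M" "set xs \<subseteq> carrier K" "\<zero>\<^bsub>K\<^esub> \<in> carrier K"
    "\<Phi> \<in> formulas_over (length xs) (carrier K)"
  shows "holds M (map f xs) (map_params f \<Phi>) \<longleftrightarrow> holds K xs \<Phi>"
  using elementary_tuple[OF assms(1), of "xs @ snd \<Phi>" "fst \<Phi>"] assms
  by (auto simp: holds_def map_params_def formulas_over_def)

text \<open>\<open>elementary\<close> speaks of elements of the source only, so the solution in M is
  quantified away entry by entry and then chosen anew in K.\<close>

lemma elementary_pullback: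
  assumes f: "elementary f K M" and z: "\<zero>\<^bsub>K\<^esub> \<in> carrier K"
    and "\<Phi> \<in> formulas_over n (carrier K)"
    and "length xs = n" "set xs \<subseteq> carrier M" "holds M xs (map_params f \<Phi>)"
  obtains ys where "length ys = n" "set ys \<subseteq> carrier K" "holds K ys \<Phi>"
proof -
  have "\<exists>ys. length ys = n \<and> set ys \<subseteq> carrier K \<and> holds K ys \<Phi>"
    using assms(3-)
  proof (induction n arbitrary: \<Phi> xs)
    case 0
    then show ?case using elementary_holds[OF f _ z, of "[]" \<Phi>] by simp
  next
    case (Suc n)
    obtain zs x where xs: "xs = zs @ [x]" using Suc.prems(2) by (cases xs rule: rev_cases) auto
    have "holds M zs (Ex_last n (map_params f \<Phi>))"
      using holds_Ex_last[OF map_params_formulas[OF Suc.prems(1), of f], of zs M] Suc.prems xs by auto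
    then obtain ys where ys: "length ys = n" "set ys \<subseteq> carrier K" "holds K ys (Ex_last n \<Phi>)"
      using Suc.IH[OF Ex_last_formulas[OF Suc.prems(1)], of zs] Suc.prems xs
      by (auto simp: map_params_Ex)
    then obtain y where "y \<in> carrier K" "holds K (ys @ [y]) \<Phi>"
      using holds_Ex_last[OF Suc.prems(1) ys(1), of K] by blast
    then show ?case using ys by (intro exI[of _ "ys @ [y]"]) auto
  qed
  then show thesis using that by blast
qed

text \<open>A finite definable set does not grow in an elementary extension: a solution in M
  different from the images of the finitely many solutions in K would be pulled back to a further
  solution in K.\<close>

lemma elementary_finite_set:
  assumes f: "elementary f K M" and z: "\<zero>\<^bsub>K\<^esub> \<in> carrier K"
    and \<Phi>: "\<Phi> \<in> formulas_over 1 (carrier K)" and fin: "finite {y \<in> carrier K. holds K [y] \<Phi>}"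
    and y: "y \<in> carrier M" "holds M [y] (map_params f \<Phi>)"
  shows "y \<in> f ` {y \<in> carrier K. holds K [y] \<Phi>}"
proof (rule ccontr)
  obtain \<phi> cs where eq: "\<Phi> = (\<phi>, cs)" by (cases \<Phi>)
  obtain xs where xs: "set xs = {y \<in> carrier K. holds K [y] \<Phi>}" using finite_list[OF fin] by blast
  \<comment> \<open>The solutions become parameters behind those of \<phi>, hence the index 1 +
    \<open>length cs\<close> + j.\<close>
  define \<psi> where "\<psi> = conjs (\<phi> # map (\<lambda>j. Not (Eq (Var 0) (Var (1 + length cs + j)))) [0..<length xs])"
  assume n: "y \<notin> f ` {y \<in> carrier K. holds K [y] \<Phi>}"
  have fv: "free_vars \<phi> \<subseteq> {..<Suc (length cs)}" "set cs \<subseteq> carrier K"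
    using \<Phi> by (auto simp: formulas_over_def eq)
  have \<Psi>: "(\<psi>, cs @ xs) \<in> formulas_over 1 (carrier K)"
    using fv xs by (auto simp: formulas_over_def \<psi>_def subset_iff)
  have \<psi>: "holds N [v] (\<psi>, ds @ zs) \<longleftrightarrow> holds N [v] (\<phi>, ds) \<and> v \<notin> set zs"
    if "length ds = length cs" "length zs = length xs" for N :: "'c LG_struct" and v ds zs
  proof -
    have "sat N (tuple N (v # ds @ zs)) \<phi> \<longleftrightarrow> sat N (tuple N (v # ds)) \<phi>"
      by (rule sat_cong) (use fv that in \<open>auto simp: tuple_def nth_append nth_Cons split: nat.split\<close>)
    moreover have "tuple N (v # ds @ zs) (Suc (length cs + j)) = zs ! j" if "j < length zs" for j
      using that \<open>length ds = length cs\<close> by (auto simp: tuple_def nth_append)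
    moreover have "tuple N (v # ds @ zs) 0 = v" by (simp add: tuple_def)
    ultimately show ?thesis using that by (auto simp: holds_def \<psi>_def in_set_conv_nth)
  qed
  have "holds M [y] (map_params f (\<psi>, cs @ xs))"
    using \<psi>[of "map f cs" "map f xs" M y] y n xs by (auto simp: map_params_def eq)
  then obtain ys where ys: "length ys = 1" "set ys \<subseteq> carrier K" "holds K ys (\<psi>, cs @ xs)"
    using elementary_pullback[OF f z \<Psi>, of "[y]"] y by auto
  then obtain v where "ys = [v]" by (metis One_nat_def length_0_conv length_Suc_conv)
  then show False using \<psi>[of cs xs K v] ys xs by (auto simp: eq)
qed

section \<open>Transport of structure\<close>

text \<open>Transport along an injection, to bring structures onto the type over which the
  definition of a model companion quantifies.\<close>

definition push :: "('b \<Rightarrow> 'a) \<Rightarrow> 'b LG_struct \<Rightarrow> 'a LG_struct" where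
  "push h M = (let k = inv_into (carrier M) h in
    \<lparr>carrier = h ` carrier M, monoid.mult = (\<lambda>x y. h (k x \<otimes>\<^bsub>M\<^esub> k y)), monoid.one = h \<one>\<^bsub>M\<^esub>,
     ring.zero = h \<zero>\<^bsub>M\<^esub>, ring.add = (\<lambda>x y. h (k x \<oplus>\<^bsub>M\<^esub> k y)), opp = (\<lambda>x. h (opp M (k x))),
     Gset = h ` Gset M\<rparr>)"

lemma push:
  assumes "LG_structure M" "inj_on h (carrier M)"
  shows "LG_structure (push h M)" "embedding h M (push h M)" "h ` carrier M = carrier (push h M)"
  using assms by (auto simp: LG_structure_def embedding_def push_def Let_def inj_on_image_mem_iff)

lemma is_model_push:
  assumes "is_model M T" "inj_on h (carrier M)"
  shows "is_model (push h M) T"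
proof -
  have M: "LG_structure M" using assms(1) by (simp add: is_model_def)
  note P = push[OF M assms(2)]
  have "sat (push h M) s \<phi>" if "\<phi> \<in> T" and s: "range s \<subseteq> carrier (push h M)" for \<phi> s
  proof -
    let ?s = "\<lambda>i. inv_into (carrier M) h (s i)"
    have hs: "s i \<in> h ` carrier M" for i using s P(3) by blast
    have "(\<lambda>i. h (?s i)) = s" using f_inv_into_f[OF hs] by auto
    moreover have rs: "range ?s \<subseteq> carrier M" using inv_into_into[OF hs] by auto
    moreover have "sat M ?s \<phi>" using assms(1) \<open>\<phi> \<in> T\<close> rs by (auto simp: is_model_def)
    ultimately show ?thesis using sat_onto_embedding[OF M P(2,3) rs, of \<phi>] by simp
  qed
  then show ?thesis using P(1) by (simp add: is_model_def)
qed

lemma embedding_comp: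
  assumes "embedding f K L" "embedding g L M" shows "embedding (\<lambda>x. g (f x)) K M"
  using assms unfolding embedding_def inj_on_def by (auto simp: image_subset_iff)

lemma embedding_ring_hom: "embedding f K L \<Longrightarrow> f \<in> ring_hom K L"
  unfolding embedding_def by (intro ring_hom_memI) auto

definition LG_of :: "'b ring \<Rightarrow> 'b set \<Rightarrow> 'b LG_struct" where
  "LG_of L H = \<lparr>carrier = carrier L, monoid.mult = monoid.mult L, monoid.one = \<one>\<^bsub>L\<^esub>,
     ring.zero = \<zero>\<^bsub>L\<^esub>, ring.add = ring.add L, opp = a_inv L, Gset = H\<rparr>"

lemma field_LG_of:
  assumes "field L" shows "field (LG_of L H)"
proof -
  have "id \<in> ring_iso L (LG_of L H)"
    by (auto simp: ring_iso_def LG_of_def intro!: ring_hom_memI)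
  from field.ring_iso_imp_img_field[OF assms this] show ?thesis by (simp add: LG_of_def)
qed

lemma ring_hom_LG_of: "f \<in> ring_hom K (LG_of L H) \<longleftrightarrow> f \<in> ring_hom K L"
  by (simp add: ring_hom_def LG_of_def)

lemma is_model_LG_of:
  assumes K: "is_model K (T_G p)" and L: "field L" and f: "f \<in> ring_hom K L"
    and H: "additive_subgroup H L" and fH: "\<And>a. a \<in> carrier K \<Longrightarrow> f a \<in> H \<longleftrightarrow> a \<in> Gset K"
  shows "is_model (LG_of L H) (T_G p)" "embedding f K (LG_of L H)"
proof -
  let ?L = "LG_of L H"
  note KT = is_model_T_G_imp[OF K]
  interpret K: field K by (rule KT(1))
  interpret L: field L by (rule L)
  interpret LL: field ?L by (rule field_LG_of[OF L])
  interpret f: ring_hom_ring K ?L f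
    by (rule ring_hom_ringI2[OF K.ring_axioms LL.ring_axioms]) (use f in \<open>simp add: ring_hom_LG_of\<close>)
  have KS: "LG_structure K" using K by (simp add: is_model_def)
  have opp: "opp ?L x = \<ominus>\<^bsub>?L\<^esub> x" for x
    by (simp add: LG_of_def a_inv_def m_inv_def)
  show emb: "embedding f K ?L"
    unfolding embedding_def
  proof (intro conjI ballI)
    show "inj_on f (carrier K)" by (rule field_hom_inj[OF KT(1) L f])
    show "f x \<in> Gset ?L \<longleftrightarrow> x \<in> Gset K" if "x \<in> carrier K" for x
      using fH[OF that] by (simp add: LG_of_def)
    show "f (opp K x) = opp ?L (f x)" if "x \<in> carrier K" for x
      using KT(4) that opp by simp
  qed auto
  show "is_model ?L (T_G p)"
  proof (rule is_model_T_GI)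
    show "field ?L" by (rule LL.field_axioms)
    interpret H: additive_subgroup H L by (rule H)
    show "additive_subgroup (Gset ?L) ?L"
    proof (rule additive_subgroup.intro, rule LL.add.subgroupI)
      have neg: "\<ominus>\<^bsub>?L\<^esub> x = \<ominus>\<^bsub>L\<^esub> x" for x by (simp add: LG_of_def a_inv_def m_inv_def)
      show "\<ominus>\<^bsub>?L\<^esub> a \<in> Gset ?L" if "a \<in> Gset ?L" for a
        unfolding neg using that H.a_inv_closed by (simp add: LG_of_def)
      have "Gset ?L = H" by (simp add: LG_of_def)
      then show "Gset ?L \<noteq> {}" using H.zero_closed by blast
    qed (use H.a_subset H.a_closed in \<open>auto simp: LG_of_def\<close>)
    show "\<forall>x\<in>carrier ?L. opp ?L x = \<ominus>\<^bsub>?L\<^esub> x" using opp by simp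
    \<comment> \<open>The characteristic is read off from the value of the term
      \<open>nat_term p\<close>, which an embedding preserves.\<close>
    have "tval ?L (\<lambda>i. f \<zero>\<^bsub>K\<^esub>) (nat_term p) = f (tval K (\<lambda>i. \<zero>\<^bsub>K\<^esub>) (nat_term p))"
      by (rule tval_embedding[OF KS emb]) simp
    then show "[p] \<cdot>\<^bsub>?L\<^esub> \<one>\<^bsub>?L\<^esub> = \<zero>\<^bsub>?L\<^esub>" using KT(3) by (simp add: tval_nat_term)
  qed
qed

lemma sum_image_additive_subgroup:
  assumes K: "abelian_group K" and L: "abelian_group L" and G: "additive_subgroup G K"
    and f: "f \<in> carrier K \<rightarrow> carrier L" "\<And>x y. x \<in> carrier K \<Longrightarrow> y \<in> carrier K \<Longrightarrow> f (x \<oplus>\<^bsub>K\<^esub> y) = f x \<oplus>\<^bsub>L\<^esub> f y"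
    and g: "g \<in> carrier K \<rightarrow> carrier L" "\<And>x y. x \<in> carrier K \<Longrightarrow> y \<in> carrier K \<Longrightarrow> g (x \<oplus>\<^bsub>K\<^esub> y) = g x \<oplus>\<^bsub>L\<^esub> g y"
  shows "additive_subgroup {f x \<oplus>\<^bsub>L\<^esub> g y | x y. x \<in> G \<and> y \<in> G} L"
proof -
  interpret K: abelian_group K by fact
  interpret L: abelian_group L by fact
  interpret G: additive_subgroup G K by fact
  have neg: "h (\<ominus>\<^bsub>K\<^esub> x) = \<ominus>\<^bsub>L\<^esub> h x" if h: "h \<in> carrier K \<rightarrow> carrier L"
    "\<And>x y. x \<in> carrier K \<Longrightarrow> y \<in> carrier K \<Longrightarrow> h (x \<oplus>\<^bsub>K\<^esub> y) = h x \<oplus>\<^bsub>L\<^esub> h y"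
    and x: "x \<in> carrier K" for h x
  proof -
    have c: "h y \<in> carrier L" if "y \<in> carrier K" for y using h(1) that by auto
    have "h \<zero>\<^bsub>K\<^esub> \<oplus>\<^bsub>L\<^esub> h \<zero>\<^bsub>K\<^esub> = h \<zero>\<^bsub>K\<^esub> \<oplus>\<^bsub>L\<^esub> \<zero>\<^bsub>L\<^esub>"
      using h(2)[of "\<zero>\<^bsub>K\<^esub>" "\<zero>\<^bsub>K\<^esub>"] c by simp
    then have h0: "h \<zero>\<^bsub>K\<^esub> = \<zero>\<^bsub>L\<^esub>" using c L.add.l_cancel[of "h \<zero>\<^bsub>K\<^esub>" "h \<zero>\<^bsub>K\<^esub>" "\<zero>\<^bsub>L\<^esub>"] by simp
    have "h (\<ominus>\<^bsub>K\<^esub> x) \<oplus>\<^bsub>L\<^esub> h x = \<zero>\<^bsub>L\<^esub>" using h(2)[of "\<ominus>\<^bsub>K\<^esub> x" x] h0 x by (simp add: K.l_neg)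
    then show ?thesis using L.minus_equality[of "h (\<ominus>\<^bsub>K\<^esub> x)" "h x"] c x by simp
  qed
  have Gc: "x \<in> carrier K" if "x \<in> G" for x using that G.a_subset by blast
  have fc: "f x \<in> carrier L" "g x \<in> carrier L" if "x \<in> G" for x using f(1) g(1) Gc[OF that] by auto
  show ?thesis
  proof (rule additive_subgroup.intro, rule L.add.subgroupI)
    show "{f x \<oplus>\<^bsub>L\<^esub> g y | x y. x \<in> G \<and> y \<in> G} \<subseteq> carrier L" using fc by auto
    show "{f x \<oplus>\<^bsub>L\<^esub> g y | x y. x \<in> G \<and> y \<in> G} \<noteq> {}" using G.zero_closed by blast
    fix a assume "a \<in> {f x \<oplus>\<^bsub>L\<^esub> g y | x y. x \<in> G \<and> y \<in> G}"
    then obtain x y where a: "a = f x \<oplus>\<^bsub>L\<^esub> g y" "x \<in> G" "y \<in> G" by blast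
    have "\<ominus>\<^bsub>L\<^esub> a = f (\<ominus>\<^bsub>K\<^esub> x) \<oplus>\<^bsub>L\<^esub> g (\<ominus>\<^bsub>K\<^esub> y)"
      using a fc neg[OF f Gc] neg[OF g Gc] by (simp add: L.minus_add)
    then show "\<ominus>\<^bsub>L\<^esub> a \<in> {f x \<oplus>\<^bsub>L\<^esub> g y | x y. x \<in> G \<and> y \<in> G}" using a G.a_inv_closed by blast
    fix b assume "b \<in> {f x \<oplus>\<^bsub>L\<^esub> g y | x y. x \<in> G \<and> y \<in> G}"
    then obtain x' y' where b: "b = f x' \<oplus>\<^bsub>L\<^esub> g y'" "x' \<in> G" "y' \<in> G" by blast
    have "a \<oplus>\<^bsub>L\<^esub> b = f (x \<oplus>\<^bsub>K\<^esub> x') \<oplus>\<^bsub>L\<^esub> g (y \<oplus>\<^bsub>K\<^esub> y')"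
      using a b fc f(2)[OF Gc Gc] g(2)[OF Gc Gc] by (simp add: L.a_ac)
    then show "a \<oplus>\<^bsub>L\<^esub> b \<in> {f x \<oplus>\<^bsub>L\<^esub> g y | x y. x \<in> G \<and> y \<in> G}" using a b G.a_closed by blast
  qed
qed

section \<open>Models of the model companion\<close>

text \<open>This is how existential closedness is used: K embeds in L, L embeds in a model M of the
  companion, and between K and M model completeness applies. The bound on L makes room for it on the
  type of K.\<close>

lemma model_companion_extend:
  fixes K :: "'a::infinite LG_struct" and L :: "'b LG_struct"
  assumes mc: "model_companion TYPE('a) T T'" and K: "is_model K T'"
    and L: "is_model L T" and card: "|carrier L| \<le>o |UNIV :: 'a set|"
  obtains M :: "'a LG_struct" and h where "is_model M T'" "embedding h L M"
    "\<And>k. embedding k K L \<Longrightarrow> elementary (\<lambda>x. h (k x)) K M"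
proof -
  obtain i :: "'b \<Rightarrow> 'a" where i: "inj_on i (carrier L)"
    using card unfolding card_of_ordLeq[symmetric] by blast
  have LS: "LG_structure L" using L by (simp add: is_model_def)
  have "is_model (push i L) T" by (rule is_model_push[OF L i])
  then obtain M :: "'a LG_struct" and j where M: "is_model M T'" "embedding j (push i L) M"
    using mc unfolding model_companion_def by blast
  have emb: "embedding (\<lambda>x. j (i x)) L M" by (rule embedding_comp[OF push(2)[OF LS i] M(2)])
  have "elementary (\<lambda>x. j (i (k x))) K M" if "embedding k K L" for k
    using mc K M(1) embedding_comp[OF that emb] unfolding model_companion_def model_complete_def by blast
  then show thesis using that[OF M(1) emb] by blast
qed

text \<open>K embeds in a model N of \<open>T_G p\<close>, from which the universal axioms descend.
  The existence of inverses is existential; they are found in N, hence in a model M of the companion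
  above N, and come down because M is elementary over K.\<close>

lemma model_companion_T_G:
  fixes K :: "'a::infinite LG_struct"
  assumes mc: "model_companion TYPE('a) (T_G p) T'" and K: "is_model K T'"
  shows "is_model K (T_G p)"
proof -
  have KS: "LG_structure K" using K by (simp add: is_model_def)
  obtain N :: "'a LG_struct" and f where N: "is_model N (T_G p)" and f: "embedding f K N"
    using mc K unfolding model_companion_def by blast
  obtain M :: "'a LG_struct" and h where M: "is_model M T'" "embedding h N M"
    and el: "elementary (\<lambda>x. h (f x)) K M"
    using model_companion_extend[OF mc K N card_of_mono1] f by (metis subset_UNIV)
  note NT = is_model_T_G_imp[OF N]
  interpret N: field N by (rule NT(1))
  interpret GN: additive_subgroup "Gset N" N by (rule NT(2))
  have inj: "a = b" if "f a = f b" "a \<in> carrier K" "b \<in> carrier K" for a b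
    using f that by (auto simp: embedding_def inj_on_def)
  have cl: "\<zero>\<^bsub>K\<^esub> \<in> carrier K" "\<one>\<^bsub>K\<^esub> \<in> carrier K" "x \<in> carrier K \<Longrightarrow> opp K x \<in> carrier K"
    "x \<in> carrier K \<Longrightarrow> y \<in> carrier K \<Longrightarrow> x \<oplus>\<^bsub>K\<^esub> y \<in> carrier K"
    "x \<in> carrier K \<Longrightarrow> y \<in> carrier K \<Longrightarrow> x \<otimes>\<^bsub>K\<^esub> y \<in> carrier K" for x y
    using KS by (auto simp: LG_structure_def)
  have fc: "x \<in> carrier K \<Longrightarrow> f x \<in> carrier N" for x using f by (auto simp: embedding_def)
  have fh: "f \<zero>\<^bsub>K\<^esub> = \<zero>\<^bsub>N\<^esub>" "f \<one>\<^bsub>K\<^esub> = \<one>\<^bsub>N\<^esub>" "x \<in> carrier K \<Longrightarrow> f (opp K x) = \<ominus>\<^bsub>N\<^esub> f x"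
    "x \<in> carrier K \<Longrightarrow> y \<in> carrier K \<Longrightarrow> f (x \<oplus>\<^bsub>K\<^esub> y) = f x \<oplus>\<^bsub>N\<^esub> f y"
    "x \<in> carrier K \<Longrightarrow> y \<in> carrier K \<Longrightarrow> f (x \<otimes>\<^bsub>K\<^esub> y) = f x \<otimes>\<^bsub>N\<^esub> f y"
    "x \<in> carrier K \<Longrightarrow> f x \<in> Gset N \<longleftrightarrow> x \<in> Gset K" for x y
    using f NT(4) fc by (auto simp: embedding_def)
  have grp: "abelian_group K"
  proof (rule abelian_groupI)
    fix x assume x: "x \<in> carrier K"
    have "opp K x \<oplus>\<^bsub>K\<^esub> x = \<zero>\<^bsub>K\<^esub>"
      by (rule inj) (use x in \<open>simp_all add: cl fc fh N.l_neg\<close>)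
    then show "\<exists>y\<in>carrier K. y \<oplus>\<^bsub>K\<^esub> x = \<zero>\<^bsub>K\<^esub>" using cl(3)[OF x] by blast
    show "\<zero>\<^bsub>K\<^esub> \<oplus>\<^bsub>K\<^esub> x = x"
      by (rule inj) (use x in \<open>simp_all add: cl fc fh\<close>)
    fix y assume y: "y \<in> carrier K"
    show "x \<oplus>\<^bsub>K\<^esub> y = y \<oplus>\<^bsub>K\<^esub> x"
      by (rule inj) (use x y in \<open>simp_all add: cl fc fh N.a_comm\<close>)
    fix z assume z: "z \<in> carrier K"
    show "x \<oplus>\<^bsub>K\<^esub> y \<oplus>\<^bsub>K\<^esub> z = x \<oplus>\<^bsub>K\<^esub> (y \<oplus>\<^bsub>K\<^esub> z)"
      by (rule inj) (use x y z in \<open>simp_all add: cl fc fh N.a_assoc\<close>)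
  qed (simp_all add: cl)
  have mon: "Group.comm_monoid K"
  proof (rule comm_monoidI)
    fix x assume x: "x \<in> carrier K"
    show "\<one>\<^bsub>K\<^esub> \<otimes>\<^bsub>K\<^esub> x = x"
      by (rule inj) (use x in \<open>simp_all add: cl fc fh\<close>)
    fix y assume y: "y \<in> carrier K"
    show "x \<otimes>\<^bsub>K\<^esub> y = y \<otimes>\<^bsub>K\<^esub> x"
      by (rule inj) (use x y in \<open>simp_all add: cl fc fh N.m_comm\<close>)
    fix z assume z: "z \<in> carrier K"
    show "x \<otimes>\<^bsub>K\<^esub> y \<otimes>\<^bsub>K\<^esub> z = x \<otimes>\<^bsub>K\<^esub> (y \<otimes>\<^bsub>K\<^esub> z)"
      by (rule inj) (use x y z in \<open>simp_all add: cl fc fh N.m_assoc\<close>)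
  qed (simp_all add: cl)
  have cr: "cring K"
  proof (rule cringI[OF grp mon])
    fix x y z assume xyz: "x \<in> carrier K" "y \<in> carrier K" "z \<in> carrier K"
    show "(x \<oplus>\<^bsub>K\<^esub> y) \<otimes>\<^bsub>K\<^esub> z = x \<otimes>\<^bsub>K\<^esub> z \<oplus>\<^bsub>K\<^esub> y \<otimes>\<^bsub>K\<^esub> z"
      by (rule inj) (use xyz in \<open>simp_all add: cl fc fh N.l_distr\<close>)
  qed
  interpret K: cring K by (rule cr)
  have field: "field K"
  proof (rule K.cring_fieldI2)
    show "\<zero>\<^bsub>K\<^esub> \<noteq> \<one>\<^bsub>K\<^esub>" using fh by auto
    fix a assume a: "a \<in> carrier K" "a \<noteq> \<zero>\<^bsub>K\<^esub>"
    have nz: "f a \<noteq> \<zero>\<^bsub>N\<^esub>" using inj[of a "\<zero>\<^bsub>K\<^esub>"] a cl fh by auto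
    then have u: "f a \<in> Units N" using N.field_Units fc[OF a(1)] by simp
    let ?b = "h (inv\<^bsub>N\<^esub> (f a))" and ?\<phi> = "Ex 1 (Eq (Mul (Var 0) (Var 1)) One)"
    have b: "?b \<in> carrier M" "h (f a) \<otimes>\<^bsub>M\<^esub> ?b = \<one>\<^bsub>M\<^esub>"
    proof -
      show "?b \<in> carrier M" using M(2) u by (auto simp: embedding_def)
      have "h (f a) \<otimes>\<^bsub>M\<^esub> ?b = h (f a \<otimes>\<^bsub>N\<^esub> inv\<^bsub>N\<^esub> (f a))"
        using ring_hom_mult[OF embedding_ring_hom[OF M(2)], of "f a" "inv\<^bsub>N\<^esub> (f a)"] u fc[OF a(1)]
        by simp
      also have "\<dots> = \<one>\<^bsub>M\<^esub>" using u M(2) by (simp add: embedding_def)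
      finally show "h (f a) \<otimes>\<^bsub>M\<^esub> ?b = \<one>\<^bsub>M\<^esub>" .
    qed
    have "sat M ((\<lambda>x. h (f x)) \<circ> (\<lambda>_. a)) ?\<phi>" using b by auto
    moreover have "range (\<lambda>_::nat. a) \<subseteq> carrier K" using a by auto
    ultimately have "sat K (\<lambda>_. a) ?\<phi>" using el unfolding elementary_def by blast
    then show "\<exists>b\<in>carrier K. a \<otimes>\<^bsub>K\<^esub> b = \<one>\<^bsub>K\<^esub>" by auto
  qed
  have opp: "opp K x = \<ominus>\<^bsub>K\<^esub> x" if "x \<in> carrier K" for x
  proof (rule K.minus_equality[symmetric])
    show "opp K x \<oplus>\<^bsub>K\<^esub> x = \<zero>\<^bsub>K\<^esub>"
      by (rule inj) (use that in \<open>simp_all add: cl fc fh N.l_neg\<close>)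
  qed (use that in \<open>simp_all add: cl\<close>)
  show ?thesis
  proof (rule is_model_T_GI[OF field])
    show "\<forall>x\<in>carrier K. opp K x = \<ominus>\<^bsub>K\<^esub> x" using opp by blast
    have Gc: "Gset K \<subseteq> carrier K" using KS by (simp add: LG_structure_def)
    show "additive_subgroup (Gset K) K"
    proof (rule additive_subgroup.intro, rule K.add.subgroupI)
      have "\<zero>\<^bsub>K\<^esub> \<in> Gset K" using fh(6)[of "\<zero>\<^bsub>K\<^esub>"] fh(1) cl GN.zero_closed by simp
      then show "Gset K \<noteq> {}" by blast
      fix a assume a: "a \<in> Gset K"
      then have ac: "a \<in> carrier K" "f a \<in> Gset N" using Gc fh(6)[of a] by auto
      show "\<ominus>\<^bsub>K\<^esub> a \<in> Gset K"
        using fh(6)[of "opp K a"] fh(3)[of a] ac cl GN.a_inv_closed opp[of a] by simp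
      fix b assume b: "b \<in> Gset K"
      then have bc: "b \<in> carrier K" "f b \<in> Gset N" using Gc fh(6)[of b] by auto
      show "a \<oplus>\<^bsub>K\<^esub> b \<in> Gset K"
        using fh(6)[of "a \<oplus>\<^bsub>K\<^esub> b"] fh(4)[of a b] ac bc cl GN.a_closed by simp
    qed (rule Gc)
    have "tval N (\<lambda>i. f \<zero>\<^bsub>K\<^esub>) (nat_term p) = f (tval K (\<lambda>i. \<zero>\<^bsub>K\<^esub>) (nat_term p))"
      by (rule tval_embedding[OF KS f]) (use cl in simp)
    then have "f ([p] \<cdot>\<^bsub>K\<^esub> \<one>\<^bsub>K\<^esub>) = f \<zero>\<^bsub>K\<^esub>" using NT(3) fh(1) by (simp add: tval_nat_term)
    then show "[p] \<cdot>\<^bsub>K\<^esub> \<one>\<^bsub>K\<^esub> = \<zero>\<^bsub>K\<^esub>"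
      by (rule inj) (use tval_closed[OF KS, of "nat_term p" "\<lambda>_. \<zero>\<^bsub>K\<^esub>"] cl in \<open>auto simp: tval_nat_term\<close>)
  qed
qed

section \<open>Extensions and amalgams of models of ACFG\<close>

locale ACFG_model =
  fixes p :: nat and T' :: "LG_form set" and K :: "'a::infinite LG_struct" (structure)
  assumes mc: "model_companion TYPE('a) (T_G p) T'" and model: "is_model K T'"
begin

lemma model_T_G: "is_model K (T_G p)"
  by (rule model_companion_T_G[OF mc model])

lemma struct: "LG_structure K" using model by (simp add: is_model_def)

lemma opp_eq: "x \<in> carrier K \<Longrightarrow> opp K x = \<ominus> x"
  using is_model_T_G_imp(4)[OF model_T_G] by blast

end

sublocale ACFG_model \<subseteq> LG_field K
  by (intro LG_field.intro is_model_T_G_imp(1)[OF model_T_G])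

sublocale ACFG_model \<subseteq> G: additive_subgroup "Gset K" K
  by (rule is_model_T_G_imp(2)[OF model_T_G])

context ACFG_model
begin

text \<open>The set Y holds further elements that the extension has to keep, such as a new root, and
  \<open>meet\<close> also covers the case f = g. The subfield L0 generated by the copies and Y
  replaces L to meet the cardinality bound.\<close>

lemma extend_amalgam:
  fixes L :: "'b ring" and f g Y
  assumes L: "field L" and f: "f \<in> ring_hom K L" and g: "g \<in> ring_hom K L"
    and Y: "finite Y" "Y \<subseteq> carrier L"
    and meet: "\<And>x y. x \<in> carrier K \<Longrightarrow> y \<in> carrier K \<Longrightarrow> f x = g y \<Longrightarrow> x = y"
  obtains M :: "'a LG_struct" and h L0 where "is_model M T'" "subfield L0 L"
    "f ` carrier K \<union> g ` carrier K \<union> Y \<subseteq> L0"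
    "embedding h (LG_of (L\<lparr>carrier := L0\<rparr>) {f x \<oplus>\<^bsub>L\<^esub> g y | x y. x \<in> Gset K \<and> y \<in> Gset K}) M"
    "elementary (\<lambda>x. h (f x)) K M" "elementary (\<lambda>x. h (g x)) K M"
proof -
  interpret L: field L by (rule L)
  interpret f: ring_hom_ring K L f by (rule ring_hom_ringI2[OF ring_axioms L.ring_axioms f])
  interpret g: ring_hom_ring K L g by (rule ring_hom_ringI2[OF ring_axioms L.ring_axioms g])
  let ?Y = "f ` carrier K \<union> g ` carrier K \<union> Y"
  define L0 where "L0 = generate_field L ?Y"
  have Xc: "?Y \<subseteq> carrier L" using Y by auto
  have sf: "subfield L0 L" unfolding L0_def by (rule L.generate_field_is_subfield[OF Xc])
  have incl: "?Y \<subseteq> L0" unfolding L0_def by (auto intro: generate_field.incl)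
  let ?L = "L\<lparr>carrier := L0\<rparr>" and ?H = "{f x \<oplus>\<^bsub>L\<^esub> g y | x y. x \<in> Gset K \<and> y \<in> Gset K}"
  have fL: "field ?L" using L.subfield_iff(2)[OF sf] .
  interpret LL: field ?L by (rule fL)
  have f0: "f \<in> ring_hom K ?L" and g0: "g \<in> ring_hom K ?L"
    using incl by (auto intro!: ring_hom_memI)
  have H: "additive_subgroup ?H ?L"
    using sum_image_additive_subgroup[OF abelian_group_axioms LL.abelian_group_axioms G.additive_subgroup_axioms, of f g]
      incl by (simp add: image_subset_iff)
  have Gc: "x \<in> carrier K" if "x \<in> Gset K" for x using that G.a_subset by blast
  have fH: "f a \<in> ?H \<longleftrightarrow> a \<in> Gset K" if a: "a \<in> carrier K" for a
  proof
    assume "f a \<in> ?H"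
    then obtain x y where xy: "f a = f x \<oplus>\<^bsub>L\<^esub> g y" "x \<in> Gset K" "y \<in> Gset K" by blast
    have xc: "x \<in> carrier K" "y \<in> carrier K" using xy Gc by auto
    then have c: "f x \<in> carrier L" "g y \<in> carrier L" by auto
    have "f (a \<ominus> x) = (f x \<oplus>\<^bsub>L\<^esub> g y) \<ominus>\<^bsub>L\<^esub> f x"
      unfolding xy(1)[symmetric] using a xc by (simp add: a_minus_def)
    also have "\<dots> = g y" using c by algebra
    finally have "f (a \<ominus> x) = g y" .
    then have "a \<ominus> x = y" using meet[of "a \<ominus> x" y] a xy Gc by simp
    moreover have "a = (a \<ominus> x) \<oplus> x" using a xc(1) by algebra
    ultimately have "a = y \<oplus> x" by simp
    then show "a \<in> Gset K" using xy by simp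
  next
    assume "a \<in> Gset K"
    moreover have "f a = f a \<oplus>\<^bsub>L\<^esub> g \<zero>" using a by simp
    ultimately show "f a \<in> ?H" using G.zero_closed by blast
  qed
  have gH: "g a \<in> ?H \<longleftrightarrow> a \<in> Gset K" if a: "a \<in> carrier K" for a
  proof
    assume "g a \<in> ?H"
    then obtain x y where xy: "g a = f x \<oplus>\<^bsub>L\<^esub> g y" "x \<in> Gset K" "y \<in> Gset K" by blast
    have xc: "x \<in> carrier K" "y \<in> carrier K" using xy Gc by auto
    then have c: "f x \<in> carrier L" "g y \<in> carrier L" by auto
    have "g (a \<ominus> y) = (f x \<oplus>\<^bsub>L\<^esub> g y) \<ominus>\<^bsub>L\<^esub> g y"
      unfolding xy(1)[symmetric] using a xc by (simp add: a_minus_def)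
    also have "\<dots> = f x" using c by algebra
    finally have "f x = g (a \<ominus> y)" by simp
    then have "x = a \<ominus> y" using meet[of x "a \<ominus> y"] a xy Gc by simp
    moreover have "a = (a \<ominus> y) \<oplus> y" using a xc(2) by algebra
    ultimately have "a = x \<oplus> y" by simp
    then show "a \<in> Gset K" using xy by simp
  next
    assume "a \<in> Gset K"
    moreover have "g a = f \<zero> \<oplus>\<^bsub>L\<^esub> g a" using a by simp
    ultimately show "g a \<in> ?H" using G.zero_closed by blast
  qed
  have mf: "is_model (LG_of ?L ?H) (T_G p)" "embedding f K (LG_of ?L ?H)"
    by (rule is_model_LG_of[OF model_T_G fL f0 H], rule fH, assumption)+
  have mg: "embedding g K (LG_of ?L ?H)"
    by (rule is_model_LG_of(2)[OF model_T_G fL g0 H], rule gH, assumption)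
  have infU: "infinite (UNIV :: 'a set)" by (rule infinite_UNIV)
  have infF: "infinite (Field |UNIV :: 'a set| )" using infU by simp
  have im: "|k ` carrier K| \<le>o |UNIV :: 'a set|" for k :: "'a \<Rightarrow> 'b"
    using ordLeq_transitive[OF card_of_image card_of_mono1[OF subset_UNIV]] .
  have "|Y| \<le>o |UNIV :: 'a set|" using Y(1) infU by (simp add: finite_ordLess_infinite2 ordLess_imp_ordLeq)
  then have "|?Y| \<le>o |UNIV :: 'a set|"
    by (intro card_of_Un_ordLeq_infinite_Field[OF infF] im card_of_Card_order)
  then have "|L0| \<le>o |UNIV :: 'a set|" unfolding L0_def by (rule card_generate_field[OF infU])
  then have card: "|carrier (LG_of ?L ?H)| \<le>o |UNIV :: 'a set|" by (simp add: LG_of_def)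
  obtain M :: "'a LG_struct" and h where "is_model M T'" "embedding h (LG_of ?L ?H) M"
    and el: "\<And>k. embedding k K (LG_of ?L ?H) \<Longrightarrow> elementary (\<lambda>x. h (k x)) K M"
    by (rule model_companion_extend[OF mc model mf(1) card]) blast
  then show thesis using that[OF _ sf incl _ el[OF mf(2)] el[OF mg]] by blast
qed

text \<open>Both copies are taken to be the same, with a root of q in an algebraic closure as the
  additional element. That q has a root is a single formula, which comes down to K.\<close>

lemma roots_closed_carrier: "roots_closed (carrier K)"
  unfolding roots_closed_def
proof (intro allI impI)
  fix q assume q: "set q \<subseteq> carrier K \<and> 2 \<le> length q \<and> hd q \<noteq> \<zero>"
  obtain L :: "((('a list \<times> nat) multiset) \<Rightarrow> 'a) ring" and f x
    where L: "field L" "f \<in> ring_hom K L" "x \<in> carrier L" "ring.eval L (map f q) x = \<zero>\<^bsub>L\<^esub>"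
    using exists_root_extension[of q] q by blast
  interpret L: field L by (rule L(1))
  have inj: "a = b" if "a \<in> carrier K" "b \<in> carrier K" "f a = f b" for a b
    using field_hom_inj[OF field_axioms L(1,2)] that by (auto simp: inj_on_def)
  obtain M :: "'a LG_struct" and h L0 where M: "is_model M T'" "subfield L0 L"
    "f ` carrier K \<union> f ` carrier K \<union> {x} \<subseteq> L0"
    "embedding h (LG_of (L\<lparr>carrier := L0\<rparr>) {f x \<oplus>\<^bsub>L\<^esub> f y | x y. x \<in> Gset K \<and> y \<in> Gset K}) M"
    "elementary (\<lambda>x. h (f x)) K M"
  proof (rule extend_amalgam[OF L(1,2,2), of "{x}"])
    show "a = b" if "a \<in> carrier K" "b \<in> carrier K" "f a = f b" for a b using inj[OF that] .
  qed (use L(3) that in simp_all)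
  let ?L = "LG_of (L\<lparr>carrier := L0\<rparr>) {f x \<oplus>\<^bsub>L\<^esub> f y | x y. x \<in> Gset K \<and> y \<in> Gset K}"
  have fM: "field M" by (rule is_model_T_G_imp(1)[OF model_companion_T_G[OF mc M(1)]])
  have fL: "field (L\<lparr>carrier := L0\<rparr>)" using L.subfield_iff(2)[OF M(2)] .
  interpret M: field M by (rule fM)
  interpret L0: field "L\<lparr>carrier := L0\<rparr>" by (rule fL)
  interpret h: ring_hom_ring "L\<lparr>carrier := L0\<rparr>" M h
  proof (rule ring_hom_ringI2[OF L0.ring_axioms M.ring_axioms])
    show "h \<in> ring_hom (L\<lparr>carrier := L0\<rparr>) M"
      using embedding_ring_hom[OF M(4)] by (simp add: ring_hom_def LG_of_def)
  qed
  have "L0.eval (map f q) x = \<zero>\<^bsub>L\<^esub>"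
    using L(4) L.eval_consistent[OF subfieldE(1)[OF M(2)]] by simp
  moreover have "h (L0.eval (map f q) x) = M.eval (map h (map f q)) (h x)"
    by (rule h.eval_hom') (use M(3) q in auto)
  ultimately have "M.eval (map h (map f q)) (h x) = \<zero>\<^bsub>M\<^esub>" using h.hom_zero by simp
  then have ev: "M.eval (map (\<lambda>x. h (f x)) q) (h x) = \<zero>\<^bsub>M\<^esub>" by (simp add: comp_def)
  let ?ts = "map (\<lambda>i. Var (Suc i)) [0..<length q]"
  let ?\<phi> = "Ex 0 (Eq (poly_term ?ts (Var 0)) Zero)"
  \<comment> \<open>Position 0 is reserved for the root, so the coefficients start at 1; the
    quantifier overwrites the entry 0.\<close>
  define s where "s = tuple K (\<zero> # q)"
  have s: "s i \<in> carrier K" for i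
    using q by (cases i) (auto simp: s_def tuple_def)
  have sS: "s (Suc i) = q ! i" if "i < length q" for i using that by (simp add: s_def tuple_def)
  have hx: "h x \<in> carrier M" using h.hom_closed[of x] M(3) by simp
  have hf: "h (f a) \<in> carrier M" if "a \<in> carrier K" for a
    using h.hom_closed[of "f a"] M(3) that by auto
  have "sat M ((\<lambda>x. h (f x)) \<circ> s) ?\<phi>"
  proof -
    let ?s = "((\<lambda>x. h (f x)) \<circ> s)(0 := h x)"
    have "tval M ?s (poly_term ?ts (Var 0)) = M.eval (map (tval M ?s) ?ts) (tval M ?s (Var 0))"
      by (rule tval_poly_term[OF fM]) (use hx hf s in auto)
    also have "map (tval M ?s) ?ts = map (\<lambda>i. h (f (q ! i))) [0..<length q]"
      using sS by (simp add: comp_def)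
    also have "\<dots> = map (\<lambda>x. h (f x)) q" by (rule nth_equalityI) auto
    also have "tval M ?s (Var 0) = h x" by simp
    finally have "tval M ?s (poly_term ?ts (Var 0)) = \<zero>\<^bsub>M\<^esub>" unfolding ev .
    then have "sat M ?s (Eq (poly_term ?ts (Var 0)) Zero)" by (simp only: sat.simps tval.simps)
    then show ?thesis unfolding sat.simps(5) using hx by blast
  qed
  moreover have "range s \<subseteq> carrier K" using s by auto
  ultimately have "sat K s ?\<phi>" using M(5) unfolding elementary_def by blast
  then obtain y where y: "y \<in> carrier K" "tval K (s(0 := y)) (poly_term ?ts (Var 0)) = \<zero>"
    unfolding sat.simps tval.simps by blast
  have "tval K (s(0 := y)) (poly_term ?ts (Var 0))
      = eval (map (tval K (s(0 := y))) ?ts) (tval K (s(0 := y)) (Var 0))"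
    by (rule tval_poly_term[OF field_axioms]) (use y s in auto)
  also have "tval K (s(0 := y)) (Var 0) = y" by simp
  also have "map (tval K (s(0 := y))) ?ts = map (\<lambda>i. q ! i) [0..<length q]" using sS by simp
  also have "\<dots> = q" by (rule map_nth)
  finally have "eval q y = \<zero>" unfolding y(2) by simp
  then show "\<exists>x\<in>carrier K. eval q x = \<zero>" using y(1) by blast
qed

text \<open>Makes alg(C) an admissible field F for specializations.\<close>

lemma roots_closed_alg:
  assumes C: "C \<subseteq> carrier K" shows "roots_closed (alg K C)"
  unfolding roots_closed_def
proof (intro allI impI)
  fix q assume q: "set q \<subseteq> alg K C \<and> 2 \<le> length q \<and> hd q \<noteq> \<zero>"
  then have "set q \<subseteq> carrier K" using alg_carrier by blast
  then obtain x where x: "x \<in> carrier K" "eval q x = \<zero>"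
    using roots_closed_carrier q unfolding roots_closed_def by blast
  have "q \<noteq> []" using q by auto
  then have "algebraic (alg K C) x"
    using algebraic_iff[OF subfieldE(1)[OF subfield_alg[OF C]] x(1)] q x by blast
  then show "\<exists>x\<in>alg K C. eval q x = \<zero>" using algebraic_alg_closed[OF C x(1)] x by blast
qed

text \<open>For the last clause, g(b) - f(a) = f(x) + g(y) with x, y in G puts f(x + a) = g(b - y)
  into both copies. So b - y is in alg(C), and w = y - b has b + w = y in G.\<close>

theorem elementary_disjoint_amalgam:
  assumes C: "C \<subseteq> carrier K"
  obtains M :: "'a LG_struct" and f g where "is_model M T'" "elementary f K M" "elementary g K M"
    "\<And>x. x \<in> alg K C \<Longrightarrow> f x = g x"
    "\<And>a b. a \<in> carrier K \<Longrightarrow> b \<in> carrier K \<Longrightarrow> f a = g b \<Longrightarrow> a = b \<and> a \<in> alg K C"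
    "\<And>a b. a \<in> carrier K \<Longrightarrow> b \<in> carrier K \<Longrightarrow> g b \<ominus>\<^bsub>M\<^esub> f a \<in> Gset M \<Longrightarrow>
       \<exists>w\<in>alg K C. b \<oplus> w \<in> Gset K"
proof -
  let ?F = "alg K C"
  obtain L :: "('a set \<Rightarrow> 'a) set ring" and f g
    where L: "field L" "f \<in> ring_hom K L" "g \<in> ring_hom K L" "\<And>x. x \<in> ?F \<Longrightarrow> f x = g x"
    "\<And>a b. a \<in> carrier K \<Longrightarrow> b \<in> carrier K \<Longrightarrow> f a = g b \<Longrightarrow> a = b \<and> a \<in> ?F"
    by (rule exists_disjoint_amalgam[OF subfield_alg[OF C] roots_closed_alg[OF C]]) (rule that, assumption+)
  interpret L: field L by (rule L(1))
  interpret f: ring_hom_ring K L f by (rule ring_hom_ringI2[OF ring_axioms L.ring_axioms L(2)])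
  interpret g: ring_hom_ring K L g by (rule ring_hom_ringI2[OF ring_axioms L.ring_axioms L(3)])
  let ?H = "{f x \<oplus>\<^bsub>L\<^esub> g y | x y. x \<in> Gset K \<and> y \<in> Gset K}"
  obtain M :: "'a LG_struct" and h L0 where M: "is_model M T'" "subfield L0 L"
    "f ` carrier K \<union> g ` carrier K \<union> {} \<subseteq> L0"
    and h: "embedding h (LG_of (L\<lparr>carrier := L0\<rparr>) ?H) M"
    and el: "elementary (\<lambda>x. h (f x)) K M" "elementary (\<lambda>x. h (g x)) K M"
  proof (rule extend_amalgam[OF L(1-3), of "{}"])
    show "a = b" if "a \<in> carrier K" "b \<in> carrier K" "f a = g b" for a b using L(5)[OF that] by simp
  qed (use that in simp_all)
  let ?L = "LG_of (L\<lparr>carrier := L0\<rparr>) ?H"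
  have MT: "is_model M (T_G p)" by (rule model_companion_T_G[OF mc M(1)])
  interpret M: field M by (rule is_model_T_G_imp(1)[OF MT])
  have cL: "carrier ?L = L0" by (simp add: LG_of_def)
  have fg: "f a \<in> L0" "g a \<in> L0" if "a \<in> carrier K" for a using M(3) that by auto
  have hinj: "x = y" if "h x = h y" "x \<in> L0" "y \<in> L0" for x y
    using h that unfolding embedding_def inj_on_def cL by blast
  show thesis
  proof (rule that[OF M(1) el])
    show "h (f x) = h (g x)" if "x \<in> ?F" for x using L(4)[OF that] by simp
  next
    fix a b assume ab: "a \<in> carrier K" "b \<in> carrier K" "h (f a) = h (g b)"
    then show "a = b \<and> a \<in> ?F" using L(5)[OF ab(1,2)] hinj fg by blast
  next
    fix a b assume ab: "a \<in> carrier K" "b \<in> carrier K" "h (g b) \<ominus>\<^bsub>M\<^esub> h (f a) \<in> Gset M"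
    have hc: "h x \<in> carrier M" if "x \<in> L0" for x using h that unfolding embedding_def cL by blast
    have hadd: "h (x \<oplus>\<^bsub>L\<^esub> y) = h x \<oplus>\<^bsub>M\<^esub> h y" if "x \<in> L0" "y \<in> L0" for x y
      using h that unfolding embedding_def cL by (simp add: LG_of_def)
    define m where "m = f (\<ominus> a)"
    have mL: "m = \<ominus>\<^bsub>L\<^esub> f a" using ab by (simp add: m_def)
    have fm: "m \<in> L0" unfolding m_def by (rule fg(1)) (use ab in simp)
    have "h (m) \<oplus>\<^bsub>M\<^esub> h (f a) = h \<zero>\<^bsub>L\<^esub>"
      using hadd[OF fm fg(1)[OF ab(1)]] ab by (simp add: mL L.l_neg)
    also have "h \<zero>\<^bsub>L\<^esub> = \<zero>\<^bsub>M\<^esub>" using h by (simp add: embedding_def LG_of_def)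
    finally have "h (m) = \<ominus>\<^bsub>M\<^esub> h (f a)"
      using M.minus_equality[of "h (m)" "h (f a)"] hc fm fg ab by simp
    then have "h (g b \<oplus>\<^bsub>L\<^esub> m) \<in> Gset M"
      using ab hadd[OF fg(2)[OF ab(2)] fm] by (simp add: a_minus_def)
    moreover have "g b \<oplus>\<^bsub>L\<^esub> m \<in> L0"
      using fg(2)[OF ab(2)] fm subringE(7)[OF subfieldE(1)[OF M(2)]] by blast
    ultimately have "g b \<oplus>\<^bsub>L\<^esub> m \<in> ?H"
      using h unfolding embedding_def cL by (simp add: LG_of_def)
    then obtain x y where xy: "g b \<oplus>\<^bsub>L\<^esub> m = f x \<oplus>\<^bsub>L\<^esub> g y" "x \<in> Gset K" "y \<in> Gset K" by blast
    have xyc: "x \<in> carrier K" "y \<in> carrier K" using xy G.a_subset by auto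
    have c: "g b \<in> carrier L" "f a \<in> carrier L" "f x \<in> carrier L" "g y \<in> carrier L"
      using ab xyc by auto
    have "g b \<ominus>\<^bsub>L\<^esub> f a = f x \<oplus>\<^bsub>L\<^esub> g y" using xy(1) by (simp add: a_minus_def mL)
    moreover have "f x \<oplus>\<^bsub>L\<^esub> f a = (f x \<oplus>\<^bsub>L\<^esub> g y) \<oplus>\<^bsub>L\<^esub> f a \<ominus>\<^bsub>L\<^esub> g y" using c by algebra
    moreover have "(g b \<ominus>\<^bsub>L\<^esub> f a) \<oplus>\<^bsub>L\<^esub> f a \<ominus>\<^bsub>L\<^esub> g y = g b \<ominus>\<^bsub>L\<^esub> g y" using c by algebra
    ultimately have "f x \<oplus>\<^bsub>L\<^esub> f a = g b \<ominus>\<^bsub>L\<^esub> g y" by simp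
    then have "f (x \<oplus> a) = g (b \<ominus> y)" using ab xyc by (simp add: a_minus_def)
    moreover have "x \<oplus> a \<in> carrier K" "b \<ominus> y \<in> carrier K" using ab xyc by auto
    ultimately have "x \<oplus> a = b \<ominus> y \<and> x \<oplus> a \<in> ?F" using L(5) by blast
    then have w: "b \<ominus> y \<in> ?F" by metis
    then have "\<ominus> (b \<ominus> y) \<in> ?F" using subringE(5)[OF subfieldE(1)[OF subfield_alg[OF C]]] by blast
    moreover have "b \<oplus> (\<ominus> (b \<ominus> y)) = y" using ab xyc by algebra
    ultimately show "\<exists>w\<in>?F. b \<oplus> w \<in> Gset K" using xy by (intro bexI[of _ "\<ominus> (b \<ominus> y)"]) auto
  qed
qed

end

section \<open>Model-theoretic and field-theoretic algebraic closure\<close>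

lemma tuple_closed:
  "set xs \<subseteq> carrier M \<Longrightarrow> \<zero>\<^bsub>M\<^esub> \<in> carrier M \<Longrightarrow> tuple M xs i \<in> carrier M"
  using nth_mem[of i xs] by (auto simp: tuple_def simp del: nth_mem)

context ACFG_model
begin

lemma tval_generate_field:
  assumes A: "A \<subseteq> carrier K" and "\<And>i. i \<in> term_vars t \<Longrightarrow> s i \<in> A"
  shows "tval K s t \<in> generate_field K A"
  using assms(2)
proof (induction t)
  case (Opp t)
  then have "tval K s t \<in> generate_field K A" by simp
  moreover from this have "tval K s t \<in> carrier K" using generate_field_in_carrier[OF A] by blast
  ultimately show ?case using generate_field.a_inv opp_eq by fastforce
qed (auto intro: generate_field.intros zero_in_generate)

text \<open>The subring generated by A, presented by terms, since a formula needs its coefficients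
  as terms in variables.\<close>

definition term_values :: "'a set \<Rightarrow> 'a set" where
  "term_values A = {tval K s t | s t. \<forall>i\<in>term_vars t. s i \<in> A}"

lemma term_values_list:
  assumes "set q \<subseteq> term_values A"
  shows "\<exists>ts s. (\<forall>t\<in>set ts. \<forall>i\<in>term_vars t. s i \<in> A) \<and> map (tval K s) ts = q"
  using assms
proof (induction q)
  case (Cons a q)
  then obtain ts s2 where 2: "\<forall>t\<in>set ts. \<forall>i\<in>term_vars t. s2 i \<in> A" "map (tval K s2) ts = q" by auto
  obtain t1 s1 where 1: "\<forall>i\<in>term_vars t1. s1 i \<in> A" "a = tval K s1 t1"
    using Cons.prems by (auto simp: term_values_def)
  \<comment> \<open>The two assignments are interleaved on even and odd variables, so that one
    assignment serves all terms.\<close>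
  let ?s = "\<lambda>i. if even i then s1 (i div 2) else s2 (i div 2)"
  let ?ts = "term_rename (\<lambda>i. 2 * i) t1 # map (term_rename (\<lambda>i. 2 * i + 1)) ts"
  have "map (tval K ?s) ?ts = a # q" using 1 2 by (simp add: comp_def)
  moreover have "\<forall>t\<in>set ?ts. \<forall>i\<in>term_vars t. ?s i \<in> A" using 1 2 by auto
  ultimately show ?case by (intro exI[of _ ?ts] exI[of _ ?s] conjI)
qed simp

lemma ring_closed_term_values:
  assumes A: "A \<subseteq> carrier K" shows "ring_closed (term_values A)"
  unfolding ring_closed_def
proof (intro conjI ballI)
  show sub: "term_values A \<subseteq> carrier K"
    using tval_generate_field[OF A] generate_field_in_carrier[OF A] by (auto simp: term_values_def)
  have "tval K (\<lambda>_. \<zero>) One \<in> term_values A" unfolding term_values_def by fastforce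
  then show "\<one> \<in> term_values A" by simp
  fix x assume x: "x \<in> term_values A"
  then obtain s t where st: "x = tval K s t" "\<forall>i\<in>term_vars t. s i \<in> A" by (auto simp: term_values_def)
  have "tval K s (Opp t) \<in> term_values A" unfolding term_values_def using st by fastforce
  then show "\<ominus> x \<in> term_values A" using st x sub opp_eq by auto
  fix y assume y: "y \<in> term_values A"
  then have "set [x, y] \<subseteq> term_values A" using x by simp
  from term_values_list[OF this]
  obtain ts s where ts: "\<forall>t\<in>set ts. \<forall>i\<in>term_vars t. s i \<in> A" "map (tval K s) ts = [x, y]"
    by (elim exE conjE) (rule that)
  then obtain t u where "ts = [t, u]" by (cases ts; cases "tl ts"; auto)
  then have tu: "tval K s t = x" "tval K s u = y" "\<forall>i\<in>term_vars t. s i \<in> A" "\<forall>i\<in>term_vars u. s i \<in> A"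
    using ts by auto
  have "tval K s (Add t u) \<in> term_values A" "tval K s (Mul t u) \<in> term_values A"
    unfolding term_values_def using tu by fastforce+
  then show "x \<oplus> y \<in> term_values A" "x \<otimes> y \<in> term_values A" using tu by auto
qed

text \<open>Algebraicity in the form that a formula can express: the coefficients are values of
  terms at elements of A, under one assignment for all of them.\<close>

lemma alg_poly:
  assumes A: "A \<subseteq> carrier K" and x: "x \<in> alg K A"
  obtains ts s where "\<And>t i. t \<in> set ts \<Longrightarrow> i \<in> term_vars t \<Longrightarrow> s i \<in> A" "ts \<noteq> []"
    "tval K s (hd ts) \<noteq> \<zero>" "eval (map (tval K s) ts) x = \<zero>"
proof -
  have "A \<subseteq> term_values A"
  proof
    fix a assume "a \<in> A"
    then have "tval K (\<lambda>_. a) (Var 0) \<in> term_values A" unfolding term_values_def by fastforce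
    then show "a \<in> term_values A" by simp
  qed
  moreover have "x \<in> carrier K" "algebraic (generate_field K A) x" using x by (auto simp: alg_iff)
  ultimately obtain q where q: "set q \<subseteq> term_values A" "q \<noteq> []" "hd q \<noteq> \<zero>" "eval q x = \<zero>"
    using algebraic_ring_coeffs[OF ring_closed_term_values[OF A]] by blast
  obtain ts s where ts: "\<forall>t\<in>set ts. \<forall>i\<in>term_vars t. s i \<in> A" "map (tval K s) ts = q"
    using term_values_list[OF q(1)] by (elim exE conjE) (rule that)
  then have "ts \<noteq> []" using q by auto
  then have "tval K s (hd ts) \<noteq> \<zero>" using q ts hd_map[of ts "tval K s"] by simp
  then show thesis using that[of ts s] ts q \<open>ts \<noteq> []\<close> by auto
qed

lemma alg_polyI:
  assumes A: "A \<subseteq> carrier K" and ts: "\<And>t i. t \<in> set ts \<Longrightarrow> i \<in> term_vars t \<Longrightarrow> s i \<in> A"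
    and "ts \<noteq> []" "tval K s (hd ts) \<noteq> \<zero>" "x \<in> carrier K" "eval (map (tval K s) ts) x = \<zero>"
  shows "x \<in> alg K A"
proof -
  have "set (map (tval K s) ts) \<subseteq> generate_field K A"
    using tval_generate_field[OF A ts] by auto
  moreover have "hd (map (tval K s) ts) \<noteq> \<zero>" using assms by (simp add: hd_map)
  moreover have "map (tval K s) ts \<noteq> []" using assms by simp
  ultimately have "algebraic (generate_field K A) x"
    using algebraic_iff[OF subfieldE(1)[OF generate_field_is_subfield[OF A]], of x] assms(5,6) by blast
  then show ?thesis using assms(5) by (simp add: alg_iff)
qed

lemma finite_eval_roots:
  assumes "\<And>i. s i \<in> carrier K" "ts \<noteq> []" "tval K s (hd ts) \<noteq> \<zero>"
  shows "finite {x \<in> carrier K. eval (map (tval K s) ts) x = \<zero>}"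
    "card {x \<in> carrier K. eval (map (tval K s) ts) x = \<zero>} \<le> length ts"
proof -
  have "set (map (tval K s) ts) \<subseteq> carrier K" using tval_closed[OF struct] assms by auto
  moreover have "hd (map (tval K s) ts) \<noteq> \<zero>" using assms by (simp add: hd_map)
  ultimately show "finite {x \<in> carrier K. eval (map (tval K s) ts) x = \<zero>}"
    "card {x \<in> carrier K. eval (map (tval K s) ts) x = \<zero>} \<le> length ts"
    using finite_roots[of "map (tval K s) ts"] assms by auto
qed

lemma nth_position:
  assumes "x \<in> set xs" shows "\<exists>j < length xs. xs ! j = x"
  using assms by (auto simp: in_set_conv_nth)

lemma alg_sub_acl:
  assumes A: "A \<subseteq> carrier K" shows "alg K A \<subseteq> acl K A"
proof
  fix x assume x: "x \<in> alg K A"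
  then have xc: "x \<in> carrier K" using alg_carrier by blast
  obtain ts s where ts: "\<And>t i. t \<in> set ts \<Longrightarrow> i \<in> term_vars t \<Longrightarrow> s i \<in> A" "ts \<noteq> []"
    "tval K s (hd ts) \<noteq> \<zero>" "eval (map (tval K s) ts) x = \<zero>"
    by (rule alg_poly[OF A x]) blast
  let ?V = "\<Union>t\<in>set ts. term_vars t"
  obtain cs where cs: "set cs = s ` ?V" using finite_list[of "s ` ?V"] by auto
  have csA: "set cs \<subseteq> A" using cs ts by auto
  have "\<exists>j. i \<in> ?V \<longrightarrow> j < length cs \<and> cs ! j = s i" for i
    using nth_position[of "s i" cs] cs by auto
  \<comment> \<open>\<rho> gives the position of each value among the parameters; it is shifted by
    one below because variable 0 stands for the root.\<close>
  then obtain \<rho> where \<rho>: "\<And>i. i \<in> ?V \<Longrightarrow> \<rho> i < length cs \<and> cs ! \<rho> i = s i" by metis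
  let ?ts = "map (term_rename (\<lambda>i. Suc (\<rho> i))) ts"
  let ?\<Phi> = "(Eq (poly_term ?ts (Var 0)) Zero, cs)"
  have fo: "?\<Phi> \<in> formulas_over 1 A"
  proof -
    have "term_vars (poly_term ?ts (Var 0)) \<subseteq> {..<1 + length cs}"
      using term_vars_poly_term[of ?ts "Var 0"] \<rho> by fastforce
    then show ?thesis using csA by (simp add: formulas_over_def)
  qed
  have tv: "tval K (tuple K ([y] @ cs)) (term_rename (\<lambda>i. Suc (\<rho> i)) t) = tval K s t" if "t \<in> set ts" for t y
    unfolding tval_rename by (rule tval_cong) (use that \<rho> in \<open>auto simp: tuple_def\<close>)
  have h: "holds K [y] ?\<Phi> \<longleftrightarrow> eval (map (tval K s) ts) y = \<zero>" if y: "y \<in> carrier K" for y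
  proof -
    let ?s = "tuple K ([y] @ cs)"
    have "?s i \<in> carrier K" for i by (rule tuple_closed) (use y csA A in auto)
    then have "tval K ?s (poly_term ?ts (Var 0)) = eval (map (tval K ?s) ?ts) (tval K ?s (Var 0))"
      by (intro tval_poly_term[OF field_axioms] tval_closed[OF struct]) auto
    also have "tval K ?s (Var 0) = y" by (simp add: tuple_def)
    also have "map (tval K ?s) ?ts = map (tval K s) ts" using tv by simp
    finally show ?thesis by (simp add: holds_def)
  qed
  have sA: "tval K s t \<in> carrier K" if "t \<in> set ts" for t
    using ts(1)[OF that] A by (intro tval_closed[OF struct]) blast
  have "finite {y \<in> carrier K. eval (map (tval K s) ts) y = \<zero>}"
    by (rule finite_roots) (use sA ts in \<open>auto simp: hd_map\<close>)
  then have "finite {y \<in> carrier K. holds K [y] ?\<Phi>}"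
    using h by (elim finite_subset[rotated]) auto
  moreover have "holds K [x] ?\<Phi>" using h[OF xc] ts by simp
  ultimately show "x \<in> acl K A" unfolding acl_def using fo xc by blast
qed

text \<open>f and g agree on the parameters, so g(x) solves the same formula in M. Its finitely many
  solutions all lie in f(K); thus g(x) is in both copies, and x is in alg(A).\<close>

lemma acl_sub_alg:
  assumes A: "A \<subseteq> carrier K" shows "acl K A \<subseteq> alg K A"
proof
  fix x assume "x \<in> acl K A"
  then obtain \<Phi> where x: "x \<in> carrier K" and \<Phi>: "\<Phi> \<in> formulas_over 1 A" "holds K [x] \<Phi>"
    "finite {y \<in> carrier K. holds K [y] \<Phi>}" by (auto simp: acl_def)
  obtain M :: "'a LG_struct" and f g where M: "is_model M T'" "elementary f K M" "elementary g K M"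
    and eq: "\<And>x. x \<in> alg K A \<Longrightarrow> f x = g x"
    and disj: "\<And>a b. a \<in> carrier K \<Longrightarrow> b \<in> carrier K \<Longrightarrow> f a = g b \<Longrightarrow> a = b \<and> a \<in> alg K A"
    by (rule elementary_disjoint_amalgam[OF A]) blast
  have \<Phi>K: "\<Phi> \<in> formulas_over 1 (carrier K)" using \<Phi>(1) A by (auto simp: formulas_over_def)
  have fg: "f a = g a" if "a \<in> A" for a using eq alg_extensive[OF A] that by blast
  have "map_params f \<Phi> = map_params g \<Phi>"
    using \<Phi>(1) fg by (auto simp: map_params_def formulas_over_def subset_iff)
  moreover have "holds M (map g [x]) (map_params g \<Phi>)"
    using elementary_holds[OF M(3), of "[x]" \<Phi>] x \<Phi> \<Phi>K by simp
  ultimately have "holds M [g x] (map_params f \<Phi>)" by simp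
  moreover have "g x \<in> carrier M" using M(3) x by (auto simp: elementary_def)
  ultimately have "g x \<in> f ` {y \<in> carrier K. holds K [y] \<Phi>}"
    using elementary_finite_set[OF M(2) zero_closed \<Phi>K \<Phi>(3)] by blast
  then obtain a where "a \<in> carrier K" "f a = g x" by auto
  then show "x \<in> alg K A" using disj[of a x] x by auto
qed

theorem acl_eq_alg: "A \<subseteq> carrier K \<Longrightarrow> acl K A = alg K A"
  using alg_sub_acl acl_sub_alg by blast

end

section \<open>Dividing\<close>

text \<open>
  The two subgroups to which the argument applies: the trivial one yields algebraic
  independence, the predicate G yields the second clause of Kim-independence.
\<close>

definition Hset :: "bool \<Rightarrow> 'a LG_struct \<Rightarrow> 'a set" where
  "Hset z M = (if z then {\<zero>\<^bsub>M\<^esub>} else Gset M)"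

definition inH :: "bool \<Rightarrow> LG_term \<Rightarrow> LG_form" where
  "inH z t = (if z then Eq t Zero else InG t)"

lemma sat_inH [simp]: "sat M s (inH z t) \<longleftrightarrow> tval M s t \<in> Hset z M"
  by (simp add: inH_def Hset_def)

lemma free_vars_inH [simp]: "free_vars (inH z t) = term_vars t"
  by (simp add: inH_def)

text \<open>
  In the application the roots w of the polynomials \<open>uss\<close> include one element of acl(C) with
  \<open>x + w \<in> H\<close> for each root x of \<open>ts\<close> that has such an element. A far root is then a
  root outside of H + acl(C), a condition that is not first-order by itself.
\<close>

definition far_root :: "bool \<Rightarrow> 'a LG_struct \<Rightarrow> (nat \<Rightarrow> 'a) \<Rightarrow> LG_term list \<Rightarrow> LG_term list list \<Rightarrow> 'a \<Rightarrow> bool" where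
  "far_root z M s ts uss x \<longleftrightarrow> tval M s (hd ts) \<noteq> \<zero>\<^bsub>M\<^esub> \<and> ring.eval M (map (tval M s) ts) x = \<zero>\<^bsub>M\<^esub> \<and>
     (\<forall>us\<in>set uss. \<forall>w\<in>carrier M. ring.eval M (map (tval M s) us) w = \<zero>\<^bsub>M\<^esub> \<longrightarrow> x \<oplus>\<^bsub>M\<^esub> w \<notin> Hset z M)"

text \<open>Variable v stands for the candidate root and w for the witness, so w has to be fresh for
  the coefficient terms.\<close>

definition far_root_form :: "bool \<Rightarrow> LG_term list \<Rightarrow> LG_term list list \<Rightarrow> nat \<Rightarrow> nat \<Rightarrow> LG_form" where
  "far_root_form z ts uss v w = conjs (Not (Eq (hd ts) Zero) # Eq (poly_term ts (Var v)) Zero #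
     map (\<lambda>us. Not (Ex w (And (Eq (poly_term us (Var w)) Zero) (inH z (Add (Var v) (Var w)))))) uss)"

lemma sat_far_root_form:
  assumes M: "is_model M (T_G p)" and s: "\<And>i. s i \<in> carrier M" and vw: "v \<noteq> w"
    and w: "\<And>us t. us \<in> set uss \<Longrightarrow> t \<in> set us \<Longrightarrow> w \<notin> term_vars t"
  shows "sat M s (far_root_form z ts uss v w) \<longleftrightarrow> far_root z M s ts uss (s v)"
proof -
  have F: "field M" by (rule is_model_T_G_imp(1)[OF M])
  have S: "LG_structure M" using M by (simp add: is_model_def)
  have 1: "tval M s (poly_term ts (Var v)) = ring.eval M (map (tval M s) ts) (s v)"
    using tval_poly_term[OF F, of ts s "Var v"] tval_closed[OF S, of _ s] s by simp
  have 2: "tval M (s(w := x)) (poly_term us (Var w)) = ring.eval M (map (tval M s) us) x"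
    if us: "us \<in> set uss" and x: "x \<in> carrier M" for us x
  proof -
    let ?s = "s(w := x)"
    have "tval M ?s (poly_term us (Var w)) = ring.eval M (map (tval M ?s) us) (tval M ?s (Var w))"
      by (intro tval_poly_term[OF F] tval_closed[OF S]) (use s x in auto)
    also have "map (tval M ?s) us = map (tval M s) us"
      by (rule map_cong[OF refl], rule tval_cong) (use w[OF us] in auto)
    also have "tval M ?s (Var w) = x" by simp
    finally show ?thesis .
  qed
  show ?thesis using vw
    by (auto simp: far_root_form_def far_root_def 1 2)
qed

lemma far_root_rename:
  assumes "ts \<noteq> []"
  shows "far_root z M s (map (term_rename r) ts) (map (map (term_rename r)) uss) x \<longleftrightarrow>
    far_root z M (\<lambda>i. s (r i)) ts uss x"
  using assms by (simp add: far_root_def hd_map comp_def)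

lemma far_root_cong:
  assumes "ts \<noteq> []" "\<And>t i. t \<in> set ts \<Longrightarrow> i \<in> term_vars t \<Longrightarrow> s i = s' i"
    "\<And>us t i. us \<in> set uss \<Longrightarrow> t \<in> set us \<Longrightarrow> i \<in> term_vars t \<Longrightarrow> s i = s' i"
  shows "far_root z M s ts uss x \<longleftrightarrow> far_root z M s' ts uss x"
proof -
  have 1: "map (tval M s) ts = map (tval M s') ts"
    by (rule map_cong[OF refl], rule tval_cong) (rule assms(2))
  have 2: "map (tval M s) us = map (tval M s') us" if "us \<in> set uss" for us
    by (rule map_cong[OF refl], rule tval_cong) (rule assms(3)[OF that])
  have 3: "tval M s (hd ts) = tval M s' (hd ts)"
    by (rule tval_cong) (use assms(1,2) hd_in_set in blast)
  show ?thesis unfolding far_root_def 1 3 by (simp only: 2 cong: ball_cong)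
qed

lemma free_vars_far_root_form:
  assumes "ts \<noteq> []" "\<And>t. t \<in> set ts \<Longrightarrow> term_vars t \<subseteq> V"
    "\<And>us t. us \<in> set uss \<Longrightarrow> t \<in> set us \<Longrightarrow> term_vars t \<subseteq> V"
  shows "free_vars (far_root_form z ts uss v w) \<subseteq> insert v V"
proof -
  have 1: "term_vars (hd ts) \<subseteq> V" using assms(1,2) by simp
  have 2: "term_vars (poly_term ts (Var v)) \<subseteq> insert v V"
  proof -
    have "(\<Union>t\<in>set ts. term_vars t) \<subseteq> V" using assms(2) by (rule UN_least)
    then show ?thesis using term_vars_poly_term[of ts "Var v"] by simp blast
  qed
  have 3: "term_vars (poly_term us (Var w)) \<subseteq> insert w V" if "us \<in> set uss" for us
  proof -
    have "(\<Union>t\<in>set us. term_vars t) \<subseteq> V" using assms(3)[OF that] by (rule UN_least)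
    then show ?thesis using term_vars_poly_term[of us "Var w"] by simp blast
  qed
  have 4: "free_vars (Not (Ex w (And (Eq (poly_term us (Var w)) Zero) (inH z (Add (Var v) (Var w)))))) \<subseteq> insert v V"
    if "us \<in> set uss" for us
    using 3[OF that] by auto
  have "(\<Union>us\<in>set uss. free_vars (Not (Ex w (And (Eq (poly_term us (Var w)) Zero) (inH z (Add (Var v) (Var w))))))) \<subseteq> insert v V"
    using 4 by (rule UN_least)
  then show ?thesis using 1 2 by (auto simp: far_root_form_def)
qed

text \<open>A nonzero leading coefficient is part of \<open>far_root\<close>, so finiteness holds at
  every assignment in K: a degenerate polynomial has no far roots.\<close>

lemma (in ACFG_model) finite_far_roots:
  assumes "\<And>i. s i \<in> carrier K" "ts \<noteq> []"
  shows "finite {x \<in> carrier K. far_root z K s ts uss x}"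
proof (cases "tval K s (hd ts) = \<zero>")
  case False
  show ?thesis
    by (rule finite_subset[OF _ finite_eval_roots(1)[OF assms False]]) (auto simp: far_root_def)
qed (simp add: far_root_def)

lemma tval_opp_Add:
  assumes "is_model M (T_G p)" "s x \<in> carrier M" "s y \<in> carrier M"
  shows "tval M s (Add (Var x) (Opp (Var y))) = s x \<ominus>\<^bsub>M\<^esub> s y"
  using is_model_T_G_imp(4)[OF assms(1)] assms(3) by (simp add: a_minus_def)

section \<open>Far conjugates and dividing\<close>

context ACFG_model
begin

text \<open>In the amalgam M over C the tuple g(bs) behaves as desired over f(K): its far roots are
  images under g of far roots over bs, and g(a) is congruent to an element of f(K) only if a is
  congruent to an element of alg(C). Finite parts of this description come down to K along f, and
  saturation realizes all of it.\<close>

lemma exists_far_conjugate: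
  fixes \<kappa> :: "'c rel"
  assumes \<kappa>: "Card_order \<kappa>" "natLeq <o \<kappa>" "saturated \<kappa> K"
    and C: "C \<subseteq> carrier K" "|C| <o \<kappa>" and bs: "set bs \<subseteq> carrier K"
    and ts: "ts \<noteq> []" "\<And>t. t \<in> set ts \<Longrightarrow> term_vars t \<subseteq> {..<length bs}"
    and uss: "\<And>us t. us \<in> set uss \<Longrightarrow> t \<in> set us \<Longrightarrow> term_vars t \<subseteq> {..<length bs}"
    and far: "\<And>x w. x \<in> carrier K \<Longrightarrow> far_root z K (tuple K bs) ts uss x \<Longrightarrow> w \<in> alg K C \<Longrightarrow> x \<oplus> w \<notin> Hset z K"
    and Y: "finite Y" "Y \<subseteq> carrier K"
  obtains b where "length b = length bs" "set b \<subseteq> carrier K" "tp K b C = tp K bs C"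
    "\<And>x y. x \<in> carrier K \<Longrightarrow> far_root z K (tuple K b) ts uss x \<Longrightarrow> y \<in> Y \<Longrightarrow> x \<ominus> y \<notin> Hset z K"
proof -
  let ?m = "length bs"
  obtain M :: "'a LG_struct" and f g where M: "is_model M T'" and el: "elementary f K M" "elementary g K M"
    and fg: "\<And>x. x \<in> alg K C \<Longrightarrow> f x = g x"
    and disj: "\<And>a b. a \<in> carrier K \<Longrightarrow> b \<in> carrier K \<Longrightarrow> f a = g b \<Longrightarrow> a = b \<and> a \<in> alg K C"
    and Gdisj: "\<And>a b. a \<in> carrier K \<Longrightarrow> b \<in> carrier K \<Longrightarrow> g b \<ominus>\<^bsub>M\<^esub> f a \<in> Gset M \<Longrightarrow>
       \<exists>w\<in>alg K C. b \<oplus> w \<in> Gset K"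
    by (rule elementary_disjoint_amalgam[OF C(1)]) (rule that, assumption+)
  have MT: "is_model M (T_G p)" by (rule model_companion_T_G[OF mc M])
  interpret M: field M by (rule is_model_T_G_imp(1)[OF MT])
  have fc: "f x \<in> carrier M" "g x \<in> carrier M" if "x \<in> carrier K" for x
    using el that by (auto simp: elementary_def)
  obtain ys where ys: "set ys = Y" using finite_list[OF Y(1)] by blast
  let ?l = "length ys"
  let ?X = "?m + ?l"
  \<comment> \<open>No far root over b is congruent to an element of Y. The variables stand for b,
    the elements of Y, the root \<open>?X\<close>, and the bound witness \<open>Suc ?X\<close>, in
    this order.\<close>
  define \<psi> where "\<psi> = Not (Ex ?X (And (far_root_form z ts uss ?X (Suc ?X))
    (Not (conjs (map (\<lambda>i. Not (inH z (Add (Var ?X) (Opp (Var (?m + i)))))) [0..<?l])))))"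
  have fvf: "free_vars (far_root_form z ts uss ?X (Suc ?X)) \<subseteq> insert ?X {..<?m}"
    by (rule free_vars_far_root_form[OF ts uss])
  have \<psi>fo: "(\<psi>, ys) \<in> formulas_over ?m (C \<union> Y)"
    using ys fvf by (force simp: formulas_over_def \<psi>_def)
  have \<psi>holds: "holds N b (\<psi>, vs) \<longleftrightarrow>
      (\<forall>x\<in>carrier N. far_root z N (tuple N b) ts uss x \<longrightarrow> (\<forall>y\<in>set vs. x \<ominus>\<^bsub>N\<^esub> y \<notin> Hset z N))"
    if N: "is_model N (T_G p)" and b: "length b = ?m" "set b \<subseteq> carrier N"
      and vs: "length vs = ?l" "set vs \<subseteq> carrier N" for N :: "'a LG_struct" and b vs
  proof -
    interpret N: field N by (rule is_model_T_G_imp(1)[OF N])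
    let ?s = "tuple N (b @ vs)"
    have sc: "?s i \<in> carrier N" for i by (rule tuple_closed) (use b vs in auto)
    have 1: "sat N (?s(?X := x)) (far_root_form z ts uss ?X (Suc ?X)) \<longleftrightarrow> far_root z N (tuple N b) ts uss x"
      if x: "x \<in> carrier N" for x
    proof -
      have "sat N (?s(?X := x)) (far_root_form z ts uss ?X (Suc ?X)) \<longleftrightarrow>
          far_root z N (?s(?X := x)) ts uss ((?s(?X := x)) ?X)"
      proof (rule sat_far_root_form[OF N])
        show "Suc ?X \<notin> term_vars t" if "us \<in> set uss" "t \<in> set us" for us t
          using uss[OF that] by auto
      qed (use sc x in auto)
      also have "(?s(?X := x)) ?X = x" by simp
      also have "far_root z N (?s(?X := x)) ts uss x \<longleftrightarrow> far_root z N (tuple N b) ts uss x"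
      proof (rule far_root_cong[OF ts(1)])
        show "(?s(?X := x)) i = tuple N b i" if "t \<in> set ts" "i \<in> term_vars t" for t i
        proof -
          have "i < ?m" using ts(2)[OF that(1)] that(2) by auto
          then show ?thesis using b by (simp add: tuple_def nth_append)
        qed
        show "(?s(?X := x)) i = tuple N b i" if "us \<in> set uss" "t \<in> set us" "i \<in> term_vars t" for us t i
        proof -
          have "i < ?m" using uss[OF that(1,2)] that(3) by auto
          then show ?thesis using b by (simp add: tuple_def nth_append)
        qed
      qed
      finally show ?thesis .
    qed
    have 2: "tval N (?s(?X := x)) (Add (Var ?X) (Opp (Var (?m + i)))) = x \<ominus>\<^bsub>N\<^esub> vs ! i"
      if x: "x \<in> carrier N" and i: "i < ?l" for x i
    proof -
      have "(?s(?X := x)) (?m + i) = vs ! i"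
        using i b vs by (simp add: tuple_def nth_append)
      then show ?thesis
        using tval_opp_Add[OF N, of "?s(?X := x)" ?X "?m + i"] x vs i by (simp add: subset_iff)
    qed
    have 3: "sat N (?s(?X := x)) (conjs (map (\<lambda>i. Not (inH z (Add (Var ?X) (Opp (Var (?m + i)))))) [0..<?l]))
       \<longleftrightarrow> (\<forall>y\<in>set vs. x \<ominus>\<^bsub>N\<^esub> y \<notin> Hset z N)" if x: "x \<in> carrier N" for x
    proof -
      have "sat N (?s(?X := x)) (conjs (map (\<lambda>i. Not (inH z (Add (Var ?X) (Opp (Var (?m + i)))))) [0..<?l]))
          \<longleftrightarrow> (\<forall>i<?l. tval N (?s(?X := x)) (Add (Var ?X) (Opp (Var (?m + i)))) \<notin> Hset z N)"
        unfolding sat_conjs by (auto simp del: tval.simps)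
      also have "\<dots> \<longleftrightarrow> (\<forall>i<?l. x \<ominus>\<^bsub>N\<^esub> vs ! i \<notin> Hset z N)" using 2[OF x] by simp
      finally show ?thesis using vs(1) by (simp add: all_set_conv_all_nth)
    qed
    have "holds N b (\<psi>, vs) \<longleftrightarrow> \<not> (\<exists>x\<in>carrier N. sat N (?s(?X := x)) (far_root_form z ts uss ?X (Suc ?X)) \<and>
       \<not> sat N (?s(?X := x)) (conjs (map (\<lambda>i. Not (inH z (Add (Var ?X) (Opp (Var (?m + i)))))) [0..<?l])))"
      unfolding holds_def \<psi>_def fst_conv snd_conv sat.simps ..
    then show ?thesis using 1 3 by blast
  qed
  let ?r = "map (term_rename Suc)"
  \<comment> \<open>The far roots as a formula in the root alone, with bs as parameters. Its
    solution set in K is finite, so all far roots over g(bs) in M come from K.\<close>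
  let ?\<chi> = "far_root_form z (?r ts) (map ?r uss) 0 (Suc ?m)"
  have \<chi>fo: "(?\<chi>, bs) \<in> formulas_over 1 (carrier K)"
  proof -
    have "free_vars ?\<chi> \<subseteq> insert 0 (Suc ` {..<?m})"
    proof (rule free_vars_far_root_form)
      show "term_vars t \<subseteq> Suc ` {..<?m}" if t: "t \<in> set (?r ts)" for t
        using t ts(2) by fastforce
      show "term_vars t \<subseteq> Suc ` {..<?m}" if t: "us \<in> set (map ?r uss)" "t \<in> set us" for us t
        using t uss by fastforce
    qed (use ts in simp)
    then show ?thesis using bs by (auto simp: formulas_over_def)
  qed
  have \<chi>holds: "holds N [x] (?\<chi>, b) \<longleftrightarrow> far_root z N (tuple N b) ts uss x"
    if N: "is_model N (T_G p)" and b: "length b = ?m" "set b \<subseteq> carrier N" and x: "x \<in> carrier N"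
    for N :: "'a LG_struct" and b x
  proof -
    interpret N: field N by (rule is_model_T_G_imp(1)[OF N])
    let ?s = "tuple N ([x] @ b)"
    have sc: "?s i \<in> carrier N" for i by (rule tuple_closed) (use b x in auto)
    have "sat N ?s ?\<chi> \<longleftrightarrow> far_root z N ?s (?r ts) (map ?r uss) (?s 0)"
    proof (rule sat_far_root_form[OF N sc])
      show "Suc ?m \<notin> term_vars t" if t: "us \<in> set (map ?r uss)" "t \<in> set us" for us t
        using t uss by fastforce
    qed simp
    also have "?s 0 = x" by (simp add: tuple_def)
    also have "far_root z N ?s (?r ts) (map ?r uss) x \<longleftrightarrow> far_root z N (\<lambda>i. ?s (Suc i)) ts uss x"
      by (rule far_root_rename[OF ts(1)])
    also have "(\<lambda>i. ?s (Suc i)) = tuple N b" by (auto simp: tuple_def)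
    finally show ?thesis by (simp add: holds_def)
  qed
  have gbs: "length (map g bs) = ?m" "set (map g bs) \<subseteq> carrier M" using bs fc by auto
  have \<psi>M: "holds M (map g bs) (\<psi>, map f ys)"
  proof (subst \<psi>holds[OF MT gbs], simp, use ys Y fc in force, intro ballI impI)
    fix x y assume x: "x \<in> carrier M" "far_root z M (tuple M (map g bs)) ts uss x" and y: "y \<in> set (map f ys)"
    have "holds M [x] (map_params g (?\<chi>, bs))"
      using \<chi>holds[OF MT gbs x(1)] x(2) by (simp add: map_params_def)
    moreover have "{y \<in> carrier K. holds K [y] (?\<chi>, bs)} = {y \<in> carrier K. far_root z K (tuple K bs) ts uss y}"
      using \<chi>holds[OF model_T_G refl bs] by blast
    moreover have "finite {y \<in> carrier K. far_root z K (tuple K bs) ts uss y}"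
      by (rule finite_far_roots[OF tuple_closed[OF bs zero_closed] ts(1)])
    ultimately have "x \<in> g ` {y \<in> carrier K. far_root z K (tuple K bs) ts uss y}"
      using elementary_finite_set[OF el(2) zero_closed \<chi>fo _ x(1)] by simp
    then obtain a where a: "a \<in> carrier K" "far_root z K (tuple K bs) ts uss a" "x = g a" by blast
    obtain c where c: "c \<in> carrier K" "y = f c" using y ys Y by auto
    show "x \<ominus>\<^bsub>M\<^esub> y \<notin> Hset z M"
    proof
      assume h: "x \<ominus>\<^bsub>M\<^esub> y \<in> Hset z M"
      \<comment> \<open>For H = 0 congruence means g(a) = f(c), so a itself is in alg(C); for H = G
        the last clause of the amalgam applies.\<close>
      have "\<exists>w\<in>alg K C. a \<oplus> w \<in> Hset z K"
      proof (cases z)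
        case True
        then have "f c = g a" using h a c fc M.r_right_minus_eq by (simp add: Hset_def)
        from disj[OF c(1) a(1) this] have "a \<in> alg K C" by metis
        then have "\<ominus> a \<in> alg K C" using subringE(5)[OF subfieldE(1)[OF subfield_alg[OF C(1)]]] by blast
        then show ?thesis using True a(1) by (intro bexI[of _ "\<ominus> a"]) (auto simp: Hset_def r_neg)
      next
        case False
        then show ?thesis using Gdisj[OF c(1) a(1)] h a(3) c(2) by (simp add: Hset_def)
      qed
      then show False using far[OF a(1,2)] by blast
    qed
  qed
  let ?S = "insert (\<psi>, ys) (tp K bs C)"
  have CY: "C \<union> Y \<subseteq> carrier K" using C Y by blast
  have Sfo: "?S \<subseteq> formulas_over ?m (C \<union> Y)"
    using \<psi>fo by (auto simp: tp_def formulas_over_def)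
  have "\<exists>xs. length xs = ?m \<and> set xs \<subseteq> carrier K \<and> (\<forall>\<Phi>\<in>?S. holds K xs \<Phi>)"
  proof (rule saturated_tuples[OF \<kappa>(3,1,2) CY card_Un_finite_less[OF \<kappa>(1,2) C(2) Y(1)] Sfo])
    fix \<Sigma>' assume S': "finite \<Sigma>'" "\<Sigma>' \<subseteq> ?S"
    have S'fo: "\<Sigma>' \<subseteq> formulas_over ?m (C \<union> Y)" using S' Sfo by blast
    obtain \<Theta> where \<Theta>: "\<Theta> \<in> formulas_over ?m (C \<union> Y)"
      "\<And>(M::'a LG_struct) f xs. length xs = ?m \<Longrightarrow>
       holds M xs (map_params f \<Theta>) \<longleftrightarrow> (\<forall>\<Phi>\<in>\<Sigma>'. holds M xs (map_params f \<Phi>))"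
      by (rule finite_conj_formula[OF S'(1) S'fo]) (rule that, assumption+)
    have "holds M (map g bs) (map_params f \<Phi>)" if \<Phi>: "\<Phi> \<in> \<Sigma>'" for \<Phi>
    proof (cases "\<Phi> = (\<psi>, ys)")
      case True
      then show ?thesis using \<psi>M by (simp add: map_params_def)
    next
      case False
      then have tp: "\<Phi> \<in> tp K bs C" using \<Phi> S'(2) by blast
      \<comment> \<open>Formulas in the type of bs have their parameters in C, where f and g agree;
        read along f, they therefore hold of g(bs) in M.\<close>
      have "f a = g a" if "a \<in> C" for a using fg alg_extensive[OF C(1)] that by blast
      then have eq: "map_params f \<Phi> = map_params g \<Phi>"
        using tp by (auto simp: map_params_def tp_def formulas_over_def subset_iff)
      have "\<Phi> \<in> formulas_over ?m (carrier K)" using tp C(1) by (auto simp: tp_def formulas_over_def)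
      then show ?thesis unfolding eq
        using elementary_holds[OF el(2) bs zero_closed] tp by (simp add: tp_def)
    qed
    then have "holds M (map g bs) (map_params f \<Theta>)" using \<Theta>(2)[OF gbs(1)] by blast
    moreover have "\<Theta> \<in> formulas_over ?m (carrier K)" using \<Theta>(1) CY by (auto simp: formulas_over_def)
    ultimately obtain vs where vs: "length vs = ?m" "set vs \<subseteq> carrier K" "holds K vs \<Theta>"
      using elementary_pullback[OF el(1) zero_closed _ gbs] by blast
    have "\<forall>\<Phi>\<in>\<Sigma>'. holds K vs \<Phi>" using \<Theta>(2)[of vs K "\<lambda>x. x"] vs by simp
    then show "\<exists>xs. length xs = ?m \<and> set xs \<subseteq> carrier K \<and> (\<forall>\<Phi>\<in>\<Sigma>'. holds K xs \<Phi>)"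
      using vs by blast
  qed
  then obtain b where b: "length b = ?m" "set b \<subseteq> carrier K" "holds K b (\<psi>, ys)"
    "\<And>\<Phi>. \<Phi> \<in> tp K bs C \<Longrightarrow> holds K b \<Phi>" by blast
  \<comment> \<open>Types are complete, so it is enough that b satisfies the type of bs.\<close>
  have "tp K b C = tp K bs C"
  proof
    show "tp K bs C \<subseteq> tp K b C" using b by (auto simp: tp_def)
    show "tp K b C \<subseteq> tp K bs C"
    proof
      fix \<Phi> assume \<Phi>: "\<Phi> \<in> tp K b C"
      obtain \<phi> cs where eq: "\<Phi> = (\<phi>, cs)" by (cases \<Phi>)
      have fo: "\<Phi> \<in> formulas_over ?m C" "holds K b \<Phi>" using \<Phi> b(1) by (auto simp: tp_def)
      show "\<Phi> \<in> tp K bs C"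
      proof (rule ccontr)
        assume "\<Phi> \<notin> tp K bs C"
        then have "(Not \<phi>, cs) \<in> tp K bs C" using fo by (auto simp: tp_def eq formulas_over_def holds_def)
        then have "holds K b (Not \<phi>, cs)" by (rule b(4))
        then show False using fo(2) by (simp add: holds_def eq)
      qed
    qed
  qed
  moreover have "set ys \<subseteq> carrier K" using ys Y by simp
  then have "\<forall>x\<in>carrier K. far_root z K (tuple K b) ts uss x \<longrightarrow> (\<forall>y\<in>Y. x \<ominus> y \<notin> Hset z K)"
    using \<psi>holds[OF model_T_G b(1,2) refl] b(3) ys by simp
  ultimately show thesis using that[OF b(1,2)] by blast
qed

lemma Hset_diff:
  assumes "x \<in> carrier K" "a \<in> carrier K" "b \<in> carrier K" "x \<ominus> a \<in> Hset z K" "x \<ominus> b \<in> Hset z K"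
  shows "a \<ominus> b \<in> Hset z K"
proof -
  have eq: "a \<ominus> b = \<ominus> (x \<ominus> a) \<oplus> (x \<ominus> b)" using assms(1-3) by algebra
  show ?thesis
  proof (cases z)
    case True
    then show ?thesis using assms(4,5) unfolding eq by (simp add: Hset_def)
  next
    case False
    then show ?thesis using assms(4,5) unfolding eq by (simp add: Hset_def)
  qed
qed

text \<open>
  Let u be a root of a polynomial q over A and C, and v a root of a polynomial over B and C.
  If v is far from acl(C), the formula saying that some root of q(x, y) is congruent modulo H
  to a far root over b has tuples b of the same type over C for which it is k-inconsistent:
  a common solution x yields more than deg q roots y which are pairwise different, as the far
  roots over different b are incongruent.
\<close>

theorem indep_d_congruence:
  fixes \<kappa> :: "'c rel"
  assumes \<kappa>: "Card_order \<kappa>" "natLeq <o \<kappa>" "saturated \<kappa> K"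
    and A: "A \<subseteq> carrier K" and B: "B \<subseteq> carrier K" and C: "C \<subseteq> carrier K" "|C| <o \<kappa>"
    and ind: "indep_d K A C B"
    and u: "u \<in> alg K (A \<union> C)" and v: "v \<in> alg K (B \<union> C)" and uv: "u \<ominus> v \<in> Hset z K"
  shows "\<exists>w\<in>alg K C. v \<oplus> w \<in> Hset z K"
proof (rule ccontr)
  assume "\<not> ?thesis"
  then have nv: "v \<oplus> w \<notin> Hset z K" if "w \<in> alg K C" for w using that by blast
  have AC: "A \<union> C \<subseteq> carrier K" and BC: "B \<union> C \<subseteq> carrier K" using A B C by auto
  have uvc: "u \<in> carrier K" "v \<in> carrier K" using u v alg_carrier by auto
  obtain ts1 s1 where 1: "\<And>t i. t \<in> set ts1 \<Longrightarrow> i \<in> term_vars t \<Longrightarrow> s1 i \<in> A \<union> C" "ts1 \<noteq> []"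
    "tval K s1 (hd ts1) \<noteq> \<zero>" "eval (map (tval K s1) ts1) u = \<zero>"
    by (rule alg_poly[OF AC u]) (rule that, assumption+)
  obtain ts2 s2 where 2: "\<And>t i. t \<in> set ts2 \<Longrightarrow> i \<in> term_vars t \<Longrightarrow> s2 i \<in> B \<union> C" "ts2 \<noteq> []"
    "tval K s2 (hd ts2) \<noteq> \<zero>" "eval (map (tval K s2) ts2) v = \<zero>"
    by (rule alg_poly[OF BC v]) (rule that, assumption+)
  define Z where "Z = {x \<in> carrier K. eval (map (tval K s2) ts2) x = \<zero>}"
  have finZ: "finite Z"
  proof -
    have "tval K s2 t \<in> carrier K" if "t \<in> set ts2" for t
      by (rule tval_closed[OF struct]) (use 2(1)[OF that] BC in blast)
    then show ?thesis unfolding Z_def by (intro finite_roots) (use 2 in \<open>auto simp: hd_map\<close>)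
  qed
  \<comment> \<open>One witness in alg(C) is fixed for each root of the polynomial for v that has
    one. These finitely many witnesses will decide which roots are far.\<close>
  define wit where "wit x = (SOME w. w \<in> alg K C \<and> x \<oplus> w \<in> Hset z K)" for x
  have wit: "wit x \<in> alg K C \<and> x \<oplus> wit x \<in> Hset z K" if "w \<in> alg K C" "x \<oplus> w \<in> Hset z K" for x w
    unfolding wit_def by (rule someI[of _ w]) (use that in simp)
  define W where "W = wit ` {x \<in> Z. \<exists>w\<in>alg K C. x \<oplus> w \<in> Hset z K}"
  have W: "finite W" "W \<subseteq> alg K C" using finZ wit by (auto simp: W_def)
  define Q where "Q w us s \<longleftrightarrow> (\<forall>t\<in>set us. \<forall>i\<in>term_vars t. s i \<in> C) \<and> us \<noteq> [] \<and>
    tval K s (hd us) \<noteq> \<zero> \<and> eval (map (tval K s) us) w = \<zero>" for w us s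
  have "\<exists>us s. w \<in> W \<longrightarrow> Q w us s" for w
  proof (cases "w \<in> W")
    case True
    then have "w \<in> alg K C" using W by blast
    then obtain us s where "\<And>t i. t \<in> set us \<Longrightarrow> i \<in> term_vars t \<Longrightarrow> s i \<in> C" "us \<noteq> []"
      "tval K s (hd us) \<noteq> \<zero>" "eval (map (tval K s) us) w = \<zero>"
      by (rule alg_poly[OF C(1)]) (rule that, assumption+)
    then have "Q w us s" unfolding Q_def by blast
    then show ?thesis by blast
  qed blast
  then obtain us sw where "\<And>w. w \<in> W \<Longrightarrow> Q w (us w) (sw w)" by metis
  then have usw: "\<And>t i. t \<in> set (us w) \<Longrightarrow> i \<in> term_vars t \<Longrightarrow> sw w i \<in> C" "us w \<noteq> []"
    "tval K (sw w) (hd (us w)) \<noteq> \<zero>" "eval (map (tval K (sw w)) (us w)) w = \<zero>" if "w \<in> W" for w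
    using that unfolding Q_def by blast+
  obtain ws where ws: "set ws = W" using finite_list[OF W(1)] by blast
  let ?V1 = "\<Union>t\<in>set ts1. term_vars t" and ?V2 = "\<Union>t\<in>set ts2. term_vars t"
  \<comment> \<open>The tuple bs also takes the elements of C that occur in the polynomial for u, so
    that the remaining ones, collected in \<open>as\<close>, all lie in A.\<close>
  let ?B = "s2 ` ?V2 \<union> (\<Union>w\<in>W. sw w ` (\<Union>t\<in>set (us w). term_vars t)) \<union> s1 ` ?V1 \<inter> C"
  have "finite ?B" using W(1) by auto
  from finite_list[OF this] obtain bs where bs: "set bs = ?B" by (elim exE) (rule that)
  have "finite (s1 ` ?V1 - C)" by auto
  from finite_list[OF this] obtain as where as: "set as = s1 ` ?V1 - C" by (elim exE) (rule that)
  let ?n = "length as" and ?m = "length bs"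
  have asA: "set as \<subseteq> A" using as 1(1) by auto
  have bsBC: "set bs \<subseteq> B \<union> C"
  proof -
    have "s2 ` ?V2 \<subseteq> B \<union> C" using 2(1) by blast
    moreover have "(\<Union>w\<in>W. sw w ` (\<Union>t\<in>set (us w). term_vars t)) \<subseteq> C" using usw(1) by blast
    ultimately show ?thesis unfolding bs by blast
  qed
  have asK: "set as \<subseteq> carrier K" and bsK: "set bs \<subseteq> carrier K" using asA A bsBC BC by auto
  have "\<exists>j. x \<in> set bs \<longrightarrow> j < ?m \<and> bs ! j = x" for x using nth_position[of x bs] by blast
  then obtain pb where pb: "\<And>x. x \<in> set bs \<Longrightarrow> pb x < ?m \<and> bs ! pb x = x" by metis
  have "\<exists>j. x \<in> set as \<longrightarrow> j < ?n \<and> as ! j = x" for x using nth_position[of x as] by blast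
  then obtain pa where pa: "\<And>x. x \<in> set as \<Longrightarrow> pa x < ?n \<and> as ! pa x = x" by metis
  define ts where "ts = map (term_rename (\<lambda>i. pb (s2 i))) ts2"
  define uss where "uss = map (\<lambda>w. map (term_rename (\<lambda>i. pb (sw w i))) (us w)) ws"
  define r1 where "r1 i = (if s1 i \<in> C then ?n + pb (s1 i) else pa (s1 i))" for i
  define qs where "qs = map (term_rename r1) ts1"
  have tsn: "ts \<noteq> []" and qsn: "qs \<noteq> []" using 1(2) 2(2) by (auto simp: ts_def qs_def)
  have B2: "s2 i \<in> set bs" if "t \<in> set ts2" "i \<in> term_vars t" for t i using that unfolding bs by blast
  have Bw: "sw w i \<in> set bs" if "w \<in> W" "t \<in> set (us w)" "i \<in> term_vars t" for w t i
    using that unfolding bs by blast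
  have B1: "s1 i \<in> set bs" if "t \<in> set ts1" "i \<in> term_vars t" "s1 i \<in> C" for t i
    using that unfolding bs by blast
  have A1: "s1 i \<in> set as" if "t \<in> set ts1" "i \<in> term_vars t" "s1 i \<notin> C" for t i
    using that unfolding as by blast
  have tsv: "term_vars t \<subseteq> {..<?m}" if "t \<in> set ts" for t
    using that pb B2 unfolding ts_def by auto
  have ussv: "term_vars t \<subseteq> {..<?m}" if us: "us' \<in> set uss" "t \<in> set us'" for us' t
  proof -
    obtain w where w: "w \<in> W" "us' = map (term_rename (\<lambda>i. pb (sw w i))) (us w)"
      using us(1) ws unfolding uss_def by auto
    then show ?thesis using us(2) pb Bw[OF w(1)] by auto
  qed
  have r1: "r1 i < ?n + ?m" if "t \<in> set ts1" "i \<in> term_vars t" for t i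
    using pb[OF B1[OF that]] pa[OF A1[OF that]] unfolding r1_def by (auto simp: trans_less_add1)
  have qsv: "term_vars t \<subseteq> {..<?n + ?m}" if "t \<in> set qs" for t
    using that r1 unfolding qs_def by auto
  have val2: "map (tval K (tuple K bs)) ts = map (tval K s2) ts2"
  proof -
    have "tval K (\<lambda>i. tuple K bs (pb (s2 i))) t = tval K s2 t" if "t \<in> set ts2" for t
      by (rule tval_cong) (use pb[OF B2[OF that]] in \<open>simp add: tuple_def\<close>)
    then show ?thesis by (simp add: ts_def)
  qed
  have hd2: "tval K (tuple K bs) (hd ts) \<noteq> \<zero>"
    using val2 2(2,3) tsn by (metis hd_map)
  have valw: "map (tval K (tuple K bs)) (map (term_rename (\<lambda>i. pb (sw w i))) (us w)) = map (tval K (sw w)) (us w)"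
    if w: "w \<in> W" for w
  proof -
    have "tval K (\<lambda>i. tuple K bs (pb (sw w i))) t = tval K (sw w) t" if "t \<in> set (us w)" for t
      by (rule tval_cong) (use pb[OF Bw[OF w that]] in \<open>simp add: tuple_def\<close>)
    then show ?thesis by simp
  qed
  have val1: "map (tval K (tuple K (as @ bs))) qs = map (tval K s1) ts1"
  proof -
    have "tval K (\<lambda>i. tuple K (as @ bs) (r1 i)) t = tval K s1 t" if t: "t \<in> set ts1" for t
    proof (rule tval_cong)
      fix i assume i: "i \<in> term_vars t"
      show "tuple K (as @ bs) (r1 i) = s1 i"
        using pb[OF B1[OF t i]] pa[OF A1[OF t i]] by (auto simp: r1_def tuple_def nth_append)
    qed
    then show ?thesis by (simp add: qs_def)
  qed
  have hd1: "tval K (tuple K (as @ bs)) (hd qs) \<noteq> \<zero>"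
    using val1 1(2,3) qsn by (metis hd_map)
  \<comment> \<open>If x had any witness w in alg(C), its chosen witness would be in W and hence a
    root of a polynomial from \<open>uss\<close>, which \<open>far_root\<close> excludes.\<close>
  have far: "x \<oplus> w \<notin> Hset z K"
    if x: "x \<in> carrier K" and fr: "far_root z K (tuple K bs) ts uss x" and w: "w \<in> alg K C" for x w
  proof
    assume h: "x \<oplus> w \<in> Hset z K"
    have "x \<in> Z" using fr x unfolding far_root_def val2 Z_def by blast
    then have wW: "wit x \<in> W" using h w unfolding W_def by blast
    let ?us = "map (term_rename (\<lambda>i. pb (sw (wit x) i))) (us (wit x))"
    have "?us \<in> set uss" using wW ws unfolding uss_def by auto
    moreover have "wit x \<in> carrier K" using wW W(2) alg_carrier by blast
    moreover have "eval (map (tval K (tuple K bs)) ?us) (wit x) = \<zero>"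
      unfolding valw[OF wW] by (rule usw(4)[OF wW])
    ultimately have "x \<oplus> wit x \<notin> Hset z K" using fr unfolding far_root_def by blast
    then show False using wit[OF w h] by blast
  qed
  \<comment> \<open>All roots of the witness polynomials lie in alg(C), and by assumption v has no
    witness in the whole of alg(C).\<close>
  have frv: "far_root z K (tuple K bs) ts uss v"
    unfolding far_root_def
  proof (intro conjI ballI impI)
    show "eval (map (tval K (tuple K bs)) ts) v = \<zero>" unfolding val2 by (rule 2(4))
    fix us' w assume us': "us' \<in> set uss" and w: "w \<in> carrier K"
      and ev: "eval (map (tval K (tuple K bs)) us') w = \<zero>"
    obtain w' where w': "w' \<in> W" "us' = map (term_rename (\<lambda>i. pb (sw w' i))) (us w')"
      using us' ws unfolding uss_def by auto
    have "eval (map (tval K (sw w')) (us w')) w = \<zero>" using ev unfolding w'(2) valw[OF w'(1)] .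
    then have "w \<in> alg K C"
      by (intro alg_polyI[OF C(1) usw(1)[OF w'(1)] usw(2,3)[OF w'(1)] w])
    then show "v \<oplus> w \<notin> Hset z K" by (rule nv)
  qed (rule hd2)
  let ?y = "?n + ?m"
  let ?x = "Suc ?y" and ?w = "Suc (Suc ?y)"
  let ?sh = "map (term_rename (\<lambda>i. ?n + i))"
  define \<chi> where "\<chi> = far_root_form z (?sh ts) (map ?sh uss) ?x ?w"
  define \<phi> where "\<phi> = Ex ?y (Ex ?x (conjs [Not (Eq (hd qs) Zero), Eq (poly_term qs (Var ?y)) Zero, \<chi>,
    inH z (Add (Var ?y) (Opp (Var ?x)))]))"
  have shv: "term_vars t \<subseteq> {?n..<?y}" if "t \<in> set (?sh ts)" for t
    using that tsv by fastforce
  have shv': "term_vars t \<subseteq> {?n..<?y}" if "us' \<in> set (map ?sh uss)" "t \<in> set us'" for us' t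
    using that ussv by fastforce
  have \<phi>fo: "(\<phi>, bs) \<in> formulas_over ?n (B \<union> C)"
  proof -
    have 1: "free_vars \<chi> \<subseteq> insert ?x {?n..<?y}"
      unfolding \<chi>_def by (rule free_vars_far_root_form) (use tsn shv shv' in auto)
    have 2: "term_vars (hd qs) \<subseteq> {..<?y}" using qsv[of "hd qs"] qsn by simp
    have "(\<Union>t\<in>set qs. term_vars t) \<subseteq> {..<?y}" using qsv by (rule UN_least)
    then have 3: "term_vars (poly_term qs (Var ?y)) \<subseteq> insert ?y {..<?y}"
      using term_vars_poly_term[of qs "Var ?y"] by simp blast
    have "free_vars \<phi> \<subseteq> {..<?y}" using 1 2 3 by (fastforce simp: \<phi>_def)
    then show ?thesis using bsBC by (simp add: formulas_over_def)
  qed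
  have \<phi>holds: "holds K xs (\<phi>, b) \<longleftrightarrow> (\<exists>y\<in>carrier K. \<exists>x\<in>carrier K.
      tval K (tuple K (xs @ b)) (hd qs) \<noteq> \<zero> \<and> eval (map (tval K (tuple K (xs @ b))) qs) y = \<zero> \<and>
      far_root z K (tuple K b) ts uss x \<and> y \<ominus> x \<in> Hset z K)"
    if xs: "length xs = ?n" "set xs \<subseteq> carrier K" and b: "length b = ?m" "set b \<subseteq> carrier K" for xs b
  proof -
    let ?s = "\<lambda>y x. (tuple K (xs @ b))(?y := y, ?x := x)"
    have tc: "tuple K (xs @ b) i \<in> carrier K" for i by (rule tuple_closed) (use xs b in auto)
    have "sat K (?s y x) (conjs [Not (Eq (hd qs) Zero), Eq (poly_term qs (Var ?y)) Zero, \<chi>,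
        inH z (Add (Var ?y) (Opp (Var ?x)))]) \<longleftrightarrow>
      tval K (tuple K (xs @ b)) (hd qs) \<noteq> \<zero> \<and> eval (map (tval K (tuple K (xs @ b))) qs) y = \<zero> \<and>
      far_root z K (tuple K b) ts uss x \<and> y \<ominus> x \<in> Hset z K"
      if y: "y \<in> carrier K" and x: "x \<in> carrier K" for y x
    proof -
      have sc: "?s y x i \<in> carrier K" for i using tc x y by simp
      have eq: "tval K (?s y x) t = tval K (tuple K (xs @ b)) t" if "t \<in> set qs" for t
        by (rule tval_cong) (use qsv[OF that] in auto)
      have h: "tval K (?s y x) (hd qs) = tval K (tuple K (xs @ b)) (hd qs)"
        by (rule eq) (use qsn in simp)
      have "tval K (?s y x) (poly_term qs (Var ?y)) = eval (map (tval K (?s y x)) qs) (tval K (?s y x) (Var ?y))"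
        by (intro tval_poly_term[OF field_axioms] tval_closed[OF struct] sc)
      also have "tval K (?s y x) (Var ?y) = y" by simp
      also have "map (tval K (?s y x)) qs = map (tval K (tuple K (xs @ b))) qs" using eq by simp
      finally have p: "tval K (?s y x) (poly_term qs (Var ?y)) = eval (map (tval K (tuple K (xs @ b))) qs) y" .
      have "sat K (?s y x) \<chi> \<longleftrightarrow> far_root z K (?s y x) (?sh ts) (map ?sh uss) (?s y x ?x)"
        unfolding \<chi>_def
      proof (rule sat_far_root_form[OF model_T_G sc])
        show "?w \<notin> term_vars t" if "us' \<in> set (map ?sh uss)" "t \<in> set us'" for us' t
          using shv'[OF that] by auto
      qed simp
      also have "?s y x ?x = x" by simp
      also have "far_root z K (?s y x) (?sh ts) (map ?sh uss) x \<longleftrightarrow> far_root z K (\<lambda>i. ?s y x (?n + i)) ts uss x"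
        by (rule far_root_rename[OF tsn])
      also have "\<dots> \<longleftrightarrow> far_root z K (tuple K b) ts uss x"
      proof -
        have e: "?s y x (?n + i) = tuple K b i" if "i < ?m" for i
          using that xs b by (simp add: tuple_def nth_append)
        show ?thesis by (rule far_root_cong[OF tsn]) (use tsv ussv e in blast)+
      qed
      finally have c: "sat K (?s y x) \<chi> \<longleftrightarrow> far_root z K (tuple K b) ts uss x" .
      have d: "tval K (?s y x) (Add (Var ?y) (Opp (Var ?x))) = y \<ominus> x"
        using tval_opp_Add[OF model_T_G, of "?s y x" ?y ?x] x y by simp
      show ?thesis unfolding sat_conjs
        by (simp only: list.set ball_simps sat.simps sat_inH h p c d tval.simps(2)) simp
    qed
    moreover have "holds K xs (\<phi>, b) \<longleftrightarrow> (\<exists>y\<in>carrier K. \<exists>x\<in>carrier K.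
      sat K (?s y x) (conjs [Not (Eq (hd qs) Zero), Eq (poly_term qs (Var ?y)) Zero, \<chi>,
        inH z (Add (Var ?y) (Opp (Var ?x)))]))"
      unfolding holds_def \<phi>_def fst_conv snd_conv sat.simps(5) ..
    ultimately show ?thesis by blast
  qed
  have "holds K as (\<phi>, bs)"
    unfolding \<phi>holds[OF refl asK refl bsK]
    using uvc hd1 val1 1(4) frv uv by (intro bexI[of _ u] bexI[of _ v]) auto
  then have \<phi>tp: "(\<phi>, bs) \<in> tp K as (B \<union> C)" using \<phi>fo by (simp add: tp_def)
  \<comment> \<open>The recursion step: b is a conjugate whose far roots are incongruent to the
    finitely many far roots over all earlier tuples.\<close>
  define P where "P h j b \<longleftrightarrow> length b = ?m \<and> set b \<subseteq> carrier K \<and> tp K b C = tp K bs C \<and>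
    (\<forall>i<j. \<forall>x\<in>carrier K. \<forall>y\<in>carrier K. far_root z K (tuple K b) ts uss x \<longrightarrow>
       far_root z K (tuple K (h i)) ts uss y \<longrightarrow> x \<ominus> y \<notin> Hset z K)" for h :: "nat \<Rightarrow> 'a list" and j b
  have "\<exists>h. \<forall>j. P h j (h j)"
  proof (rule dependent_wellorder_choice)
    show "P f j b = P g j b" if "\<And>i. i < j \<Longrightarrow> f i = g i" for b f g j
      using that unfolding P_def by (metis (no_types, lifting))
    fix j h assume IH: "\<And>i. i < j \<Longrightarrow> P h i (h i)"
    let ?Y = "\<Union>i\<in>{..<j}. {y \<in> carrier K. far_root z K (tuple K (h i)) ts uss y}"
    have "finite {y \<in> carrier K. far_root z K (tuple K (h i)) ts uss y}" if "i < j" for i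
      using IH[OF that] by (intro finite_far_roots tuple_closed tsn) (auto simp: P_def)
    then have Y: "finite ?Y" "?Y \<subseteq> carrier K" by auto
    obtain b where b: "length b = ?m" "set b \<subseteq> carrier K" "tp K b C = tp K bs C"
      "\<And>x y. x \<in> carrier K \<Longrightarrow> far_root z K (tuple K b) ts uss x \<Longrightarrow> y \<in> ?Y \<Longrightarrow> x \<ominus> y \<notin> Hset z K"
      by (rule exists_far_conjugate[OF \<kappa> C bsK tsn tsv ussv far Y]) (assumption+, rule that, assumption+)
    then have "P h j b" unfolding P_def by blast
    then show "\<exists>b. P h j b" by blast
  qed
  then obtain b where Pb: "\<And>j. P b j (b j)" by blast
  have b: "length (b j) = ?m" "set (b j) \<subseteq> carrier K" "tp K (b j) C = tp K bs C" for j
    using Pb[of j] by (auto simp: P_def)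
  have sep: "x \<ominus> y \<notin> Hset z K" if "i < j" "x \<in> carrier K" "y \<in> carrier K"
    "far_root z K (tuple K (b j)) ts uss x" "far_root z K (tuple K (b i)) ts uss y" for i j x y
    using Pb[of j] that unfolding P_def by blast
  \<comment> \<open>The type over C fixes the entries that lie in C. The polynomial for u takes only
    such entries from bs, so it is the same for all tuples of the sequence.\<close>
  have bC: "b j ! i = bs ! i" if i: "i < ?m" "bs ! i \<in> C" for i j
  proof -
    let ?\<Phi> = "(Eq (Var i) (Var ?m), [bs ! i])"
    have "?\<Phi> \<in> tp K bs C"
      using i by (auto simp: tp_def formulas_over_def holds_def tuple_def nth_append)
    then have "?\<Phi> \<in> tp K (b j) C" using b(3) by simp
    then show ?thesis using i b(1)[of j] by (auto simp: tp_def holds_def tuple_def nth_append)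
  qed
  \<comment> \<open>The polynomial for u has at most \<open>length ts1\<close> roots, so among this
    many tuples two share the same root y.\<close>
  let ?k = "Suc (length ts1)"
  have incons: False
    if I: "finite I" "card I = ?k" and xs: "length xs = ?n" "set xs \<subseteq> carrier K"
      and h: "\<And>i. i \<in> I \<Longrightarrow> holds K xs (\<phi>, b i)" for I xs
  proof -
    have sol: "\<exists>y x. y \<in> carrier K \<and> x \<in> carrier K \<and>
      tval K (tuple K (xs @ b i)) (hd qs) \<noteq> \<zero> \<and> eval (map (tval K (tuple K (xs @ b i))) qs) y = \<zero> \<and>
      far_root z K (tuple K (b i)) ts uss x \<and> y \<ominus> x \<in> Hset z K" if "i \<in> I" for i
      using h[OF that] unfolding \<phi>holds[OF xs b(1,2)] by blast
    have same: "tval K (tuple K (xs @ b i)) t = tval K (tuple K (xs @ bs)) t" if t: "t \<in> set qs" for i t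
    proof (rule tval_cong)
      fix k assume k: "k \<in> term_vars t"
      obtain t1 where t1: "t1 \<in> set ts1" "t = term_rename r1 t1" using t unfolding qs_def by auto
      then obtain l where l: "l \<in> term_vars t1" "k = r1 l" using k by auto
      show "tuple K (xs @ b i) k = tuple K (xs @ bs) k"
      proof (cases "s1 l \<in> C")
        case True
        then have "k = ?n + pb (s1 l)" "pb (s1 l) < ?m" "bs ! pb (s1 l) \<in> C"
          using l pb[OF B1[OF t1(1) l(1) True]] by (auto simp: r1_def)
        then show ?thesis using bC[of "pb (s1 l)" i] b(1)[of i] xs(1) by (simp add: tuple_def nth_append)
      next
        case False
        then have "k < ?n" using l pa[OF A1[OF t1(1) l(1) False]] by (simp add: r1_def)
        then show ?thesis using xs(1) by (simp add: tuple_def nth_append)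
      qed
    qed
    have same_map: "map (tval K (tuple K (xs @ b i))) qs = map (tval K (tuple K (xs @ bs))) qs" for i
      using same by simp
    have same_hd: "tval K (tuple K (xs @ b i)) (hd qs) = tval K (tuple K (xs @ bs)) (hd qs)" for i
      using same qsn by simp
    let ?R = "{y \<in> carrier K. eval (map (tval K (tuple K (xs @ bs))) qs) y = \<zero>}"
    have "I \<noteq> {}" using I by auto
    then have nz: "tval K (tuple K (xs @ bs)) (hd qs) \<noteq> \<zero>" using sol unfolding same_hd by blast
    have tc: "tuple K (xs @ bs) i \<in> carrier K" for i by (rule tuple_closed) (use xs bsK in auto)
    have R: "finite ?R" "card ?R \<le> length ts1"
      using finite_eval_roots[OF tc qsn nz] by (auto simp: qs_def)
    define V where "V i y x \<longleftrightarrow> y \<in> ?R \<and> x \<in> carrier K \<and>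
      far_root z K (tuple K (b i)) ts uss x \<and> y \<ominus> x \<in> Hset z K" for i y x
    have "\<exists>y x. V i y x" if "i \<in> I" for i
      using sol[OF that] unfolding same_map V_def by blast
    then obtain y x where "\<And>i. i \<in> I \<Longrightarrow> V i (y i) (x i)" by metis
    then have yx: "y i \<in> ?R \<and> x i \<in> carrier K \<and>
      far_root z K (tuple K (b i)) ts uss (x i) \<and> y i \<ominus> x i \<in> Hset z K" if "i \<in> I" for i
      using that unfolding V_def by blast
    have "card (y ` I) \<le> card ?R" by (rule card_mono[OF R(1)]) (use yx in blast)
    then have "card (y ` I) < card I" using R(2) I by simp
    then have "\<not> inj_on y I" using card_image by fastforce
    then obtain i j where ij: "i \<in> I" "j \<in> I" "i < j" "y i = y j"
      unfolding inj_on_def by (metis linorder_neqE_nat)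
    \<comment> \<open>Both far roots are congruent to the common y and hence to each other, which
      the choice of the later tuple excludes.\<close>
    have "y j \<ominus> x i \<in> Hset z K" using yx[OF ij(1)] ij(4) by simp
    then have "x j \<ominus> x i \<in> Hset z K"
      using Hset_diff[of "y j" "x j" "x i" z] yx[OF ij(1)] yx[OF ij(2)] by blast
    then show False using sep[OF ij(3), of "x j" "x i"] yx[OF ij(1)] yx[OF ij(2)] by blast
  qed
  have "formula_divides K ?n (\<phi>, bs) C"
    unfolding formula_divides_def prod.case
  proof (intro exI[of _ ?k] exI[of _ b] conjI allI impI notI)
    fix I assume "finite I \<and> card I = ?k"
      "\<exists>xs. length xs = ?n \<and> set xs \<subseteq> carrier K \<and> (\<forall>i\<in>I. holds K xs (\<phi>, b i))"
    then show False using incons by blast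
  qed (use b in auto)
  then show False using ind asA \<phi>tp unfolding indep_d_def by blast
qed

text \<open>Tuples with the same type over D have the same type over the smaller C, so a sequence
  that witnesses dividing over D also witnesses it over C; the set of parameters allowed in the
  formula is the same.\<close>

lemma indep_d_base_mono:
  assumes "indep_d K A C B" "C \<subseteq> D" "D \<subseteq> B \<union> C"
  shows "indep_d K A D B"
proof -
  have BD: "B \<union> D = B \<union> C" using assms by blast
  have "formula_divides K n \<Phi> C" if d: "formula_divides K n \<Phi> D" for n \<Phi>
  proof -
    obtain \<phi> bs where eq: "\<Phi> = (\<phi>, bs)" by (cases \<Phi>)
    define Q where "Q E k b \<longleftrightarrow>
      (\<forall>i. set (b i) \<subseteq> carrier K \<and> length (b i) = length bs \<and> tp K (b i) E = tp K bs E) \<and>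
      (\<forall>I. finite I \<and> card I = k \<longrightarrow>
        \<not> (\<exists>xs. length xs = n \<and> set xs \<subseteq> carrier K \<and> (\<forall>i\<in>I. holds K xs (\<phi>, b i))))"
      for E k and b :: "nat \<Rightarrow> 'a list"
    have div: "formula_divides K n \<Phi> E \<longleftrightarrow> (\<exists>k b. Q E k b)" for E
      unfolding formula_divides_def eq prod.case Q_def ..
    have restr: "tp K xs C = tp K xs D \<inter> formulas_over (length xs) C" for xs
      using assms(2) by (auto simp: tp_def formulas_over_def)
    have "Q C k b" if q: "Q D k b" for k b
    proof -
      have "tp K (b i) C = tp K bs C" for i using q unfolding Q_def restr by simp
      then show ?thesis using q unfolding Q_def by blast
    qed
    then show ?thesis using d unfolding div by blast
  qed
  then show ?thesis using assms(1) unfolding indep_d_def BD by blast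
qed

end

section \<open>Comparison of the independence relations\<close>

theorem mainTheorem6:
  fixes p :: nat and ACFG :: "LG_form set"
    and K :: "'a::infinite LG_struct" and \<kappa> :: "'c rel"
  assumes "Factorial_Ring.prime p"
    and "model_companion TYPE('a) (T_G p) ACFG"
    and "monster_model \<kappa> ACFG K"
  shows "ternary_eq \<kappa> K (indep_alg K) (upper_m (indep_a K)) \<and>
         ternary_eq \<kappa> K (upper_m (indep_a K)) (upper_M K (indep_a K)) \<and>
         ternary_imp \<kappa> K (indep_d K) (indep_K K) \<and>
         ternary_imp \<kappa> K (indep_K K) (upper_M K (indep_a K))"
proof -
  have \<kappa>: "Card_order \<kappa>" "natLeq <o \<kappa>" "saturated \<kappa> K" and "is_model K ACFG"
    using assms(3) by (auto simp: monster_model_def)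
  then interpret ACFG_model p ACFG K
    using assms(2) by unfold_locales
  have a_iff: "indep_a K A D B \<longleftrightarrow> alg K (A \<union> D) \<inter> alg K (B \<union> D) = alg K D"
    if "A \<subseteq> carrier K" "B \<subseteq> carrier K" "D \<subseteq> carrier K" for A B D
    using that by (simp add: indep_a_def acl_eq_alg)
  have alg_M: "upper_M K (indep_a K) A C B"
    if c: "A \<subseteq> carrier K" "B \<subseteq> carrier K" "C \<subseteq> carrier K" and ind: "indep_alg K A C B" for A B C
    unfolding upper_M_def
  proof (intro allI impI)
    fix D assume D: "C \<subseteq> D \<and> D \<subseteq> acl K (B \<union> C)"
    then have Dalg: "D \<subseteq> alg K (B \<union> C)" using c acl_eq_alg[of "B \<union> C"] by simp
    then have Dc: "D \<subseteq> carrier K" using alg_carrier by (rule subset_trans)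
    have "alg K (A \<union> D) \<inter> alg K (B \<union> D) = alg K D"
      by (rule indep_alg_imp_alg_Int[OF c ind _ Dalg]) (use D in simp)
    then show "indep_a K A D B" using a_iff[OF c(1,2) Dc] by simp
  qed
  have M_m: "upper_m (indep_a K) A C B"
    if c: "B \<subseteq> carrier K" "C \<subseteq> carrier K" and M: "upper_M K (indep_a K) A C B" for A B C
  proof -
    have "B \<union> C \<subseteq> acl K (B \<union> C)" using c acl_eq_alg[of "B \<union> C"] alg_extensive[of "B \<union> C"] by simp
    then show ?thesis using M unfolding upper_M_def upper_m_def by blast
  qed
  have m_alg: "indep_alg K A C B"
    if c: "A \<subseteq> carrier K" "B \<subseteq> carrier K" "C \<subseteq> carrier K" and m: "upper_m (indep_a K) A C B" for A B C
  proof (rule alg_Int_imp_indep_alg[OF c])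
    fix D assume D: "C \<subseteq> D" "D \<subseteq> B \<union> C"
    then have Dc: "D \<subseteq> carrier K" using c by blast
    have "indep_a K A D B" using m D unfolding upper_m_def by blast
    then show "alg K (A \<union> D) \<inter> alg K (B \<union> D) = alg K D"
      using a_iff[OF c(1,2) Dc] by simp
  qed
  have d_K: "indep_K K A C B"
    if small: "small \<kappa> K A" "small \<kappa> K B" "small \<kappa> K C" and d: "indep_d K A C B" for A B C
  proof -
    have c: "A \<subseteq> carrier K" "B \<subseteq> carrier K" "C \<subseteq> carrier K"
      and cB: "|B| <o \<kappa>" and cC: "|C| <o \<kappa>" using small by (auto simp: small_def)
    have cBC: "|B \<union> C| <o \<kappa>"
      by (rule card_of_Un_ordLess_infinite_Field[OF infinite_Field[OF \<kappa>(1,2)] \<kappa>(1) cB cC])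
    have "upper_m (indep_a K) A C B"
      unfolding upper_m_def
    proof (intro allI impI)
      fix D assume D: "C \<subseteq> D \<and> D \<subseteq> B \<union> C"
      then have Dc: "D \<subseteq> carrier K" using c by blast
      have cD: "|D| <o \<kappa>" using ordLeq_ordLess_trans[OF card_of_mono1 cBC] D by blast
      have dD: "indep_d K A D B" using indep_d_base_mono[OF d] D by blast
      have AD: "A \<union> D \<subseteq> carrier K" "B \<union> D \<subseteq> carrier K" using c Dc by auto
      have "alg K (A \<union> D) \<inter> alg K (B \<union> D) \<subseteq> alg K D"
      proof
        fix x assume x: "x \<in> alg K (A \<union> D) \<inter> alg K (B \<union> D)"
        then have xc: "x \<in> carrier K" using alg_carrier by blast
        \<comment> \<open>The congruence theorem is applied with H = 0 and u = v = x; the witness it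
          yields is the negative of x.\<close>
        then have "x \<ominus>\<^bsub>K\<^esub> x \<in> Hset True K" by (simp add: Hset_def a_minus_def r_neg)
        then obtain w where w: "w \<in> alg K D" "x \<oplus>\<^bsub>K\<^esub> w \<in> Hset True K"
          using indep_d_congruence[OF \<kappa> c(1,2) Dc cD dD] x by blast
        have "w \<in> carrier K" using w(1) alg_carrier by blast
        then have "x = \<ominus>\<^bsub>K\<^esub> w" using w(2) xc minus_equality[of x w] by (simp add: Hset_def)
        then show "x \<in> alg K D"
          using w(1) subringE(5)[OF subfieldE(1)[OF subfield_alg[OF Dc]]] by blast
      qed
      moreover have "alg K D \<subseteq> alg K (A \<union> D) \<inter> alg K (B \<union> D)"
        using alg_mono[OF Un_upper2 AD(1)] alg_mono[OF Un_upper2 AD(2)] by blast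
      ultimately show "indep_a K A D B" using a_iff[OF c(1,2) Dc] by blast
    qed
    then have ind: "indep_alg K A C B" by (rule m_alg[OF c])
    have ACc: "A \<union> C \<subseteq> carrier K" and BCc: "B \<union> C \<subseteq> carrier K" using c by auto
    note fA = subfieldE(1)[OF subfield_alg[OF ACc]] and fB = subfieldE(1)[OF subfield_alg[OF BCc]]
    have CA: "alg K C \<subseteq> alg K (A \<union> C)" "alg K C \<subseteq> alg K (B \<union> C)"
      using alg_mono[OF Un_upper2 ACc] alg_mono[OF Un_upper2 BCc] by auto
    have "g \<in> (Gset K \<inter> alg K (A \<union> C)) <+>\<^bsub>K\<^esub> (Gset K \<inter> alg K (B \<union> C))"
      if g: "g \<in> Gset K" "g \<in> alg K (A \<union> C) <+>\<^bsub>K\<^esub> alg K (B \<union> C)" for g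
    proof -
      obtain a b where ab: "a \<in> alg K (A \<union> C)" "b \<in> alg K (B \<union> C)" "g = a \<oplus>\<^bsub>K\<^esub> b"
        using g(2) by (auto simp: set_add_def')
      have abc: "a \<in> carrier K" "b \<in> carrier K" using ab alg_carrier by auto
      \<comment> \<open>The congruence theorem is applied with H = G, u = a and v = - b, which are
        congruent because a + b = g is in G.\<close>
      have "a \<ominus>\<^bsub>K\<^esub> (\<ominus>\<^bsub>K\<^esub> b) \<in> Hset False K" using g(1) ab(3) abc by (simp add: Hset_def a_minus_def)
      moreover have "\<ominus>\<^bsub>K\<^esub> b \<in> alg K (B \<union> C)" using subringE(5)[OF fB ab(2)] .
      ultimately have "\<exists>w\<in>alg K C. (\<ominus>\<^bsub>K\<^esub> b) \<oplus>\<^bsub>K\<^esub> w \<in> Hset False K"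
        using indep_d_congruence[OF \<kappa> c cC d ab(1)] by blast
      then obtain w where w: "w \<in> alg K C" "(\<ominus>\<^bsub>K\<^esub> b) \<oplus>\<^bsub>K\<^esub> w \<in> Gset K"
        unfolding Hset_def if_False by blast
      have wc: "w \<in> carrier K" using w(1) alg_carrier by blast
      \<comment> \<open>The decomposition of g is shifted by w in alg(C): - b + w is in G by the
        choice of w, so both b - w and a + w = g + (- b + w) are in G, and each stays in its
        closure.\<close>
      have "a \<oplus>\<^bsub>K\<^esub> w = g \<oplus>\<^bsub>K\<^esub> ((\<ominus>\<^bsub>K\<^esub> b) \<oplus>\<^bsub>K\<^esub> w)" unfolding ab(3) using abc wc by algebra
      then have "a \<oplus>\<^bsub>K\<^esub> w \<in> Gset K" using G.a_closed[OF g(1) w(2)] by metis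
      moreover have "a \<oplus>\<^bsub>K\<^esub> w \<in> alg K (A \<union> C)" using subringE(7)[OF fA ab(1)] w(1) CA by blast
      ultimately have 1: "a \<oplus>\<^bsub>K\<^esub> w \<in> Gset K \<inter> alg K (A \<union> C)" by blast
      have "b \<ominus>\<^bsub>K\<^esub> w = \<ominus>\<^bsub>K\<^esub> ((\<ominus>\<^bsub>K\<^esub> b) \<oplus>\<^bsub>K\<^esub> w)" using abc wc by algebra
      moreover have "b \<ominus>\<^bsub>K\<^esub> w \<in> alg K (B \<union> C)"
        using subringE(7)[OF fB ab(2)] subringE(5)[OF fB] w(1) CA unfolding a_minus_def by blast
      ultimately have 2: "b \<ominus>\<^bsub>K\<^esub> w \<in> Gset K \<inter> alg K (B \<union> C)"
        using G.a_inv_closed[OF w(2)] by (metis IntI)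
      have "g = (a \<oplus>\<^bsub>K\<^esub> w) \<oplus>\<^bsub>K\<^esub> (b \<ominus>\<^bsub>K\<^esub> w)" unfolding ab(3) using abc wc by algebra
      then show ?thesis using 1 2 unfolding set_add_def' by blast
    qed
    moreover have "(Gset K \<inter> alg K (A \<union> C)) <+>\<^bsub>K\<^esub> (Gset K \<inter> alg K (B \<union> C)) \<subseteq>
        Gset K \<inter> (alg K (A \<union> C) <+>\<^bsub>K\<^esub> alg K (B \<union> C))"
      by (auto simp: set_add_def')
    ultimately show ?thesis using ind unfolding indep_K_def by blast
  qed
  have sub: "A \<subseteq> carrier K" "B \<subseteq> carrier K" "C \<subseteq> carrier K"
    if "small \<kappa> K A \<and> small \<kappa> K B \<and> small \<kappa> K C" for A B C
    using that by (auto simp: small_def)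
  have "ternary_eq \<kappa> K (indep_alg K) (upper_m (indep_a K))"
    unfolding ternary_eq_def
  proof (intro allI impI)
    fix A B C assume "small \<kappa> K A \<and> small \<kappa> K B \<and> small \<kappa> K C"
    note c = sub[OF this]
    show "indep_alg K A C B \<longleftrightarrow> upper_m (indep_a K) A C B"
      using M_m[OF c(2,3) alg_M[OF c]] m_alg[OF c] by (rule iffI)
  qed
  moreover have "ternary_eq \<kappa> K (upper_m (indep_a K)) (upper_M K (indep_a K))"
    unfolding ternary_eq_def
  proof (intro allI impI)
    fix A B C assume "small \<kappa> K A \<and> small \<kappa> K B \<and> small \<kappa> K C"
    note c = sub[OF this]
    show "upper_m (indep_a K) A C B \<longleftrightarrow> upper_M K (indep_a K) A C B"
      using alg_M[OF c m_alg[OF c]] M_m[OF c(2,3)] by (rule iffI)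
  qed
  moreover have "ternary_imp \<kappa> K (indep_d K) (indep_K K)"
    unfolding ternary_imp_def using d_K by simp
  moreover have "ternary_imp \<kappa> K (indep_K K) (upper_M K (indep_a K))"
    unfolding ternary_imp_def
  proof (intro allI impI)
    fix A B C assume "small \<kappa> K A \<and> small \<kappa> K B \<and> small \<kappa> K C" and K: "indep_K K A C B"
    note c = sub[OF this(1)]
    show "upper_M K (indep_a K) A C B"
      by (rule alg_M[OF c]) (use K in \<open>simp add: indep_K_def\<close>)
  qed
  ultimately show ?thesis by simp
qed

end
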